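(* Let $u_0=u(\cdot;a_0,E_0,c_0)$ be a non-constant periodic traveling wave profile of $u_t=u_{xxx}+f(u)_x$ as described in the context. Assume that the Jacobian $\{T,M,P\}_{a,E,c}=\det\frac{\partial(T,M,P)}{\partial(a,E,c)}$ is non-zero at $(a_0,E_0,c_0)$, and that the matrix $\frac{\partial(\dot u)}{\partial(a,E,s)}\big|_{(a,E,s)=(a_0,E_0,0)}$ is nonsingular, where $\dot u=\dot u(a,E,s)\in\mathcal P$ denotes the class modulo translation of the wave $u(\cdot;a,E,c_0-s)$. If the $3\times 3$ matrix $$A(a,E,s)=\left(\frac{\partial(a-sM\omega,\,-sP\omega-2E,\,-s\omega)}{\partial(a,E,s)}\right)^{-1}\left(\frac{\partial(M\omega,P\omega,\omega)}{\partial(a,E,s)}\right)$$ has only simple real eigenvalues at $(a,E,s)=(a_0,E_0,0)$ (i.e. the Whitham system $\partial_t(M\omega,P\omega,\omega)-\partial_x(a-sM\omega,\,-sP\omega-2E,\,-s\omega)=0$ is strictly hyperbolic at $(a_0,E_0,0)$), then $u_0$ is modulationally stable: there is a neighborhood of the origin in $\mathbb C$ in which the $L^2(\mathbb R)$ spectrum of $\partial_x\mathcal L[u_0]$ is contained in the imaginary axis.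
   Context: **Profiles.** Let $f:\mathbb R\to\mathbb R$ be a (sufficiently smooth) nonlinearity, $F'=f$, $F(0)=0$, and $V(u;a,c)=F(u)-au-\frac c2u^2$. Traveling waves $u(x+ct)$ of $u_t=u_{xxx}+f(u)_x$ have profiles satisfying $u_{xxx}+f(u)_x-cu_x=0$, which integrates to $\frac{u_x^2}{2}=E-V(u;a,c)$ with constants $a,E$. Parameters $(a,E,c)$ are considered in an open set of $\mathbb R^3$ (containing $(a_0,E_0,c_0)$) on which there are simple roots $u_-<u_+$ of $E=V(\cdot;a,c)$ with $V(u;a,c)<E$ for $u\in(u_-,u_+)$; $u(\cdot;a,E,c)$ denotes the corresponding non-constant periodic profile, normalized by $u(0)=u_-$. **Period, mass, momentum.** The following are $C^1$ functions of $(a,E,c)$: $T(a,E,c)=\sqrt2\int_{u_-}^{u_+}\frac{du}{\sqrt{E-V(u;a,c)}}$ (the period of $u(\cdot;a,E,c)$), $M(a,E,c)=\int_0^T u(x)\,dx$, $P(a,E,c)=\int_0^T u(x)^2\,dx$. Put $\omega=1/T$. **Variables $(a,E,s)$.** With $c_0$ fixed, in expressions involving $(a,E,s)$ the functions $T,M,P,\omega$ are evaluated at $(a,E,c)=(a,E,c_0-s)$, and $\frac{\partial(g_1,g_2,g_3)}{\partial(a,E,s)}$ denotes the $3\times3$ Jacobian matrix. **The space $\mathcal P$.** $\mathcal T$ is the set of periodic traveling wave profiles (all translates of the $u(\cdot;a,E,c)$) and $\mathcal P=\mathcal T/\mathcal R$ is its quotient by translations ($u\,\mathcal R\,v$ iff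 $v=u(\cdot-\xi)$ for some $\xi\in\mathbb R$); $\mathcal P$ is locally a three-dimensional manifold. Nonsingularity of $\frac{\partial(\dot u)}{\partial(a,E,s)}$ at $(a_0,E_0,0)$ means that the differential at $(a_0,E_0,0)$ of the map $(a,E,s)\mapsto\dot u(a,E,s)\in\mathcal P$ is invertible, so that waves in $\mathcal P$ near $\dot u_0$ are coordinatized by $(a,E,s)$. **Linearized operator.** $\mathcal L[u_0]=-\partial_x^2-f'(u_0)+c_0$, and $\partial_x\mathcal L[u_0]$ is considered as an operator on $L^2(\mathbb R)$. *)

theory Defs
  imports
    "HOL-Analysis.Analysis"
    "HOL-Computational_Algebra.Polynomial"
begin

section \<open>Profiles\<close>

definition C2_fun :: "(real \<Rightarrow> real) \<Rightarrow> bool" where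
  "C2_fun f \<longleftrightarrow> (\<forall>x. f differentiable at x) \<and> (\<forall>x. deriv f differentiable at x)
     \<and> continuous_on UNIV (deriv (deriv f))"

definition potential :: "(real \<Rightarrow> real) \<Rightarrow> real \<Rightarrow> real \<Rightarrow> real \<Rightarrow> real" where
  "potential F a c v = F v - a * v - c / 2 * v\<^sup>2"

definition simple_root :: "(real \<Rightarrow> real) \<Rightarrow> real \<Rightarrow> bool" where
  "simple_root g r \<longleftrightarrow> g r = 0 \<and> deriv g r \<noteq> 0"

definition potential_well ::
  "(real \<Rightarrow> real) \<Rightarrow> real \<Rightarrow> real \<Rightarrow> real \<Rightarrow> real \<Rightarrow> real \<Rightarrow> bool" where
  "potential_well F a E c um up \<longleftrightarrow>
     um < up \<and>
     simple_root (\<lambda>v. E - potential F a c v) um \<and>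
     simple_root (\<lambda>v. E - potential F a c v) up \<and>
     (\<forall>v. um < v \<and> v < up \<longrightarrow> potential F a c v < E)"

text \<open>The third-order equation is required in addition to its first integral: the latter alone
  also admits solutions that rest at a turning point for a while.\<close>

definition periodic_profile ::
  "(real \<Rightarrow> real) \<Rightarrow> (real \<Rightarrow> real) \<Rightarrow> real \<Rightarrow> real \<Rightarrow> real \<Rightarrow> (real \<Rightarrow> real) \<Rightarrow> bool" where
  "periodic_profile f F a E c w \<longleftrightarrow>
     (\<forall>x. w differentiable at x) \<and>
     (\<forall>x. deriv w differentiable at x) \<and>
     (\<forall>x. deriv (deriv w) differentiable at x) \<and>
     (\<forall>x. deriv (deriv (deriv w)) x + deriv (\<lambda>y. f (w y)) x - c * deriv w x = 0) \<and>
     (\<forall>x. (deriv w x)\<^sup>2 / 2 = E - potential F a c (w x)) \<and>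
     \<not> w constant_on UNIV \<and>
     (\<exists>T>0. \<forall>x. w (x + T) = w x)"

section \<open>Period, mass, momentum\<close>

text \<open>Throughout, a parameter \<open>p :: real^3\<close> stands for \<open>(a, E, c)\<close>, and a variable
  \<open>q :: real^3\<close> for \<open>(a, E, s)\<close>; \<open>um\<close>, \<open>up\<close> and \<open>u\<close> give the turning points \<open>u\<^sub>-\<close>, \<open>u\<^sub>+\<close>
  and the profile as functions of \<open>p\<close>.\<close>

definition wave_period ::
  "(real \<Rightarrow> real) \<Rightarrow> (real^3 \<Rightarrow> real) \<Rightarrow> (real^3 \<Rightarrow> real) \<Rightarrow> real^3 \<Rightarrow> real" where
  "wave_period F um up p =
     sqrt 2 * integral {um p..up p} (\<lambda>v. 1 / sqrt (p$2 - potential F (p$1) (p$3) v))"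

definition wave_mass ::
  "(real \<Rightarrow> real) \<Rightarrow> (real^3 \<Rightarrow> real) \<Rightarrow> (real^3 \<Rightarrow> real) \<Rightarrow> (real^3 \<Rightarrow> real \<Rightarrow> real)
     \<Rightarrow> real^3 \<Rightarrow> real" where
  "wave_mass F um up u p = integral {0..wave_period F um up p} (u p)"

definition wave_momentum ::
  "(real \<Rightarrow> real) \<Rightarrow> (real^3 \<Rightarrow> real) \<Rightarrow> (real^3 \<Rightarrow> real) \<Rightarrow> (real^3 \<Rightarrow> real \<Rightarrow> real)
     \<Rightarrow> real^3 \<Rightarrow> real" where
  "wave_momentum F um up u p = integral {0..wave_period F um up p} (\<lambda>x. (u p x)\<^sup>2)"

definition wave_frequency ::
  "(real \<Rightarrow> real) \<Rightarrow> (real^3 \<Rightarrow> real) \<Rightarrow> (real^3 \<Rightarrow> real) \<Rightarrow> real^3 \<Rightarrow> real" where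
  "wave_frequency F um up p = 1 / wave_period F um up p"

definition TMP ::
  "(real \<Rightarrow> real) \<Rightarrow> (real^3 \<Rightarrow> real) \<Rightarrow> (real^3 \<Rightarrow> real) \<Rightarrow> (real^3 \<Rightarrow> real \<Rightarrow> real)
     \<Rightarrow> real^3 \<Rightarrow> real^3" where
  "TMP F um up u p =
     vector [wave_period F um up p, wave_mass F um up u p, wave_momentum F um up u p]"

definition C1_map_on :: "(real^'n) set \<Rightarrow> (real^'n \<Rightarrow> real^'m) \<Rightarrow> bool" where
  "C1_map_on S g \<longleftrightarrow>
     (\<forall>p\<in>S. g differentiable at p) \<and> continuous_on S (\<lambda>p. jacobian g (at p))"

section \<open>The Whitham system\<close>

definition aEc :: "real \<Rightarrow> real^3 \<Rightarrow> real^3" where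
  "aEc c0 q = vector [q$1, q$2, c0 - q$3]"

definition whitham_density ::
  "(real \<Rightarrow> real) \<Rightarrow> (real^3 \<Rightarrow> real) \<Rightarrow> (real^3 \<Rightarrow> real) \<Rightarrow> (real^3 \<Rightarrow> real \<Rightarrow> real)
     \<Rightarrow> real \<Rightarrow> real^3 \<Rightarrow> real^3" where
  "whitham_density F um up u c0 q =
     (let p = aEc c0 q; M = wave_mass F um up u p; P = wave_momentum F um up u p;
          \<omega> = wave_frequency F um up p
      in vector [M * \<omega>, P * \<omega>, \<omega>])"

definition whitham_flux ::
  "(real \<Rightarrow> real) \<Rightarrow> (real^3 \<Rightarrow> real) \<Rightarrow> (real^3 \<Rightarrow> real) \<Rightarrow> (real^3 \<Rightarrow> real \<Rightarrow> real)
     \<Rightarrow> real \<Rightarrow> real^3 \<Rightarrow> real^3" where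
  "whitham_flux F um up u c0 q =
     (let p = aEc c0 q; M = wave_mass F um up u p; P = wave_momentum F um up u p;
          \<omega> = wave_frequency F um up p; a = q$1; E = q$2; s = q$3
      in vector [a - s * M * \<omega>, - s * P * \<omega> - 2 * E, - s * \<omega>])"

text \<open>At \<open>s = 0\<close> the flux Jacobian has determinant \<open>2 * \<omega>\<close>, so \<open>matrix_inv\<close> below is applied
  to an invertible matrix where it is used.\<close>

definition whitham_matrix ::
  "(real \<Rightarrow> real) \<Rightarrow> (real^3 \<Rightarrow> real) \<Rightarrow> (real^3 \<Rightarrow> real) \<Rightarrow> (real^3 \<Rightarrow> real \<Rightarrow> real)
     \<Rightarrow> real \<Rightarrow> real^3 \<Rightarrow> real^3^3" where
  "whitham_matrix F um up u c0 q =
     matrix_inv (jacobian (whitham_flux F um up u c0) (at q))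
       ** jacobian (whitham_density F um up u c0) (at q)"

definition complex_matrix :: "real^'n^'m \<Rightarrow> complex^'n^'m" where
  "complex_matrix A = (\<chi> i j. complex_of_real (A$i$j))"

definition matrix_eigenvalue :: "complex^'n^'n \<Rightarrow> complex \<Rightarrow> bool" where
  "matrix_eigenvalue A z \<longleftrightarrow> (\<exists>v. v \<noteq> 0 \<and> A *v v = z *s v)"

definition characteristic_poly :: "complex^'n^'n \<Rightarrow> complex poly" where
  "characteristic_poly A = det (\<chi> i j. (if i = j then [:0, 1:] else 0) - [:A$i$j:])"

definition only_simple_real_eigenvalues :: "real^'n^'n \<Rightarrow> bool" where
  "only_simple_real_eigenvalues A \<longleftrightarrow>
     (\<forall>z. matrix_eigenvalue (complex_matrix A) z \<longrightarrow>
        z \<in> \<real> \<and> order z (characteristic_poly (complex_matrix A)) = 1)"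

section \<open>The space of waves modulo translation\<close>

definition traveling_waves :: "(real^3) set \<Rightarrow> (real^3 \<Rightarrow> real \<Rightarrow> real) \<Rightarrow> (real \<Rightarrow> real) set" where
  "traveling_waves \<Omega> u = {(\<lambda>x. u p (x - \<xi>)) | p \<xi>. p \<in> \<Omega>}"

definition translation_rel :: "((real \<Rightarrow> real) \<times> (real \<Rightarrow> real)) set" where
  "translation_rel = {(v, w). \<exists>\<xi>. w = (\<lambda>x. v (x - \<xi>))}"

definition wave_class :: "(real \<Rightarrow> real) \<Rightarrow> (real \<Rightarrow> real) set" where
  "wave_class w = translation_rel `` {w}"

text \<open>Waves of different periods are not close uniformly on the line, so differentiability of
  maps into the waves is understood in the topology of locally uniform convergence. The
  differential at \<open>q0\<close> is \<open>D\<close>, with \<open>D h\<close> a function of \<open>x\<close>.\<close>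

definition has_lu_differential ::
  "('a::real_normed_vector \<Rightarrow> real \<Rightarrow> real) \<Rightarrow> ('a \<Rightarrow> real \<Rightarrow> real) \<Rightarrow> 'a \<Rightarrow> bool" where
  "has_lu_differential U D q0 \<longleftrightarrow>
     (\<forall>x. bounded_linear (\<lambda>h. D h x)) \<and>
     (\<forall>K. compact K \<longrightarrow>
        uniform_limit K (\<lambda>q x. (U q x - U q0 x - D (q - q0) x) / norm (q - q0)) (\<lambda>_. 0) (at q0))"

definition tangent_vectors :: "(real \<Rightarrow> real) set \<Rightarrow> (real \<Rightarrow> real) \<Rightarrow> (real \<Rightarrow> real) set" where
  "tangent_vectors S w =
     {v. \<exists>\<gamma>::real \<Rightarrow> real \<Rightarrow> real. \<gamma> 0 = w \<and> (\<forall>t. \<gamma> t \<in> S)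
           \<and> has_lu_differential \<gamma> (\<lambda>t x. t * v x) 0}"

text \<open>The tangent space of the quotient by translations at the class of \<open>w\<close> is the tangent
  space of the set of waves at \<open>w\<close> modulo that of the class itself (a curve of translates);
  its elements are represented as cosets.\<close>

definition mod_translation :: "(real \<Rightarrow> real) \<Rightarrow> (real \<Rightarrow> real) \<Rightarrow> (real \<Rightarrow> real) set" where
  "mod_translation w v = {h. (\<lambda>x. h x - v x) \<in> tangent_vectors (wave_class w) w}"

definition quotient_tangent_space ::
  "(real \<Rightarrow> real) set \<Rightarrow> (real \<Rightarrow> real) \<Rightarrow> (real \<Rightarrow> real) set set" where
  "quotient_tangent_space S w = mod_translation w ` tangent_vectors S w"

definition nonsingular_mod_translation ::
  "(real \<Rightarrow> real) set \<Rightarrow> (real^3 \<Rightarrow> real \<Rightarrow> real) \<Rightarrow> real^3 \<Rightarrow> bool" where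
  "nonsingular_mod_translation S U q0 \<longleftrightarrow>
     (\<exists>D. has_lu_differential U D q0 \<and>
          bij_betw (\<lambda>h. mod_translation (U q0) (D h)) UNIV (quotient_tangent_space S (U q0)))"

section \<open>The linearized operator on square-integrable functions\<close>

text \<open>Elements of \<open>L\<^sup>2\<close> are represented by functions, and unbounded operators by their graphs.\<close>

definition L2 :: "(real \<Rightarrow> complex) set" where
  "L2 = {v. v \<in> borel_measurable lebesgue \<and> integrable lebesgue (\<lambda>x. (cmod (v x))\<^sup>2)}"

definition L2_norm :: "(real \<Rightarrow> complex) \<Rightarrow> real" where
  "L2_norm v = sqrt (integral\<^sup>L lebesgue (\<lambda>x. (cmod (v x))\<^sup>2))"

text \<open>The derivative with domain \<open>H\<^sup>1\<close>, whose elements are represented by their absolutely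
  continuous representatives.\<close>

definition dx :: "((real \<Rightarrow> complex) \<times> (real \<Rightarrow> complex)) set" where
  "dx = {(v, w). v \<in> L2 \<and> w \<in> L2 \<and> (\<forall>x y. x \<le> y \<longrightarrow> (w has_integral (v y - v x)) {x..y})}"

definition hessian_op ::
  "(real \<Rightarrow> real) \<Rightarrow> (real \<Rightarrow> real) \<Rightarrow> real \<Rightarrow> ((real \<Rightarrow> complex) \<times> (real \<Rightarrow> complex)) set" where
  "hessian_op f w c =
     {(v, g). \<exists>v1 v2. (v, v1) \<in> dx \<and> (v1, v2) \<in> dx \<and>
        g = (\<lambda>x. - v2 x - complex_of_real (deriv f (w x)) * v x + complex_of_real c * v x)}"

text \<open>The composition with \<open>dx\<close> has domain \<open>H\<^sup>3\<close>: since \<open>f' \<circ> w\<close> is bounded with bounded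
  derivative, \<open>v \<in> H\<^sup>2\<close> and \<open>\<L> v \<in> H\<^sup>1\<close> force \<open>v'' \<in> H\<^sup>1\<close>.\<close>

definition linearized_op ::
  "(real \<Rightarrow> real) \<Rightarrow> (real \<Rightarrow> real) \<Rightarrow> real \<Rightarrow> ((real \<Rightarrow> complex) \<times> (real \<Rightarrow> complex)) set" where
  "linearized_op f w c = hessian_op f w c O dx"

text \<open>The resolvent set consists of those \<open>z\<close> for which the operator minus \<open>z\<close> is a bijection
  from its domain onto \<open>L\<^sup>2\<close> with bounded inverse; the norm bound includes injectivity.\<close>

definition L2_resolvent_set ::
  "((real \<Rightarrow> complex) \<times> (real \<Rightarrow> complex)) set \<Rightarrow> complex set" where
  "L2_resolvent_set G =
     {z. (\<forall>g\<in>L2. \<exists>(v, h)\<in>G. AE x in lebesgue. h x - z * v x = g x) \<and>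
         (\<exists>C. \<forall>(v, h)\<in>G. L2_norm v \<le> C * L2_norm (\<lambda>x. h x - z * v x))}"

definition L2_spectrum ::
  "((real \<Rightarrow> complex) \<times> (real \<Rightarrow> complex)) set \<Rightarrow> complex set" where
  "L2_spectrum G = - L2_resolvent_set G"

definition modulationally_stable :: "(real \<Rightarrow> real) \<Rightarrow> (real \<Rightarrow> real) \<Rightarrow> real \<Rightarrow> bool" where
  "modulationally_stable f w c \<longleftrightarrow>
     (\<exists>N. open N \<and> 0 \<in> N \<and> L2_spectrum (linearized_op f w c) \<inter> N \<subseteq> {z. Re z = 0})"

end

theory Submission
  imports Defs "HOL-Computational_Algebra.Fundamental_Theorem_Algebra"
begin

text \<open>
  The equation \<open>\<partial>\<^sub>x \<L> v = \<mu> v\<close> is a linear system with periodic coefficients for \<open>(v, v', \<L> v)\<close>. If its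
  monodromy matrix has no eigenvalue on the unit circle, then the inhomogeneous problem reduces to a
  recursion on the square-summable sequences, which is uniquely solvable, so \<open>\<mu>\<close> is in the resolvent set.

  The derivatives of the wave in \<open>a\<close>, \<open>E\<close>, \<open>s\<close> and the translation mode give exact solutions up to a remainder
  of order \<open>\<mu>\<close>. In a basis in which the translation mode is scaled by \<open>1 / \<mu>\<close> the monodromy matrix is
  \<open>1 + \<mu> W(\<mu>)\<close>, with \<open>W\<close> Lipschitz in \<open>\<mu>\<close> and \<open>W(0)\<close> having the rows \<open>- \<nabla>M\<close>, \<open>\<nabla>P / 2\<close>, \<open>- \<nabla>T\<close>. The Whitham matrix is
  \<open>- \<omega> W(0)\<close>, so \<open>W(0)\<close> has simple, real and nonzero eigenvalues.

  The Hamiltonian structure maps a multiplier \<open>l\<close> for \<open>\<mu>\<close> to the multiplier \<open>1 / cnj l\<close> for \<open>- cnj \<mu>\<close>. On the unit circle the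
  two multipliers coincide, and a simple branch of \<open>W\<close> takes the same multiplier only once; hence
  \<open>\<mu> = - cnj \<mu>\<close>.
\<close>

section \<open>Linear ordinary differential equations\<close>

text \<open>At \<open>\<mu> = 0\<close> all three multipliers equal 1, and the monodromy matrix is
  in general not diagonalizable: the period varies with the parameters, so a variation of the wave
  is not periodic but picks up a multiple of \<open>u'\<close> over one period. Perturbing such a
  Jordan block would let the multipliers split in fractional powers of \<mu>. Dividing the
  translation mode by \<mu> moves this jump from order one to order \<mu>, where mass and momentum
  enter as well. The same division repairs the variation in \<open>s\<close>, for which
  \<open>\<L> \<phi>\<close> is \<open>u\<close> instead of a constant.

  No eigenvalue branch of \<open>W\<close> is constructed and no analyticity in \<mu> is needed:
  only the coefficients of its characteristic polynomial occur, and a compactness argument compares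
  two roots directly. Roots at \<mu> and \<open>- cnj \<mu>\<close> with a common multiplier differ
  by a multiple of \<open>\<mu> + cnj \<mu>\<close>, with a factor of order \<open>1 / \<mu>\<close>
  as long as the root stays away from 0. This is where \<open>{T, M, P}\<close> enters.

  Difference quotients of the wave converge only locally uniformly; their derivatives in
  \<open>x\<close> are recovered from the profile equation.\<close>

lemma gronwall:
  fixes Y Y' :: "real \<Rightarrow> 'a::real_inner"
  assumes "a \<le> b" and K: "0 \<le> K"
    and deriv: "\<And>x. a \<le> x \<Longrightarrow> x \<le> b \<Longrightarrow> (Y has_vector_derivative Y' x) (at x)"
    and bound: "\<And>x. a \<le> x \<Longrightarrow> x \<le> b \<Longrightarrow> norm (Y' x) \<le> K * norm (Y x) + C"
  shows "(norm (Y b))\<^sup>2 \<le> exp ((2 * K + 1) * (b - a)) * ((norm (Y a))\<^sup>2 + C\<^sup>2 * (b - a))"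
proof -
  \<comment> \<open>The squared norm is differentiable also where \<open>Y\<close> vanishes. The
    extra 1 absorbs the mixed term \<open>2 * C * norm (Y x)\<close> at the price of
    \<open>C\<^sup>2\<close>.\<close>
  define L where "L = 2 * K + 1"
  define g where "g x = exp (- L * (x - a)) * (Y x \<bullet> Y x) - C\<^sup>2 * (x - a)" for x
  have "g b \<le> g a"
  proof (rule DERIV_nonpos_imp_nonincreasing[OF \<open>a \<le> b\<close>])
    fix x assume x: "a \<le> x" "x \<le> b"
    have "(Y has_derivative (\<lambda>h. h *\<^sub>R Y' x)) (at x)"
      using deriv[OF x] by (simp add: has_vector_derivative_def)
    from has_derivative_inner[OF this this]
    have 1: "((\<lambda>x. Y x \<bullet> Y x) has_real_derivative (2 * (Y x \<bullet> Y' x))) (at x)"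
      by (rule has_derivative_imp_has_field_derivative) (simp add: inner_commute)
    have 2: "(g has_real_derivative exp (- L * (x - a)) * (2 * (Y x \<bullet> Y' x) - L * (Y x \<bullet> Y x)) - C\<^sup>2) (at x)"
      unfolding g_def by (rule derivative_eq_intros 1 refl)+ (simp add: algebra_simps)
    have "2 * (Y x \<bullet> Y' x) \<le> 2 * (norm (Y x) * norm (Y' x))"
      using norm_cauchy_schwarz[of "Y x" "Y' x"] by simp
    also have "\<dots> \<le> 2 * (norm (Y x) * (K * norm (Y x) + C))"
      using bound[OF x] by (intro mult_left_mono) auto
    also have "\<dots> \<le> L * (norm (Y x))\<^sup>2 + C\<^sup>2"
      using zero_le_power2[of "norm (Y x) - C"]
      by (simp add: L_def power2_eq_square algebra_simps)
    finally have "2 * (Y x \<bullet> Y' x) - L * (Y x \<bullet> Y x) \<le> C\<^sup>2"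
      by (simp add: power2_norm_eq_inner)
    then have "exp (- L * (x - a)) * (2 * (Y x \<bullet> Y' x) - L * (Y x \<bullet> Y x)) \<le> exp (- L * (x - a)) * C\<^sup>2"
      by (intro mult_left_mono) auto
    also have "\<dots> \<le> 1 * C\<^sup>2"
    proof (rule mult_right_mono)
      have "0 \<le> L * (x - a)" using x K by (auto simp: L_def)
      then have "- L * (x - a) \<le> 0" by linarith
      then show "exp (- L * (x - a)) \<le> 1" by (simp only: exp_le_one_iff)
    qed simp
    finally have "exp (- L * (x - a)) * (2 * (Y x \<bullet> Y' x) - L * (Y x \<bullet> Y x)) - C\<^sup>2 \<le> 0"
      by simp
    with 2 show "\<exists>y. (g has_real_derivative y) (at x) \<and> y \<le> 0"
      by blast
  qed
  then have "exp (- L * (b - a)) * (norm (Y b))\<^sup>2 \<le> (norm (Y a))\<^sup>2 + C\<^sup>2 * (b - a)"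
    by (simp add: g_def power2_norm_eq_inner)
  then have "exp (L * (b - a)) * (exp (- L * (b - a)) * (norm (Y b))\<^sup>2)
      \<le> exp (L * (b - a)) * ((norm (Y a))\<^sup>2 + C\<^sup>2 * (b - a))"
    by (intro mult_left_mono) auto
  moreover have "exp (L * (b - a)) * exp (- L * (b - a)) = 1"
    by (simp only: mult_minus_left exp_minus_inverse)
  ultimately show ?thesis
    unfolding L_def[symmetric] by (simp only: mult.assoc[symmetric] mult_1_left)
qed

lemma has_vector_derivative_reflect:
  fixes Y :: "real \<Rightarrow> 'a::real_normed_vector"
  assumes "(Y has_vector_derivative D) (at (- x))"
  shows "((\<lambda>x. Y (- x)) has_vector_derivative - D) (at x)"
proof -
  have "(uminus has_vector_derivative (-1::real)) (at x)"
    by (auto intro!: derivative_eq_intros)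
  from vector_diff_chain_at[OF this assms] show ?thesis by (simp add: o_def)
qed

text \<open>Time reversal of \<open>gronwall\<close>. It later bounds the value at the start of a
  period by the values inside it.\<close>

lemma gronwall_backward:
  fixes Y Y' :: "real \<Rightarrow> 'a::real_inner"
  assumes "a \<le> b" and K: "0 \<le> K"
    and deriv: "\<And>x. a \<le> x \<Longrightarrow> x \<le> b \<Longrightarrow> (Y has_vector_derivative Y' x) (at x)"
    and bound: "\<And>x. a \<le> x \<Longrightarrow> x \<le> b \<Longrightarrow> norm (Y' x) \<le> K * norm (Y x) + C"
  shows "(norm (Y a))\<^sup>2 \<le> exp ((2 * K + 1) * (b - a)) * ((norm (Y b))\<^sup>2 + C\<^sup>2 * (b - a))"
proof -
  have "((\<lambda>x. Y (- x)) has_vector_derivative - Y' (- x)) (at x)" if "-b \<le> x" "x \<le> -a" for x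
    using that by (intro has_vector_derivative_reflect deriv) auto
  then show ?thesis
    using gronwall[of "-b" "-a" K "\<lambda>x. Y (-x)" "\<lambda>x. - Y' (-x)" C] assms by auto
qed

lemma linear_ode_unique:
  fixes Y Y' :: "real \<Rightarrow> 'a::real_inner"
  assumes deriv: "\<And>x. (Y has_vector_derivative Y' x) (at x)"
    and bound: "\<And>x. norm (Y' x) \<le> K * norm (Y x)"
    and "Y a = 0"
  shows "Y x = 0"
proof -
  have "norm (Y' x) \<le> \<bar>K\<bar> * norm (Y x) + 0" for x
    using bound[of x] mult_right_mono[OF abs_ge_self[of K] norm_ge_zero[of "Y x"]] by linarith
  then have "(norm (Y x))\<^sup>2 \<le> 0"
    using gronwall[of a x "\<bar>K\<bar>" Y Y' 0, OF _ _ deriv] gronwall_backward[of x a "\<bar>K\<bar>" Y Y' 0, OF _ _ deriv] \<open>Y a = 0\<close>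
    by (cases "a \<le> x") auto
  then show ?thesis by simp
qed

section \<open>Existence for linear equations by Picard iteration\<close>

lemma antiderivative_exists:
  fixes g :: "real \<Rightarrow> 'a::euclidean_space"
  assumes "continuous_on UNIV g"
  obtains G where "G 0 = y0" "\<And>x. (G has_vector_derivative g x) (at x)"
proof -
  obtain F where F: "\<And>x. (F has_vector_derivative g x) (at x)"
    using einterval_antiderivative[of "-\<infinity>" "\<infinity>" g] assms
    by (auto simp: continuous_on_eq_continuous_at)
  show ?thesis
    by (rule that[of "\<lambda>x. F x - F 0 + y0"]) (auto intro!: derivative_eq_intros F)
qed

text \<open>The majorant is the general term of an exponential series. For positive \<open>x\<close>
  its derivative is \<open>K\<close> times the preceding term, so a mean value comparison passes
  from \<open>n\<close> to \<open>Suc n\<close>; negative \<open>x\<close> follows by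
  reflection.\<close>

lemma picard_bound:
  fixes Z Z' :: "real \<Rightarrow> 'a::real_normed_vector"
  assumes deriv: "\<And>x. (Z has_vector_derivative Z' x) (at x)" and "Z 0 = 0"
    and bound: "\<And>x. \<bar>x\<bar> \<le> R \<Longrightarrow> norm (Z' x) \<le> K * (C * (K * \<bar>x\<bar>) ^ n / fact n)"
    and x: "\<bar>x\<bar> \<le> R"
  shows "norm (Z x) \<le> C * (K * \<bar>x\<bar>) ^ Suc n / fact (Suc n)"
proof -
  have pos: "norm (Z x) \<le> C * (K * x) ^ Suc n / fact (Suc n)"
    if deriv: "\<And>x. (Z has_vector_derivative Z' x) (at x)" and "Z 0 = 0"
      and bound: "\<And>x. \<bar>x\<bar> \<le> R \<Longrightarrow> norm (Z' x) \<le> K * (C * (K * \<bar>x\<bar>) ^ n / fact n)"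
      and "0 < x" "x \<le> R" for Z Z' :: "real \<Rightarrow> 'a" and x
  proof -
    let ?\<phi> = "\<lambda>x. C * (K * x) ^ Suc n / fact (Suc n)"
    have d: "(?\<phi> has_vector_derivative K * (C * (K * x) ^ n / fact n)) (at x)" for x
    proof -
      have "(?\<phi> has_real_derivative C * (real (Suc n) * (K * x) ^ n * K) / fact (Suc n)) (at x)"
        by (rule derivative_eq_intros refl | simp)+
      moreover have "C * (real (Suc n) * (K * x) ^ n * K) / fact (Suc n) = K * (C * (K * x) ^ n / fact n)"
        by (simp add: divide_simps del: of_nat_Suc)
      ultimately show ?thesis by (simp only: has_real_derivative_iff_has_vector_derivative)
    qed
    have "norm (Z x - Z 0) \<le> ?\<phi> x - ?\<phi> 0"
    proof (rule differentiable_bound_general[OF \<open>0 < x\<close> _ _ deriv d])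
      show "continuous_on {0..x} Z"
        using deriv by (meson continuous_at_imp_continuous_on has_vector_derivative_continuous)
      show "continuous_on {0..x} ?\<phi>"
        using d by (meson continuous_at_imp_continuous_on has_vector_derivative_continuous)
      show "norm (Z' y) \<le> K * (C * (K * y) ^ n / fact n)" if "0 < y" "y < x" for y
        using bound[of y] that \<open>x \<le> R\<close> by auto
    qed
    then show ?thesis using \<open>Z 0 = 0\<close> by simp
  qed
  consider "x = 0" | "x > 0" | "x < 0" by linarith
  then show ?thesis
  proof cases
    case 1 then show ?thesis using \<open>Z 0 = 0\<close> by simp
  next
    case 2 then show ?thesis using pos[OF deriv \<open>Z 0 = 0\<close> bound] x by auto
  next
    case 3
    have "((\<lambda>x. Z (- x)) has_vector_derivative - Z' (- x)) (at x)" for x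
      by (intro has_vector_derivative_reflect deriv)
    from pos[OF this, of "-x"] show ?thesis using \<open>Z 0 = 0\<close> bound[of "- _"] x 3 by auto
  qed
qed

text \<open>The solution is the Neumann series of the integral equation, dominated on every bounded
  interval by an exponential series. Asking in \<open>cont\<close> that \<open>A\<close> preserve
  continuity along curves avoids any regularity of \<open>A\<close> as an operator-valued
  map.\<close>

lemma linear_ode_exists:
  fixes A :: "real \<Rightarrow> 'a \<Rightarrow> 'a::euclidean_space" and h :: "real \<Rightarrow> 'a"
  assumes lin: "\<And>x. bounded_linear (A x)"
    and bound: "\<And>x y. norm (A x y) \<le> K * norm y"
    and cont: "\<And>Y. continuous_on UNIV Y \<Longrightarrow> continuous_on UNIV (\<lambda>x. A x (Y x))"
    and h: "continuous_on UNIV h" and K: "0 \<le> K"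
  obtains Y where "Y 0 = y0" "\<And>x. (Y has_vector_derivative A x (Y x) + h x) (at x)"
proof -
  define I where "I y0 g = (SOME G. G 0 = y0 \<and> (\<forall>x. (G has_vector_derivative g x) (at x)))"
    for y0 and g :: "real \<Rightarrow> 'a"
  have I: "I y0 g 0 = y0" "(I y0 g has_vector_derivative g x) (at x)"
    if "continuous_on UNIV g" for g y0 x
  proof -
    have "\<exists>G. G 0 = y0 \<and> (\<forall>x. (G has_vector_derivative g x) (at x))"
      using antiderivative_exists[OF that] by metis
    from someI_ex[OF this] show "I y0 g 0 = y0" "(I y0 g has_vector_derivative g x) (at x)"
      unfolding I_def by blast+
  qed
  \<comment> \<open>Term \<open>n\<close> is the difference of consecutive Picard iterates: the
    initial value and \<open>h\<close> enter only through term 0.\<close>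
  define Z where "Z n = ((\<lambda>g. I 0 (\<lambda>x. A x (g x))) ^^ n) (I y0 h)" for n
  define dZ where "dZ n = (case n of 0 \<Rightarrow> h | Suc m \<Rightarrow> (\<lambda>x. A x (Z m x)))" for n
  have Z0: "Z 0 = I y0 h" and ZS: "Z (Suc n) = I 0 (\<lambda>x. A x (Z n x))" for n
    by (simp_all add: Z_def)
  have cZ: "continuous_on UNIV (Z n)" for n
  proof (induction n)
    case 0
    show ?case unfolding Z0 using I(2)[OF h] 
      by (meson continuous_at_imp_continuous_on has_vector_derivative_continuous)
  next
    case (Suc n)
    show ?case unfolding ZS using I(2)[OF cont[OF Suc]] 
      by (meson continuous_at_imp_continuous_on has_vector_derivative_continuous)
  qed
  have dZ: "(Z n has_vector_derivative dZ n x) (at x)" for n x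
    using I(2)[OF h] I(2)[OF cont[OF cZ]] by (cases n) (simp_all add: dZ_def Z0 ZS)
  have Z_0: "Z n 0 = (if n = 0 then y0 else 0)" for n
    by (cases n) (simp_all add: Z0 ZS I h cont cZ)
  have loc: "\<exists>g. \<forall>x\<in>{-R<..<R}. (\<lambda>n. Z n x) sums g x \<and> (g has_derivative (\<lambda>t. t *\<^sub>R (A x (\<Sum>n. Z n x) + h x))) (at x within {-R<..<R})"
    if "R > 0" for R
  proof -
    have "compact (Z 0 ` {-R..R})"
      by (intro compact_continuous_image continuous_on_subset[OF cZ]) auto
    then obtain C where C: "\<And>x. \<bar>x\<bar> \<le> R \<Longrightarrow> norm (Z 0 x) \<le> C"
      by (metis (no_types, lifting) abs_le_iff atLeastAtMost_iff bounded_iff compact_imp_bounded imageI minus_le_iff)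
    have "0 \<le> C" using C[of 0] \<open>R > 0\<close> norm_ge_zero[of "Z 0 0"] by linarith
    have Zb: "norm (Z n x) \<le> C * (K * \<bar>x\<bar>) ^ n / fact n" if "\<bar>x\<bar> \<le> R" for n x
      using that
    proof (induction n arbitrary: x)
      case 0 then show ?case using C by simp
    next
      case (Suc n)
      show ?case
      proof (rule picard_bound[OF dZ _ _ Suc.prems])
        show "Z (Suc n) 0 = 0" by (simp add: Z_0)
        show "norm (dZ (Suc n) x) \<le> K * (C * (K * \<bar>x\<bar>) ^ n / fact n)" if "\<bar>x\<bar> \<le> R" for x
          using order_trans[OF bound[of x "Z n x"] mult_left_mono[OF Suc.IH[OF that] K]] by (simp add: dZ_def)
      qed
    qed
    define M where "M n = C * ((K * R) ^ n / fact n)" for n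
    have Mb: "norm (Z n x) \<le> M n" if "\<bar>x\<bar> \<le> R" for n x
    proof -
      have "(K * \<bar>x\<bar>) ^ n \<le> (K * R) ^ n" using that K by (intro power_mono mult_left_mono) auto
      then have "C * (K * \<bar>x\<bar>) ^ n / fact n \<le> M n"
        using \<open>0 \<le> C\<close> by (auto simp: M_def intro!: divide_right_mono mult_left_mono)
      then show ?thesis using Zb[OF that, of n] by linarith
    qed
    have sM: "summable M"
      unfolding M_def using summable_exp[of "K * R"] by (intro summable_mult) (simp add: field_simps)
    have sZ: "summable (\<lambda>n. Z n x)" if "\<bar>x\<bar> \<le> R" for x
      using Mb[OF that] sM by (rule summable_comparison_test'[rotated])
    have ul: "uniform_limit {-R..R} (\<lambda>n x. \<Sum>i<n. Z i x) (\<lambda>x. \<Sum>i. Z i x) sequentially"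
      by (rule Weierstrass_m_test[OF _ sM]) (use Mb in auto)
    show ?thesis
    proof (rule has_derivative_series[where f' = "\<lambda>n x t. t *\<^sub>R dZ n x" and x = 0 and l = "\<Sum>n. Z n 0"])
      show "convex {-R<..<R}" by simp
      show "(0::real) \<in> {-R<..<R}" using \<open>R > 0\<close> by simp
      show "(\<lambda>n. Z n 0) sums (\<Sum>n. Z n 0)" using sZ[of 0] \<open>R > 0\<close> by (simp add: summable_sums)
      show "(Z n has_derivative (\<lambda>t. t *\<^sub>R dZ n x)) (at x within {-R<..<R})" for n x
        using dZ[of n x] by (auto simp: has_vector_derivative_def intro: has_derivative_at_withinI)
      fix e :: real assume "e > 0"
      then have "e / (K + 1) > 0" using K by simp
      from uniform_limitD[OF ul this]
      have "\<forall>\<^sub>F n in sequentially. \<forall>x\<in>{-R..R}. dist (\<Sum>i<n. Z i x) (\<Sum>i. Z i x) < e / (K + 1)" .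
      \<comment> \<open>The derivative of term \<open>i + 1\<close> is \<open>A\<close> applied to
        term \<open>i\<close>, so \<open>Suc n\<close> derivatives are paired with \<open>n\<close>
        terms of the solution. The shift is undone afterwards.\<close>
      then have "\<forall>\<^sub>F n in sequentially. \<forall>x\<in>{-R<..<R}. \<forall>t. norm ((\<Sum>i<Suc n. t *\<^sub>R dZ i x) - t *\<^sub>R (A x (\<Sum>n. Z n x) + h x)) \<le> e * norm t"
      proof (rule eventually_mono, intro ballI allI)
        fix n x and t :: real
        assume *: "\<forall>x\<in>{-R..R}. dist (\<Sum>i<n. Z i x) (\<Sum>i. Z i x) < e / (K + 1)" and x: "x \<in> {-R<..<R}"
        interpret A: bounded_linear "A x" by (rule lin)
        have "(\<Sum>i<Suc n. t *\<^sub>R dZ i x) - t *\<^sub>R (A x (\<Sum>n. Z n x) + h x)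
            = t *\<^sub>R (A x ((\<Sum>i<n. Z i x) - (\<Sum>i. Z i x)))"
          by (simp only: sum.lessThan_Suc_shift) (simp add: dZ_def A.diff A.sum scaleR_right.sum[symmetric] scaleR_sum_right[symmetric] algebra_simps)
        also have "norm \<dots> \<le> \<bar>t\<bar> * (K * norm ((\<Sum>i<n. Z i x) - (\<Sum>i. Z i x)))"
          using bound by (auto intro!: mult_left_mono)
        also have "\<dots> \<le> \<bar>t\<bar> * (K * (e / (K + 1)))"
          using *[rule_format, of x] x K by (intro mult_left_mono) (auto simp: dist_norm)
        also have "\<dots> \<le> \<bar>t\<bar> * e"
          using K \<open>e > 0\<close> by (intro mult_left_mono) (auto simp: divide_simps)
        finally show "norm ((\<Sum>i<Suc n. t *\<^sub>R dZ i x) - t *\<^sub>R (A x (\<Sum>n. Z n x) + h x)) \<le> e * norm t"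
          by (simp add: mult.commute)
      qed
      then show "\<forall>\<^sub>F n in sequentially. \<forall>x\<in>{-R<..<R}. \<forall>t. norm ((\<Sum>i<n. t *\<^sub>R dZ i x) - t *\<^sub>R (A x (\<Sum>n. Z n x) + h x)) \<le> e * norm t"
        by (subst (asm) eventually_sequentially_Suc[where P="\<lambda>n. \<forall>x\<in>{-R<..<R}. \<forall>t. norm ((\<Sum>i<n. t *\<^sub>R dZ i x) - t *\<^sub>R (A x (\<Sum>n. Z n x) + h x)) \<le> e * norm t"])
    qed
  qed
  show ?thesis
  proof (rule that[of "\<lambda>x. \<Sum>n. Z n x"])
    show "(\<Sum>n. Z n 0) = y0"
      using suminf_finite[of "{0}" "\<lambda>n. Z n 0"] by (simp add: Z_0)
    fix x :: real
    \<comment> \<open>The series converges uniformly only on bounded intervals, so each point is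
      treated in an open interval that contains it.\<close>
    let ?S = "{-(\<bar>x\<bar> + 1)<..<\<bar>x\<bar> + 1}"
    obtain g where g: "\<And>y. y \<in> ?S \<Longrightarrow> (\<lambda>n. Z n y) sums g y"
      "\<And>y. y \<in> ?S \<Longrightarrow> (g has_derivative (\<lambda>t. t *\<^sub>R (A y (\<Sum>n. Z n y) + h y))) (at y within ?S)"
      using loc[of "\<bar>x\<bar> + 1"] abs_ge_zero[of x] by (metis add_nonneg_pos zero_less_one)
    have x: "x \<in> ?S" by auto
    have "((\<lambda>x. \<Sum>n. Z n x) has_derivative (\<lambda>t. t *\<^sub>R (A x (\<Sum>n. Z n x) + h x))) (at x within ?S)"
      by (rule has_derivative_transform[OF x _ g(2)[OF x]]) (simp add: sums_unique[OF g(1)])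
    then show "((\<lambda>x. \<Sum>n. Z n x) has_vector_derivative A x (\<Sum>n. Z n x) + h x) (at x)"
      by (simp only: has_vector_derivative_def at_within_open[OF x open_greaterThanLessThan])
  qed
qed

section \<open>Recursions on square-summable sequences\<close>

text \<open>The squared l2 norm over the integers, valued in \<open>ennreal\<close> so that sums can
  be reindexed and exchanged without summability conditions.\<close>

definition sq_sum :: "(int \<Rightarrow> 'a::real_normed_vector) \<Rightarrow> ennreal" where
  "sq_sum b = (\<integral>\<^sup>+n. ennreal ((norm (b n))\<^sup>2) \<partial>count_space UNIV)"

lemma sq_sum_bij: "bij g \<Longrightarrow> sq_sum (\<lambda>n. b (g n)) = sq_sum b"
  unfolding sq_sum_def by (rule nn_integral_bij_count_space)

lemma bij_int_shift: "bij (\<lambda>n::int. n + k)" "bij (\<lambda>n::int. k - n)"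
  by (rule o_bij[where g = "\<lambda>n. n - k"]; auto) (rule o_bij[where g = "\<lambda>n. k - n"]; auto)

lemma sq_sum_le:
  assumes "0 \<le> C" "0 \<le> D" and "\<And>n. (norm (a n))\<^sup>2 \<le> C * (norm (b n))\<^sup>2 + D * (norm (c n))\<^sup>2"
  shows "sq_sum a \<le> ennreal C * sq_sum b + ennreal D * sq_sum c"
proof -
  have "sq_sum a \<le> (\<integral>\<^sup>+n. (ennreal C * ennreal ((norm (b n))\<^sup>2) + ennreal D * ennreal ((norm (c n))\<^sup>2)) \<partial>count_space UNIV)"
    unfolding sq_sum_def using assms
    by (intro nn_integral_mono) (simp add: ennreal_mult[symmetric] ennreal_plus[symmetric] del: ennreal_plus)
  also have "\<dots> = ennreal C * sq_sum b + ennreal D * sq_sum c"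
    by (simp add: sq_sum_def nn_integral_add nn_integral_cmult)
  finally show ?thesis .
qed

lemma sq_sum_le_mult:
  assumes "0 \<le> C" and "\<And>n. norm (a n) \<le> C * norm (b n)"
  shows "sq_sum a \<le> ennreal (C\<^sup>2) * sq_sum b"
  using sq_sum_le[of "C\<^sup>2" 0 a b b] power_mono[OF assms(2) norm_ge_zero, of _ 2]
  by (simp add: power_mult_distrib)

lemma norm_add_sq: "(norm (x + y :: 'a::real_normed_vector))\<^sup>2 \<le> 2 * (norm x)\<^sup>2 + 2 * (norm y)\<^sup>2"
proof -
  have "(norm (x + y))\<^sup>2 \<le> (norm x + norm y)\<^sup>2"
    by (intro power_mono norm_triangle_ineq) auto
  also have "\<dots> \<le> 2 * (norm x)\<^sup>2 + 2 * (norm y)\<^sup>2"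
    using zero_le_power2[of "norm x - norm y"] by (simp add: power2_eq_square algebra_simps)
  finally show ?thesis .
qed

lemma sq_sum_add: "sq_sum (\<lambda>n. a n + b n) \<le> 2 * sq_sum a + 2 * sq_sum b"
  using sq_sum_le[of 2 2 "\<lambda>n. a n + b n" a b, OF _ _ norm_add_sq] by simp

lemma norm_le_sq_sum: "ennreal ((norm (b n))\<^sup>2) \<le> sq_sum b"
  unfolding sq_sum_def by (rule nn_integral_ge_point) simp

text \<open>Cauchy-Schwarz for the weights \<open>r ^ k\<close>, whose total mass is
  \<open>1 / (1 - r)\<close>. This is the convolution estimate that keeps a geometric sum of shifts
  square-summable.\<close>

lemma suminf_power2_le:
  fixes c :: "nat \<Rightarrow> real"
  assumes r: "0 \<le> r" "r < 1" and c: "\<And>k. 0 \<le> c k" "\<And>k. c k \<le> B"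
  shows "(\<Sum>k. r ^ k * c k)\<^sup>2 \<le> 1 / (1 - r) * (\<Sum>k. r ^ k * (c k)\<^sup>2)"
    and "summable (\<lambda>k. r ^ k * (c k)\<^sup>2)"
proof -
  have "0 \<le> B" using c[of 0] by linarith
  have g: "summable (\<lambda>k. r ^ k)" "(\<Sum>k. r ^ k) = 1 / (1 - r)"
    using r by (auto intro: summable_geometric suminf_geometric)
  have s1: "summable (\<lambda>k. r ^ k * c k)"
    by (rule summable_comparison_test'[OF summable_mult2[OF g(1), of B]])
      (use r c in \<open>auto intro!: mult_left_mono\<close>)
  show s2: "summable (\<lambda>k. r ^ k * (c k)\<^sup>2)"
    by (rule summable_comparison_test'[OF summable_mult2[OF g(1), of "B\<^sup>2"]])
      (use r c in \<open>auto intro!: mult_left_mono power_mono\<close>)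
  have fin: "(\<Sum>k<N. r ^ k * c k)\<^sup>2 \<le> 1 / (1 - r) * (\<Sum>k. r ^ k * (c k)\<^sup>2)" for N
  proof -
    have "(\<Sum>k<N. r ^ k * c k)\<^sup>2 = (\<Sum>k<N. sqrt (r ^ k) * (sqrt (r ^ k) * c k))\<^sup>2"
      using r by (simp add: mult.assoc[symmetric])
    also have "\<dots> \<le> (\<Sum>k<N. (sqrt (r ^ k))\<^sup>2) * (\<Sum>k<N. (sqrt (r ^ k) * c k)\<^sup>2)"
      by (rule Cauchy_Schwarz_ineq_sum)
    also have "\<dots> = (\<Sum>k<N. r ^ k) * (\<Sum>k<N. r ^ k * (c k)\<^sup>2)"
      using r by (simp add: power_mult_distrib)
    also have "\<dots> \<le> 1 / (1 - r) * (\<Sum>k. r ^ k * (c k)\<^sup>2)"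
      using r g sum_le_suminf[OF g(1), of "{..<N}"] sum_le_suminf[OF s2, of "{..<N}"]
      by (intro mult_mono) (auto intro!: sum_nonneg)
    finally show ?thesis .
  qed
  have "(\<lambda>N. (\<Sum>k<N. r ^ k * c k)\<^sup>2) \<longlonglongrightarrow> (\<Sum>k. r ^ k * c k)\<^sup>2"
    using summable_LIMSEQ[OF s1] by (intro tendsto_power)
  then show "(\<Sum>k. r ^ k * c k)\<^sup>2 \<le> 1 / (1 - r) * (\<Sum>k. r ^ k * (c k)\<^sup>2)"
    using fin by (intro LIMSEQ_le_const2) auto
qed

section \<open>Recursions with a contraction or a scalar multiplier\<close>

text \<open>Iterating from minus infinity gives \<open>z n\<close> as the sum of
  \<open>L ^^ k\<close> applied to \<open>b (n - 1 - int k)\<close>. The weighted Cauchy-Schwarz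
  inequality bounds its square by shifted copies of \<open>b\<close>, all of which have the same
  \<open>sq_sum\<close>.\<close>

lemma contraction_recursion_exists:
  fixes L :: "'a::banach \<Rightarrow> 'a" and b :: "int \<Rightarrow> 'a"
  assumes lin: "bounded_linear L" and L: "\<And>y. norm (L y) \<le> r * norm y" and r: "0 \<le> r" "r < 1"
    and b: "sq_sum b < \<infinity>"
  obtains z where "sq_sum z < \<infinity>" "\<And>n. z (n + 1) = L (z n) + b n"
proof -
  interpret L: bounded_linear L by (rule lin)
  define B where "B = sqrt (enn2real (sq_sum b))"
  have bB: "norm (b n) \<le> B" for n
    using enn2real_mono[OF norm_le_sq_sum[of b n]] b by (auto simp: B_def intro: real_le_rsqrt)
  have Lk: "norm ((L ^^ k) y) \<le> r ^ k * norm y" for k y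
  proof (induction k)
    case (Suc k)
    have "norm (L ((L ^^ k) y)) \<le> r * (r ^ k * norm y)"
      using order_trans[OF L mult_left_mono[OF Suc r(1)]] .
    then show ?case by simp
  qed simp
  have g: "summable (\<lambda>k. r ^ k)" using r by (auto intro: summable_geometric)
  define t where "t n k = (L ^^ k) (b (n - 1 - int k))" for n k
  define c where "c n k = norm (b (n - 1 - int k))" for n k
  have tc: "norm (t n k) \<le> r ^ k * c n k" for n k
    using Lk by (simp add: t_def c_def)
  have sc: "summable (\<lambda>k. r ^ k * c n k)" for n
    by (rule summable_comparison_test'[OF summable_mult2[OF g, of B]])
      (use r bB in \<open>auto intro!: mult_left_mono simp: c_def\<close>)
  have st: "summable (t n)" "summable (\<lambda>k. norm (t n k))" for n
    using tc by (auto intro!: summable_comparison_test'[OF sc])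
  define z where "z n = (\<Sum>k. t n k)" for n
  have "z (n + 1) = L (z n) + b n" for n
  proof -
    have "t (n + 1) (Suc k) = L (t n k)" for k by (simp add: t_def algebra_simps)
    then have "z (n + 1) - b n = (\<Sum>k. L (t n k))"
      using suminf_split_head[OF st(1), of "n + 1"] by (simp add: z_def) (simp add: t_def)
    also have "\<dots> = L (z n)" unfolding z_def by (rule L.suminf[OF st(1), symmetric])
    finally show ?thesis by (simp add: algebra_simps)
  qed
  moreover have "sq_sum z < \<infinity>"
  proof -
    have 1: "(norm (z n))\<^sup>2 \<le> 1 / (1 - r) * (\<Sum>k. r ^ k * (c n k)\<^sup>2)" for n
    proof -
      have "norm (z n) \<le> (\<Sum>k. norm (t n k))" unfolding z_def by (rule summable_norm[OF st(2)])
      also have "\<dots> \<le> (\<Sum>k. r ^ k * c n k)" by (rule suminf_le[OF tc st(2) sc])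
      finally have "(norm (z n))\<^sup>2 \<le> (\<Sum>k. r ^ k * c n k)\<^sup>2" by (intro power_mono) auto
      also have "\<dots> \<le> 1 / (1 - r) * (\<Sum>k. r ^ k * (c n k)\<^sup>2)"
        by (rule suminf_power2_le(1)[OF r, where B=B]) (use bB in \<open>auto simp: c_def\<close>)
      finally show ?thesis .
    qed
    have sm: "summable (\<lambda>k. r ^ k * (c n k)\<^sup>2)" for n
      by (rule suminf_power2_le(2)[OF r, where B=B]) (use bB in \<open>auto simp: c_def\<close>)
    have "sq_sum z \<le> (\<integral>\<^sup>+n. ennreal (1 / (1 - r)) * (\<Sum>k. ennreal (r ^ k) * ennreal ((c n k)\<^sup>2)) \<partial>count_space UNIV)"
      unfolding sq_sum_def
    proof (rule nn_integral_mono)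
      fix n
      have "ennreal ((norm (z n))\<^sup>2) \<le> ennreal (1 / (1 - r) * (\<Sum>k. r ^ k * (c n k)\<^sup>2))"
        by (rule ennreal_leI[OF 1])
      also have "\<dots> = ennreal (1 / (1 - r)) * (\<Sum>k. ennreal (r ^ k * (c n k)\<^sup>2))"
        using r by (subst suminf_ennreal2[OF _ sm]) (simp_all only: ennreal_mult suminf_nonneg[OF sm] zero_le_power zero_le_power2 mult_nonneg_nonneg zero_le_divide_1_iff diff_ge_0_iff_ge less_imp_le)
      finally show "ennreal ((norm (z n))\<^sup>2) \<le> ennreal (1 / (1 - r)) * (\<Sum>k. ennreal (r ^ k) * ennreal ((c n k)\<^sup>2))"
        using r by (simp add: ennreal_mult)
    qed
    also have "\<dots> = ennreal (1 / (1 - r)) * (\<Sum>k. ennreal (r ^ k) * sq_sum (\<lambda>n. b (n + (- 1 - int k))))"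
      by (simp add: nn_integral_cmult nn_integral_suminf sq_sum_def c_def algebra_simps)
    also have "\<dots> = ennreal (1 / (1 - r)) * ((\<Sum>k. ennreal (r ^ k)) * sq_sum b)"
      by (simp only: sq_sum_bij[OF bij_int_shift(1)] ennreal_suminf_multc)
    also have "\<dots> < \<infinity>"
      using b r by (subst suminf_ennreal2[OF _ g]) (auto simp: ennreal_mult_less_top)
    finally show ?thesis .
  qed
  ultimately show ?thesis by (rule that[rotated])
qed

text \<open>The estimate has \<open>r\<close> times \<open>sq_sum z\<close> on the right and absorbs
  it, which is legitimate because \<open>sq_sum z\<close> is finite. Finiteness also excludes the
  homogeneous solutions, which grow towards minus infinity.\<close>

lemma contraction_recursion_bound:
  fixes L :: "'a::real_normed_vector \<Rightarrow> 'a" and b z :: "int \<Rightarrow> 'a"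
  assumes L: "\<And>y. norm (L y) \<le> r * norm y" and r: "0 \<le> r" "r < 1"
    and z: "sq_sum z < \<infinity>" "\<And>n. z (n + 1) = L (z n) + b n"
  shows "sq_sum z \<le> ennreal (1 / (1 - r)\<^sup>2) * sq_sum b"
proof (cases "sq_sum b = \<infinity>")
  case True
  then show ?thesis using r by (simp add: ennreal_mult_top)
next
  case False
  have "(norm (z (n + 1)))\<^sup>2 \<le> r * (norm (z n))\<^sup>2 + 1 / (1 - r) * (norm (b n))\<^sup>2" for n
  proof -
    \<comment> \<open>With this scaling of \<open>y\<close> the right-hand side becomes a convex
      combination, and convexity of the square keeps the coefficient of
      \<open>(norm (z n))\<^sup>2\<close> equal to \<open>r\<close>.\<close>
    define x y where "x = norm (z n)" and "y = norm (b n) / (1 - r)"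
    have "norm (z (n + 1)) \<le> r * x + (1 - r) * y"
      using norm_triangle_ineq[of "L (z n)" "b n"] L[of "z n"] r unfolding z x_def y_def by simp
    then have "(norm (z (n + 1)))\<^sup>2 \<le> (r * x + (1 - r) * y)\<^sup>2"
      by (intro power_mono) auto
    also have "\<dots> \<le> r * x\<^sup>2 + (1 - r) * y\<^sup>2"
    proof -
      have "r * x\<^sup>2 + (1 - r) * y\<^sup>2 - (r * x + (1 - r) * y)\<^sup>2 = r * (1 - r) * (x - y)\<^sup>2"
        by (simp add: power2_eq_square algebra_simps)
      moreover have "0 \<le> r * (1 - r) * (x - y)\<^sup>2" using r by simp
      ultimately show ?thesis by linarith
    qed
    also have "(1 - r) * y\<^sup>2 = 1 / (1 - r) * (norm (b n))\<^sup>2"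
      using r by (simp add: y_def power2_eq_square)
    finally show ?thesis by (simp add: x_def)
  qed
  then have "sq_sum (\<lambda>n. z (n + 1)) \<le> ennreal r * sq_sum z + ennreal (1 / (1 - r)) * sq_sum b"
    using r by (intro sq_sum_le) auto
  then have 1: "sq_sum z \<le> ennreal r * sq_sum z + ennreal (1 / (1 - r)) * sq_sum b"
    by (simp only: sq_sum_bij[OF bij_int_shift(1)])
  obtain Z B where Z: "sq_sum z = ennreal Z" "0 \<le> Z" and B: "sq_sum b = ennreal B" "0 \<le> B"
    using z(1) False by (metis ennreal_cases infinity_ennreal_def less_irrefl)
  have "Z \<le> r * Z + 1 / (1 - r) * B"
    using 1 r unfolding Z B
    by (simp add: ennreal_mult[symmetric] ennreal_plus[symmetric] Z(2) B(2) del: ennreal_plus)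
  then have "(1 - r) * Z \<le> 1 / (1 - r) * B" by (simp add: algebra_simps)
  then have "1 / (1 - r) * ((1 - r) * Z) \<le> 1 / (1 - r) * (1 / (1 - r) * B)"
    using r by (intro mult_left_mono) auto
  then have "Z \<le> 1 / (1 - r)\<^sup>2 * B"
    using r by (simp add: power2_eq_square)
  then show ?thesis using r by (simp add: Z B ennreal_mult[symmetric] B(2) ennreal_leI)
qed

lemma norm_smult_vec: "norm (l *s (y :: complex^'n)) = cmod l * norm y"
  by (simp add: norm_vec_def norm_mult L2_set_right_distrib)

lemma bounded_linear_smult_vec: "bounded_linear (\<lambda>y :: complex^'n. l *s y)"
  by (rule bounded_linear_intro[where K = "cmod l"])
    (auto simp: vec_eq_iff algebra_simps norm_smult_vec)

text \<open>For \<open>cmod l > 1\<close> the recursion contracts when it is run backwards, so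
  reflecting the index reduces it to the first case.\<close>

lemma scalar_recursion_exists:
  fixes b :: "int \<Rightarrow> complex^'n"
  assumes l: "cmod l \<noteq> 1" and b: "sq_sum b < \<infinity>"
  obtains z where "sq_sum z < \<infinity>" "\<And>n. z (n + 1) = l *s z n + b n"
proof (cases "cmod l < 1")
  case True
  then show ?thesis
    using contraction_recursion_exists[OF bounded_linear_smult_vec, of l "cmod l" b] b that
    by (auto simp: norm_smult_vec)
next
  case False
  then have l1: "cmod (inverse l) < 1" "l \<noteq> 0"
    using l by (auto simp: norm_inverse inverse_less_1_iff)
  \<comment> \<open>Solved for the earlier value, the recursion has the forcing
    \<open>- (inverse l *s b)\<close>. The index \<open>- 1 - m\<close> arises because
    \<open>z (- m - 1)\<close> is computed from \<open>z (- m)\<close>.\<close>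
  define b' where "b' m = - (inverse l *s b (- 1 - m))" for m
  have "sq_sum b' \<le> ennreal ((cmod (inverse l))\<^sup>2) * sq_sum (\<lambda>m. b (- 1 - m))"
    by (rule sq_sum_le_mult) (auto simp: b'_def norm_smult_vec)
  also have "\<dots> < \<infinity>" using b sq_sum_bij[OF bij_int_shift(2), of b "-1"] by (simp add: ennreal_mult_less_top)
  finally obtain z where z: "sq_sum z < \<infinity>" "\<And>n. z (n + 1) = inverse l *s z n + b' n"
    using contraction_recursion_exists[OF bounded_linear_smult_vec, of "inverse l" "cmod (inverse l)" b'] l1
    by (auto simp: norm_smult_vec)
  show ?thesis
  proof (rule that[of "\<lambda>n. z (0 - n)"])
    show "sq_sum (\<lambda>n. z (0 - n)) < \<infinity>" using z(1) sq_sum_bij[OF bij_int_shift(2), of z 0] by simp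
    show "z (0 - (n + 1)) = l *s z (0 - n) + b n" for n
      using z(2)[of "-(n+1)"] l1 by (simp add: b'_def vec_eq_iff field_simps)
  qed
qed

lemma scalar_recursion_bound:
  assumes l: "cmod l \<noteq> 1"
  obtains C where "0 \<le> C" "\<And>z b :: int \<Rightarrow> complex^'n. sq_sum z < \<infinity> \<Longrightarrow> (\<And>n. z (n + 1) = l *s z n + b n)
    \<Longrightarrow> sq_sum z \<le> ennreal C * sq_sum b"
proof (cases "cmod l < 1")
  case True
  then show ?thesis
    by (intro that[of "1 / (1 - cmod l)\<^sup>2"] contraction_recursion_bound) (auto simp: norm_smult_vec)
next
  case False
  then have l1: "cmod (inverse l) < 1" "l \<noteq> 0"
    using l by (auto simp: norm_inverse inverse_less_1_iff)
  define C where "C = 1 / (1 - cmod (inverse l))\<^sup>2"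
  have "0 \<le> C" by (simp add: C_def)
  show ?thesis
  proof (rule that[of "C * (cmod (inverse l))\<^sup>2"])
    show "0 \<le> C * (cmod (inverse l))\<^sup>2" using \<open>0 \<le> C\<close> by simp
    fix z b :: "int \<Rightarrow> complex^'n"
    assume z: "sq_sum z < \<infinity>" "\<And>n. z (n + 1) = l *s z n + b n"
    define b' where "b' m = - (inverse l *s b (- 1 - m))" for m
    have r: "z (0 - (n + 1)) = inverse l *s z (0 - n) + b' n" for n
      using z(2)[of "-(n+1)"] l1 by (simp add: b'_def vec_eq_iff field_simps)
    have "sq_sum z = sq_sum (\<lambda>n. z (0 - n))"
      by (rule sq_sum_bij[OF bij_int_shift(2), symmetric])
    also have "\<dots> \<le> ennreal C * sq_sum b'"
      unfolding C_def
    proof (rule contraction_recursion_bound[where L = "\<lambda>y. inverse l *s y"])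
      show "z (0 - (n + 1)) = inverse l *s z (0 - n) + b' n" for n by (rule r)
    qed (use l1 z(1) sq_sum_bij[OF bij_int_shift(2), of z 0] in \<open>auto simp: norm_smult_vec\<close>)
    also have "ennreal C * sq_sum b' \<le> ennreal C * (ennreal ((cmod (inverse l))\<^sup>2) * sq_sum (\<lambda>m. b (- 1 - m)))"
      by (intro mult_left_mono sq_sum_le_mult) (auto simp: b'_def norm_smult_vec)
    also have "sq_sum (\<lambda>m. b (- 1 - m)) = sq_sum b"
      by (rule sq_sum_bij[OF bij_int_shift(2)])
    finally show "sq_sum z \<le> ennreal (C * (cmod (inverse l))\<^sup>2) * sq_sum b"
      using \<open>0 \<le> C\<close> by (simp only: ennreal_mult zero_le_power2 mult.assoc mult_left_mono)
  qed
qed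

section \<open>Reduction of a matrix recursion to three scalar ones\<close>

text \<open>The factored form takes the place of a Jordan decomposition, so repeated eigenvalues
  need no separate treatment. One root comes from the fundamental theorem of algebra, the other two
  from the quadratic formula.\<close>

lemma cayley_hamilton_3:
  fixes M :: "complex^3^3"
  obtains l1 l2 l3 where
    "\<And>l. l \<in> {l1, l2, l3} \<Longrightarrow> det (M - mat l) = 0"
    "(M - mat l1) ** (M - mat l2) ** (M - mat l3) = 0"
proof -
  define t where "t = M$1$1 + M$2$2 + M$3$3"
  define e where "e = M$1$1 * M$2$2 - M$1$2 * M$2$1 + M$1$1 * M$3$3 - M$1$3 * M$3$1 + M$2$2 * M$3$3 - M$2$3 * M$3$2"
  define d where "d = det M"
  have det: "det (M - mat l) = - (l^3 - t * l^2 + e * l - d)" for l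
    unfolding t_def e_def d_def det_3 by (simp add: mat_def power3_eq_cube power2_eq_square algebra_simps)
  have dM: "d = det M" by (simp add: d_def)
  have "\<not> constant (poly [:-d, e, -t, 1:])"
    by (simp add: constant_degree)
  then obtain l1 where "poly [:-d, e, -t, 1:] l1 = 0" using fundamental_theorem_of_algebra by blast
  then have d: "d = l1^3 - t * l1^2 + e * l1" by (simp add: power3_eq_cube power2_eq_square algebra_simps)
  \<comment> \<open>Coefficients of the quotient of the characteristic polynomial by the linear
    factor of \<open>l1\<close>.\<close>
  define \<alpha> \<beta> where "\<alpha> = l1 - t" and "\<beta> = l1^2 - t * l1 + e"
  define s where "s = csqrt (\<alpha>^2 - 4 * \<beta>)"
  define l2 l3 where "l2 = (- \<alpha> + s) / 2" and "l3 = (- \<alpha> - s) / 2"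
  have s: "s^2 = \<alpha>^2 - 4 * \<beta>" by (simp add: s_def)
  have sum: "l2 + l3 = - \<alpha>" by (simp add: l2_def l3_def field_simps)
  have prod: "l2 * l3 = \<beta>"
  proof -
    have "l2 * l3 = (\<alpha>^2 - s^2) / 4" by (simp add: l2_def l3_def field_simps power2_eq_square)
    then show ?thesis by (simp add: s)
  qed
  have t: "t = l1 + l2 + l3" using sum by (simp add: \<alpha>_def algebra_simps)
  have e: "e = l1 * l2 + l1 * l3 + l2 * l3" using prod t by (simp add: \<beta>_def power2_eq_square algebra_simps)
  have d': "d = l1 * l2 * l3" unfolding d t e by (simp add: power3_eq_cube power2_eq_square algebra_simps)
  have roots: "det (M - mat l) = - ((l - l1) * (l - l2) * (l - l3))" for l
    unfolding det d' unfolding t e by (simp add: power3_eq_cube power2_eq_square algebra_simps)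
  have CH: "(M ** M ** M) $ i $ j = t * (M ** M) $ i $ j - e * M $ i $ j + (if i = j then d else 0)" for i j
    using exhaust_3[of i] exhaust_3[of j]
    by (auto simp: matrix_matrix_mult_def sum_3 det_3 t_def e_def dM algebra_simps)
  have "((M - mat l1) ** (M - mat l2) ** (M - mat l3)) $ i $ j =
      (M ** M ** M) $ i $ j - (l1 + l2 + l3) * (M ** M) $ i $ j
        + (l1 * l2 + l1 * l3 + l2 * l3) * M $ i $ j - (if i = j then l1 * l2 * l3 else 0)" for i j
    using exhaust_3[of i] exhaust_3[of j]
    by (auto simp: matrix_matrix_mult_def mat_def sum_3 algebra_simps)
  then have "((M - mat l1) ** (M - mat l2) ** (M - mat l3)) $ i $ j = 0" for i j
    unfolding CH d' by (simp add: t[symmetric] e[symmetric])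
  then show ?thesis
    by (intro that[of l1 l2 l3]) (auto simp: roots vec_eq_iff)
qed


lemma det_zero_imp_kernel:
  fixes A :: "'a::field^'n^'n"
  assumes "det A = 0"
  obtains y where "y \<noteq> 0" "A *v y = 0"
  using assms by (metis invertible_def invertible_det_nz matrix_left_invertible_ker matrix_left_right_inverse)

lemma mat_mult_vec: "mat l *v y = l *s (y :: 'a::comm_semiring_1^'n)"
  by (simp add: vec_eq_iff matrix_vector_mult_def mat_def if_distrib[where f = "\<lambda>x. x * _"] cong: if_cong)

lemma diff_mat_mult_vec: "(M - mat l) *v y = M *v y - l *s (y :: 'a::comm_ring_1^'n)"
  by (simp add: matrix_vector_mult_diff_rdistrib mat_mult_vec)

lemma linear_complex_matrix: "linear (\<lambda>y. (A :: complex^'n^'m) *v y)"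
  by (rule linearI) (auto simp: vec_eq_iff matrix_vector_mult_def sum.distrib distrib_left scaleR_right.sum)

lemma complex_matrix_bound:
  obtains K where "0 \<le> K" "\<And>y. norm ((A :: complex^'n^'m) *v y) \<le> K * norm y"
  by (meson linear_complex_matrix linear_bounded_pos less_imp_le)

lemma sq_sum_matrix_finite:
  "sq_sum b < \<infinity> \<Longrightarrow> sq_sum (\<lambda>n. (A :: complex^'n^'m) *v b n) < \<infinity>"
  using complex_matrix_bound[of A] sq_sum_le_mult[of _ "\<lambda>n. A *v b n" b]
  by (metis ennreal_less_top ennreal_mult_less_top infinity_ennreal_def order_le_less_trans)

lemma sq_sum_add_finite:
  "sq_sum a < \<infinity> \<Longrightarrow> sq_sum b < \<infinity> \<Longrightarrow> sq_sum (\<lambda>n. a n + b n) < \<infinity>"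
  using sq_sum_add[of a b] by (auto intro: order_le_less_trans simp: ennreal_mult_less_top ennreal_add_less_top)

text \<open>Three scalar recursions in cascade, each driven by the solution of the previous one, are
  combined with the partial products of the Cayley-Hamilton factors. The leftover term is the full
  product applied to \<open>x3\<close>, which vanishes.\<close>

lemma matrix_recursion_exists:
  fixes M :: "complex^3^3"
  assumes M: "\<And>l y. cmod l = 1 \<Longrightarrow> M *v y = l *s y \<Longrightarrow> y = 0" and b: "sq_sum b < \<infinity>"
  obtains z where "sq_sum z < \<infinity>" "\<And>n. z (n + 1) = M *v z n + b n"
proof -
  obtain l1 l2 l3 where l: "\<And>l. l \<in> {l1, l2, l3} \<Longrightarrow> det (M - mat l) = 0"
    and CH: "(M - mat l1) ** (M - mat l2) ** (M - mat l3) = 0"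
    by (rule cayley_hamilton_3[of M]) blast
  have ln: "cmod l \<noteq> 1" if "l \<in> {l1, l2, l3}" for l
    using det_zero_imp_kernel[OF l[OF that]] M by (metis diff_mat_mult_vec eq_iff_diff_eq_0)
  obtain x1 where x1: "sq_sum x1 < \<infinity>" "\<And>n. x1 (n + 1) = l1 *s x1 n + b n"
    using scalar_recursion_exists[OF ln b, of l1] by auto
  obtain x2 where x2: "sq_sum x2 < \<infinity>" "\<And>n. x2 (n + 1) = l2 *s x2 n + x1 n"
    using scalar_recursion_exists[OF ln x1(1), of l2] by auto
  obtain x3 where x3: "sq_sum x3 < \<infinity>" "\<And>n. x3 (n + 1) = l3 *s x3 n + x2 n"
    using scalar_recursion_exists[OF ln x2(1), of l3] by auto
  let ?N = "\<lambda>l. M - mat l"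
  define z where "z n = x1 n + (?N l1 *v x2 n + (?N l1 ** ?N l2) *v x3 n)" for n
  have S: "l *s y = M *v y - ?N l *v y" for l y by (simp add: diff_mat_mult_vec)
  have comm: "?N l *v (M *v y) = M *v (?N l *v y)" for l y
    by (simp add: diff_mat_mult_vec matrix_vector_mult_diff_distrib vector_scalar_commute)
  show ?thesis
  proof (rule that[of z])
    show "sq_sum z < \<infinity>"
      unfolding z_def by (intro sq_sum_add_finite sq_sum_matrix_finite x1 x2 x3)
    fix n
    have 3: "?N l1 *v (?N l2 *v (?N l3 *v x3 n)) = 0"
      using CH by (simp only: matrix_vector_mul_assoc matrix_mul_assoc) simp
    show "z (n + 1) = M *v z n + b n"
      unfolding z_def x1(2) x2(2) x3(2) S using 3
      by (simp only: matrix_vector_mul_assoc[symmetric] matrix_vector_right_distrib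
          matrix_vector_mult_diff_distrib comm) simp
  qed
qed

text \<open>The cascade in the opposite direction: the product of the last two factors applied to
  \<open>z\<close> obeys a scalar recursion because the first factor annihilates it. This sequence
  drives the recursion of \<open>?N l3 *v z n\<close>, and that one drives \<open>z\<close>.\<close>

lemma matrix_recursion_bound:
  fixes M :: "complex^3^3"
  assumes M: "\<And>l y. cmod l = 1 \<Longrightarrow> M *v y = l *s y \<Longrightarrow> y = 0"
  obtains C where "0 \<le> C" "\<And>z b. sq_sum z < \<infinity> \<Longrightarrow> (\<And>n. z (n + 1) = M *v z n + b n)
    \<Longrightarrow> sq_sum z \<le> ennreal C * sq_sum b"
proof -
  obtain l1 l2 l3 where l: "\<And>l. l \<in> {l1, l2, l3} \<Longrightarrow> det (M - mat l) = 0"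
    and CH: "(M - mat l1) ** (M - mat l2) ** (M - mat l3) = 0"
    by (rule cayley_hamilton_3[of M]) blast
  have ln: "cmod l \<noteq> 1" if "l \<in> {l1, l2, l3}" for l
    using det_zero_imp_kernel[OF l[OF that]] M by (metis diff_mat_mult_vec eq_iff_diff_eq_0)
  let ?N = "\<lambda>l. M - mat l"
  have S: "M *v y = l *s y + ?N l *v y" for l y by (simp add: diff_mat_mult_vec)
  have comm: "?N l *v (M *v y) = M *v (?N l *v y)" for l y
    by (simp add: diff_mat_mult_vec matrix_vector_mult_diff_distrib vector_scalar_commute)
  obtain C1 where C1: "0 \<le> C1" "\<And>z b :: int \<Rightarrow> complex^3. sq_sum z < \<infinity> \<Longrightarrow> (\<And>n. z (n + 1) = l1 *s z n + b n)
    \<Longrightarrow> sq_sum z \<le> ennreal C1 * sq_sum b" using scalar_recursion_bound[OF ln] by blast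
  obtain C2 where C2: "0 \<le> C2" "\<And>z b :: int \<Rightarrow> complex^3. sq_sum z < \<infinity> \<Longrightarrow> (\<And>n. z (n + 1) = l2 *s z n + b n)
    \<Longrightarrow> sq_sum z \<le> ennreal C2 * sq_sum b" using scalar_recursion_bound[OF ln] by blast
  obtain C3 where C3: "0 \<le> C3" "\<And>z b :: int \<Rightarrow> complex^3. sq_sum z < \<infinity> \<Longrightarrow> (\<And>n. z (n + 1) = l3 *s z n + b n)
    \<Longrightarrow> sq_sum z \<le> ennreal C3 * sq_sum b" using scalar_recursion_bound[OF ln] by blast
  obtain K2 where K2: "0 \<le> K2" "\<And>y. norm ((?N l2 ** ?N l3) *v y) \<le> K2 * norm y"
    using complex_matrix_bound[of "?N l2 ** ?N l3"] by blast
  obtain K3 where K3: "0 \<le> K3" "\<And>y. norm (?N l3 *v y) \<le> K3 * norm y"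
    using complex_matrix_bound[of "?N l3"] by blast
  define D1 where "D1 = C1 * K2\<^sup>2"
  define D2 where "D2 = C2 * (2 * D1 + 2 * K3\<^sup>2)"
  define D3 where "D3 = C3 * (2 * D2 + 2)"
  have D: "0 \<le> D1" "0 \<le> D2" "0 \<le> D3" using C1(1) C2(1) C3(1) by (auto simp: D1_def D2_def D3_def)
  show ?thesis
  proof (rule that[OF D(3)])
    fix z b
    assume z: "sq_sum z < \<infinity>" and rec: "\<And>n. z (n + 1) = M *v z n + b n"
    define x1 where "x1 n = ?N l2 *v (?N l3 *v z n)" for n
    define x2 where "x2 n = ?N l3 *v z n" for n
    have fin: "sq_sum x1 < \<infinity>" "sq_sum x2 < \<infinity>"
      unfolding x1_def x2_def by (intro sq_sum_matrix_finite z)+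
    have 0: "?N l1 *v x1 n = 0" for n
      using CH unfolding x1_def by (simp only: matrix_vector_mul_assoc matrix_mul_assoc) simp
    have r1: "x1 (n + 1) = l1 *s x1 n + (?N l2 ** ?N l3) *v b n" for n
      using 0[of n] S[of "x1 n" l1]
      by (simp add: x1_def rec matrix_vector_right_distrib comm matrix_vector_mul_assoc[symmetric])
    have r2: "x2 (n + 1) = l2 *s x2 n + (x1 n + ?N l3 *v b n)" for n
      using S[of "x2 n" l2]
      by (simp add: x1_def x2_def rec matrix_vector_right_distrib comm)
    have r3: "z (n + 1) = l3 *s z n + (x2 n + b n)" for n
      using S[of "z n" l3] by (simp add: x2_def rec)
    have "sq_sum x1 \<le> ennreal C1 * sq_sum (\<lambda>n. (?N l2 ** ?N l3) *v b n)"
      by (rule C1(2)[OF fin(1) r1])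
    also have "\<dots> \<le> ennreal C1 * (ennreal (K2\<^sup>2) * sq_sum b)"
      by (intro mult_left_mono sq_sum_le_mult K2) auto
    finally have b1: "sq_sum x1 \<le> ennreal D1 * sq_sum b"
      using C1(1) by (simp add: D1_def ennreal_mult mult.assoc)
    have "sq_sum x2 \<le> ennreal C2 * sq_sum (\<lambda>n. x1 n + ?N l3 *v b n)"
      by (rule C2(2)[OF fin(2) r2])
    also have "\<dots> \<le> ennreal C2 * (2 * (ennreal D1 * sq_sum b) + 2 * (ennreal (K3\<^sup>2) * sq_sum b))"
      by (intro mult_left_mono order_trans[OF sq_sum_add] add_mono sq_sum_le_mult K3 b1) auto
    also have "\<dots> = ennreal D2 * sq_sum b"
      using C2(1) D(1) by (simp add: D2_def ennreal_mult ennreal_plus mult.assoc distrib_right)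
    finally have b2: "sq_sum x2 \<le> ennreal D2 * sq_sum b" .
    have "sq_sum z \<le> ennreal C3 * sq_sum (\<lambda>n. x2 n + b n)"
      by (rule C3(2)[OF z r3])
    also have "\<dots> \<le> ennreal C3 * (2 * (ennreal D2 * sq_sum b) + 2 * sq_sum b)"
      by (intro mult_left_mono order_trans[OF sq_sum_add] add_mono b2) auto
    also have "\<dots> = ennreal D3 * sq_sum b"
      using C3(1) D(2) by (simp add: D3_def ennreal_mult ennreal_plus mult.assoc distrib_right)
    finally show "sq_sum z \<le> ennreal D3 * sq_sum b" .
  qed
qed

section \<open>Monodromy matrix and its symmetry\<close>

lemma has_vector_derivative_componentwise:
  fixes Y :: "real \<Rightarrow> 'a::real_normed_vector^'n"
  shows "(Y has_vector_derivative D) (at x) \<longleftrightarrow> (\<forall>i. ((\<lambda>x. Y x $ i) has_vector_derivative D $ i) (at x))"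
proof
  assume "(Y has_vector_derivative D) (at x)"
  then show "\<forall>i. ((\<lambda>x. Y x $ i) has_vector_derivative D $ i) (at x)"
    using bounded_linear.has_vector_derivative[OF bounded_linear_vec_nth] by blast
next
  assume "\<forall>i. ((\<lambda>x. Y x $ i) has_vector_derivative D $ i) (at x)"
  then show "(Y has_vector_derivative D) (at x)"
    unfolding has_vector_derivative_def has_derivative_at_within
    by (auto intro!: bounded_linear_scaleR_left vec_tendstoI)
qed

lemma has_vector_derivative_translate:
  fixes Y :: "real \<Rightarrow> 'a::real_normed_vector"
  assumes "(Y has_vector_derivative D) (at (x + c))"
  shows "((\<lambda>x. Y (x + c)) has_vector_derivative D) (at x)"
proof -
  have "((\<lambda>x. x + c) has_vector_derivative 1) (at x)"
    by (auto intro!: derivative_eq_intros)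
  from vector_diff_chain_at[OF this assms] show ?thesis by (simp add: o_def)
qed

lemma continuous_on_vector_3:
  "continuous_on S f \<Longrightarrow> continuous_on S g \<Longrightarrow> continuous_on S h
    \<Longrightarrow> continuous_on S (\<lambda>x. vector [f x, g x, h x] :: ('a::{zero,topological_space})^3)"
  unfolding continuous_on_def
proof (intro ballI vec_tendstoI)
  fix x i
  assume "\<forall>x\<in>S. (f \<longlongrightarrow> f x) (at x within S)" "\<forall>x\<in>S. (g \<longlongrightarrow> g x) (at x within S)"
    "\<forall>x\<in>S. (h \<longlongrightarrow> h x) (at x within S)" "x \<in> S"
  then show "((\<lambda>x. (vector [f x, g x, h x] :: 'a^3) $ i) \<longlongrightarrow> (vector [f x, g x, h x] :: 'a^3) $ i) (at x within S)"
    using exhaust_3[of i] by auto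
qed

lemma norm_vec3_le: "norm (y :: 'a::real_normed_vector^3) \<le> norm (y$1) + norm (y$2) + norm (y$3)"
  using L2_set_le_sum[of UNIV "\<lambda>i. norm (y$i)"] by (simp add: norm_vec_def sum_3)

lemma periodic_int_shift:
  fixes q :: "real \<Rightarrow> 'a"
  assumes "\<And>x. q (x + T) = q x"
  shows "q (x + of_int n * T) = q x"
proof (induction n rule: int_induct[where k = 0])
  case (step1 i) then show ?case using assms[of "x + of_int i * T"] by (simp add: algebra_simps)
next
  case (step2 i) then show ?case using assms[of "x + of_int (i - 1) * T"] by (simp add: algebra_simps)
qed simp

lemma periodic_continuous_bounded:
  fixes q :: "real \<Rightarrow> real"
  assumes "continuous_on UNIV q" "0 < T" "\<And>x. q (x + T) = q x"
  obtains Q where "0 \<le> Q" "\<And>x. \<bar>q x\<bar> \<le> Q"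
proof -
  have "compact (q ` {0..T})"
    by (intro compact_continuous_image continuous_on_subset[OF assms(1)]) auto
  then obtain Q where Q: "\<And>x. x \<in> {0..T} \<Longrightarrow> \<bar>q x\<bar> \<le> Q"
    by (metis bounded_iff compact_imp_bounded imageI real_norm_def)
  have "\<bar>q x\<bar> \<le> Q" for x
  proof -
    define n where "n = \<lfloor>x / T\<rfloor>"
    have "of_int n \<le> x / T" "x / T < of_int n + 1" unfolding n_def by linarith+
    then have "x - of_int n * T \<in> {0..T}" using \<open>0 < T\<close> by (auto simp: field_simps)
    from Q[OF this] show ?thesis
      using periodic_int_shift[of q T "x - of_int n * T" n] assms(3) by simp
  qed
  then show ?thesis by (intro that[of Q]) (auto intro: order_trans[OF abs_ge_zero])
qed

text \<open>The spectral problem \<open>\<partial>\<^sub>x \<L> v = \<mu> v\<close> is written as a system for \<open>y = (v, v', \<L> v)\<close>, in which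
  \<open>q = c - f' \<circ> u\<close> is not differentiated.\<close>

locale hill =
  fixes q :: "real \<Rightarrow> real" and T :: real
  assumes q_cont: "continuous_on UNIV q" and T_pos: "0 < T" and q_periodic: "q (x + T) = q x"
begin

definition coef :: "complex \<Rightarrow> real \<Rightarrow> complex^3 \<Rightarrow> complex^3" where
  "coef \<mu> x y = vector [y$2, of_real (q x) * y$1 - y$3, \<mu> * y$1]"

definition q_bound :: real where
  "q_bound = (SOME Q. 0 \<le> Q \<and> (\<forall>x. \<bar>q x\<bar> \<le> Q))"

lemma q_bound: "0 \<le> q_bound" "\<bar>q x\<bar> \<le> q_bound"
proof -
  have "\<exists>Q. 0 \<le> Q \<and> (\<forall>x. \<bar>q x\<bar> \<le> Q)"
    using periodic_continuous_bounded[OF q_cont T_pos q_periodic] by metis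
  from someI_ex[OF this] show "0 \<le> q_bound" "\<bar>q x\<bar> \<le> q_bound" unfolding q_bound_def by auto
qed

definition coef_bound :: "complex \<Rightarrow> real" where
  "coef_bound \<mu> = q_bound + 2 + cmod \<mu>"

lemma coef_bound_nonneg: "0 \<le> coef_bound \<mu>"
  using q_bound by (simp add: coef_bound_def)

lemma coef_norm: "norm (coef \<mu> x y) \<le> coef_bound \<mu> * norm y"
proof -
  have c: "norm (y $ i) \<le> norm y" for i by (rule Finite_Cartesian_Product.norm_nth_le)
  have "norm (coef \<mu> x y) \<le> cmod (y$2) + cmod (of_real (q x) * y$1 - y$3) + cmod (\<mu> * y$1)"
    using norm_vec3_le[of "coef \<mu> x y"] by (simp add: coef_def)
  also have "\<dots> \<le> cmod (y$2) + (\<bar>q x\<bar> * cmod (y$1) + cmod (y$3)) + cmod \<mu> * cmod (y$1)"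
    using norm_triangle_ineq4[of "of_real (q x) * y$1" "y$3"] by (simp add: norm_mult)
  also have "\<dots> \<le> norm y + (q_bound * norm y + norm y) + cmod \<mu> * norm y"
    by (intro add_mono mult_mono c q_bound norm_ge_zero order_refl)
  finally show ?thesis by (simp add: coef_bound_def algebra_simps)
qed

lemma coef_add: "coef \<mu> x (y + z) = coef \<mu> x y + coef \<mu> x z"
  and coef_diff: "coef \<mu> x (y - z) = coef \<mu> x y - coef \<mu> x z"
  and coef_smult: "coef \<mu> x (c *s y) = c *s coef \<mu> x y"
  by (simp_all add: coef_def vec_eq_iff forall_3 algebra_simps)

lemma coef_zero: "coef \<mu> x 0 = 0"
  by (simp add: coef_def vec_eq_iff forall_3)

lemma coef_bounded_linear: "bounded_linear (coef \<mu> x)"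
  by (rule bounded_linear_intro[where K = "coef_bound \<mu>"])
    (simp_all add: coef_norm mult.commute[of "norm _"] coef_add, simp add: coef_def vec_eq_iff forall_3 algebra_simps)

lemma coef_continuous:
  "continuous_on UNIV Y \<Longrightarrow> continuous_on UNIV (\<lambda>x. coef \<mu> x (Y x))"
  unfolding coef_def by (intro continuous_on_vector_3 continuous_intros q_cont) auto

lemma coef_shift: "coef \<mu> (x + of_int n * T) = coef \<mu> x"
  using periodic_int_shift[of q T x n, OF q_periodic] by (simp add: coef_def fun_eq_iff)

definition solves :: "complex \<Rightarrow> (real \<Rightarrow> complex^3) \<Rightarrow> (real \<Rightarrow> complex^3) \<Rightarrow> bool" where
  "solves \<mu> h Y \<longleftrightarrow> (\<forall>x. (Y has_vector_derivative coef \<mu> x (Y x) + h x) (at x))"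

lemma solves_unique:
  assumes "solves \<mu> h Y" "solves \<mu> h Z" "Y a = Z a"
  shows "Y = Z"
proof
  fix x
  have "Y x - Z x = 0"
  proof (rule linear_ode_unique[where a = a and K = "coef_bound \<mu>"])
    show "((\<lambda>x. Y x - Z x) has_vector_derivative coef \<mu> x (Y x - Z x)) (at x)" for x
      using has_vector_derivative_diff[of Y _ "at x" Z] assms(1,2) unfolding solves_def coef_diff
      by fastforce
  qed (use coef_norm assms(3) in auto)
  then show "Y x = Z x" by simp
qed

lemma solves_exists:
  assumes "continuous_on UNIV h"
  obtains Y where "Y 0 = y" "solves \<mu> h Y"
  using linear_ode_exists[OF coef_bounded_linear coef_norm coef_continuous assms coef_bound_nonneg]
  unfolding solves_def by metis

lemma solves_add: "solves \<mu> h Y \<Longrightarrow> solves \<mu> k Z \<Longrightarrow> solves \<mu> (\<lambda>x. h x + k x) (\<lambda>x. Y x + Z x)"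
  unfolding solves_def coef_add
  by (auto intro!: derivative_eq_intros simp: add_ac)

lemma solves_smult: "solves \<mu> h Y \<Longrightarrow> solves \<mu> (\<lambda>x. c *s h x) (\<lambda>x. c *s Y x)"
  unfolding solves_def coef_smult vector_add_ldistrib[symmetric]
  by (intro allI bounded_linear.has_vector_derivative[OF bounded_linear_smult_vec[of c]]) simp

lemma solves_shift:
  assumes "solves \<mu> (\<lambda>x. 0) Y"
  shows "solves \<mu> (\<lambda>x. 0) (\<lambda>x. Y (x + of_int n * T))"
  unfolding solves_def
proof
  fix x
  have "(Y has_vector_derivative coef \<mu> (x + of_int n * T) (Y (x + of_int n * T)) + 0) (at (x + of_int n * T))"
    using assms unfolding solves_def by blast
  then show "((\<lambda>x. Y (x + of_int n * T)) has_vector_derivative coef \<mu> x (Y (x + of_int n * T)) + 0) (at x)"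
    unfolding coef_shift by (rule has_vector_derivative_translate)
qed

definition flow :: "complex \<Rightarrow> complex^3 \<Rightarrow> real \<Rightarrow> complex^3" where
  "flow \<mu> y = (SOME Y. Y 0 = y \<and> solves \<mu> (\<lambda>x. 0) Y)"

lemma flow: "flow \<mu> y 0 = y" "solves \<mu> (\<lambda>x. 0) (flow \<mu> y)"
proof -
  have "\<exists>Y. Y 0 = y \<and> solves \<mu> (\<lambda>x. 0) Y"
    using solves_exists[of "\<lambda>x. 0" y \<mu>] by auto
  from someI_ex[OF this] show "flow \<mu> y 0 = y" "solves \<mu> (\<lambda>x. 0) (flow \<mu> y)"
    unfolding flow_def by auto
qed

lemma flow_eqI: "solves \<mu> (\<lambda>x. 0) Y \<Longrightarrow> flow \<mu> (Y 0) = Y"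
  by (rule solves_unique[OF flow(2), where a = 0]) (auto simp: flow)

definition monodromy :: "complex \<Rightarrow> complex^3^3" where
  "monodromy \<mu> = matrix (\<lambda>y. flow \<mu> y T)"

lemma monodromy_flow: "monodromy \<mu> *v y = flow \<mu> y T"
proof -
  have "flow \<mu> (y + z) = (\<lambda>x. flow \<mu> y x + flow \<mu> z x)" for y z
    using flow_eqI[OF solves_add[OF flow(2) flow(2), of \<mu> y z, simplified]] by (simp add: flow)
  moreover have "flow \<mu> (c *s y) = (\<lambda>x. c *s flow \<mu> y x)" for c y
    using flow_eqI[OF solves_smult[OF flow(2), of \<mu> c y, simplified]] by (simp add: flow)
  ultimately have "Vector_Spaces.linear (*s) (*s) (\<lambda>y. flow \<mu> y T)"
    by (unfold_locales) (auto simp: vec.scale_right_distrib vec.scale_left_distrib)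
  from matrix_works[OF this] show ?thesis unfolding monodromy_def by simp
qed

lemma monodromy_solves: "solves \<mu> (\<lambda>x. 0) Y \<Longrightarrow> Y (of_int (n + 1) * T) = monodromy \<mu> *v Y (of_int n * T)"
  using flow_eqI[OF solves_shift, of \<mu> Y n] unfolding monodromy_flow
  by (simp add: algebra_simps)

text \<open>A solution that vanishes after one period vanishes identically. This makes it possible
  to step backwards over periods.\<close>

lemma monodromy_inj:
  assumes "monodromy \<mu> *v y = 0"
  shows "y = 0"
proof -
  have "solves \<mu> (\<lambda>x. 0) (\<lambda>x. 0)"
    by (simp add: solves_def coef_zero)
  from solves_unique[OF flow(2) this, of y T] have "flow \<mu> y = (\<lambda>x. 0)"
    using assms by (simp add: monodromy_flow)
  then show ?thesis using flow(1)[of \<mu> y] by simp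
qed

text \<open>The concomitant of \<open>\<partial>\<^sub>x \<L> - \<mu>\<close> with its formal adjoint, in which the adjoint solution is
  \<open>\<L> \<zeta>\<close> for \<open>\<zeta>\<close> solving \<open>\<partial>\<^sub>x \<L> \<zeta> = - cnj \<mu> \<zeta>\<close>.\<close>

lemma concomitant_constant:
  assumes Y: "solves \<mu> (\<lambda>x. 0) Y" and Z: "solves (- cnj \<mu>) (\<lambda>x. 0) Z"
  shows "Y x $ 3 * cnj (Z x $ 3) - \<mu> * (Y x $ 2 * cnj (Z x $ 1) - Y x $ 1 * cnj (Z x $ 2))
       = Y 0 $ 3 * cnj (Z 0 $ 3) - \<mu> * (Y 0 $ 2 * cnj (Z 0 $ 1) - Y 0 $ 1 * cnj (Z 0 $ 2))"
proof -
  have dY: "((\<lambda>x. Y x $ i) has_vector_derivative coef \<mu> x (Y x) $ i) (at x)" for i x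
    using Y unfolding solves_def has_vector_derivative_componentwise by simp
  have dZ: "((\<lambda>x. cnj (Z x $ i)) has_vector_derivative cnj (coef (- cnj \<mu>) x (Z x) $ i)) (at x)" for i x
    using Z unfolding solves_def has_vector_derivative_componentwise
    by (intro bounded_linear.has_vector_derivative[OF bounded_linear_cnj]) simp
  let ?J = "\<lambda>x. Y x $ 3 * cnj (Z x $ 3) - \<mu> * (Y x $ 2 * cnj (Z x $ 1) - Y x $ 1 * cnj (Z x $ 2))"
  have "(?J has_vector_derivative 0) (at x)" for x
    by (rule derivative_eq_intros dY dZ refl)+ (simp add: coef_def algebra_simps)
  then have "(?J has_derivative (\<lambda>h. 0)) (at x within UNIV)" for x
    by (simp add: has_vector_derivative_def)
  from has_derivative_zero_unique[OF _ this, of x 0] show ?thesis by simp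
qed

text \<open>If \<open>l\<close> were no multiplier for \<open>- cnj \<mu>\<close>, the second
  monodromy matrix minus \<open>l\<close> would be onto. Conservation of the concomitant together
  with \<open>l * cnj l = 1\<close> then makes the form \<open>J\<close> vanish between
  \<open>y\<close> and every vector, although it is nondegenerate for
  \<open>\<mu> \<noteq> 0\<close>.\<close>

lemma unimodular_multiplier_reflect:
  assumes "\<mu> \<noteq> 0" "cmod l = 1" "y \<noteq> 0" "monodromy \<mu> *v y = l *s y"
  obtains z where "z \<noteq> 0" "monodromy (- cnj \<mu>) *v z = l *s z"
proof (rule ccontr)
  assume "\<not> thesis"
  then have no: "\<And>z. (monodromy (- cnj \<mu>) - mat l) *v z = 0 \<Longrightarrow> z = 0"
    using that by (metis diff_mat_mult_vec eq_iff_diff_eq_0)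
  have surj: "\<exists>z. (monodromy (- cnj \<mu>) - mat l) *v z = w" for w
  proof -
    obtain B where "B ** (monodromy (- cnj \<mu>) - mat l) = mat 1"
      using no matrix_left_invertible_ker by blast
    then have "(monodromy (- cnj \<mu>) - mat l) ** B = mat 1" using matrix_left_right_inverse by blast
    then have "(monodromy (- cnj \<mu>) - mat l) *v (B *v w) = w" by (simp add: matrix_vector_mul_assoc)
    then show ?thesis by blast
  qed
  have l: "l * cnj l = 1" using \<open>cmod l = 1\<close> complex_norm_square[of l] by simp
  define J where "J y z = y $ 3 * cnj (z $ 3) - \<mu> * (y $ 2 * cnj (z $ 1) - y $ 1 * cnj (z $ 2))"
    for y z :: "complex^3"
  have J0: "J y w = 0" for w
  proof -
    obtain z where z: "(monodromy (- cnj \<mu>) - mat l) *v z = w" using surj by blast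
    have "J (flow \<mu> y T) (flow (- cnj \<mu>) z T) = J y z"
      using concomitant_constant[OF flow(2)[of \<mu> y] flow(2)[of _ z], of T] by (simp add: J_def flow)
    then have "J (l *s y) (w + l *s z) = J y z"
      using assms(4) z by (simp add: monodromy_flow diff_mat_mult_vec mat_mult_vec algebra_simps)
    moreover have "J (l *s y) (w + l *s z) = l * J y w + (l * cnj l) * J y z"
      by (simp add: J_def algebra_simps)
    ultimately have "l * J y w = 0" using l by simp
    then show ?thesis using l by auto
  qed
  \<comment> \<open>Up to sign, the three unit vectors read off \<open>\<mu> * y $ 2\<close>,
    \<open>\<mu> * y $ 1\<close> and \<open>y $ 3\<close>.\<close>
  have "y $ i = 0" for i
    using J0[of "axis 1 1"] J0[of "axis 2 1"] J0[of "axis 3 1"] \<open>\<mu> \<noteq> 0\<close> exhaust_3[of i]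
    by (auto simp: J_def axis_def)
  then show False using \<open>y \<noteq> 0\<close> by (simp add: vec_eq_iff)
qed

end

section \<open>Square-integrable functions on the line\<close>

definition mass_sq :: "(real \<Rightarrow> 'a::real_normed_vector) \<Rightarrow> ennreal" where
  "mass_sq v = (\<integral>\<^sup>+x. ennreal ((norm (v x))\<^sup>2) \<partial>lebesgue)"

text \<open>Half-open cells tile the line without overlap, so \<open>mass_sq\<close> is exactly the
  sum over the cells.\<close>

definition cell_sq :: "real \<Rightarrow> (real \<Rightarrow> 'a::real_normed_vector) \<Rightarrow> int \<Rightarrow> ennreal" where
  "cell_sq T v n = (\<integral>\<^sup>+x. ennreal ((norm (v x))\<^sup>2) * indicator {of_int n * T..<of_int (n + 1) * T} x \<partial>lebesgue)"

lemma cell_unique: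
  assumes "0 < T"
  shows "x \<in> {of_int n * T..<of_int (n + 1) * T} \<longleftrightarrow> n = \<lfloor>x / T\<rfloor>"
proof -
  have "x \<in> {of_int n * T..<of_int (n + 1) * T} \<longleftrightarrow> of_int n \<le> x / T \<and> x / T < of_int n + 1"
    using assms by (simp add: field_simps)
  then show ?thesis unfolding eq_commute[of n] floor_eq_iff .
qed

lemma norm_sq_measurable:
  "v \<in> borel_measurable M \<Longrightarrow> (\<lambda>x. ennreal ((norm (v x))\<^sup>2)) \<in> borel_measurable M"
  by measurable

lemma interval_indicator_measurable [measurable]:
  "(indicator {a..<b::real} :: real \<Rightarrow> ennreal) \<in> borel_measurable lebesgue"
  "(indicator {a..b::real} :: real \<Rightarrow> ennreal) \<in> borel_measurable lebesgue"
  by (auto intro!: borel_measurable_indicator)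

lemma mass_sq_cells:
  fixes v :: "real \<Rightarrow> 'a::{second_countable_topology,real_normed_vector}"
  assumes "0 < T" and v[measurable]: "v \<in> borel_measurable lebesgue"
  shows "mass_sq v = (\<integral>\<^sup>+n. cell_sq T v n \<partial>count_space UNIV)"
proof -
  have "ennreal ((norm (v x))\<^sup>2) = (\<integral>\<^sup>+n. ennreal ((norm (v x))\<^sup>2) * indicator {of_int n * T..<of_int (n + 1) * T} x \<partial>count_space UNIV)" for x
  proof -
    have "(\<integral>\<^sup>+n. ennreal ((norm (v x))\<^sup>2) * indicator {of_int n * T..<of_int (n + 1) * T} x \<partial>count_space UNIV)
        = (\<integral>\<^sup>+n. ennreal ((norm (v x))\<^sup>2) * indicator {\<lfloor>x / T\<rfloor>} n \<partial>count_space UNIV)"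
      using cell_unique[OF \<open>0 < T\<close>, of x] by (intro nn_integral_cong) (auto split: split_indicator)
    also have "\<dots> = ennreal ((norm (v x))\<^sup>2)"
      by (simp add: nn_integral_cmult_indicator)
    finally show ?thesis by simp
  qed
  then have "mass_sq v = (\<integral>\<^sup>+x. \<integral>\<^sup>+n. ennreal ((norm (v x))\<^sup>2) * indicator {of_int n * T..<of_int (n + 1) * T} x \<partial>count_space UNIV \<partial>lebesgue)"
    unfolding mass_sq_def by (intro nn_integral_cong) blast
  also have "\<dots> = (\<integral>\<^sup>+n. cell_sq T v n \<partial>count_space UNIV)"
    unfolding cell_sq_def
    by (intro nn_integral_count_space_nn_integral) (auto intro!: borel_measurable_times_ennreal norm_sq_measurable v)
  finally show ?thesis .
qed

lemma L2_iff: "v \<in> L2 \<longleftrightarrow> v \<in> borel_measurable lebesgue \<and> mass_sq v < \<infinity>"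
proof -
  have "integrable lebesgue (\<lambda>x. (cmod (v x))\<^sup>2) \<longleftrightarrow> mass_sq v < \<infinity>" if [measurable]: "v \<in> borel_measurable lebesgue"
    unfolding integrable_iff_bounded mass_sq_def by (simp, measurable)
  then show ?thesis unfolding L2_def by blast
qed

lemma L2_norm_eq: "v \<in> L2 \<Longrightarrow> L2_norm v = sqrt (enn2real (mass_sq v))"
  unfolding L2_norm_def mass_sq_def L2_def by (subst integral_eq_nn_integral) auto

lemma L2_domination:
  assumes [measurable]: "v \<in> borel_measurable lebesgue" and ab: "a \<in> L2" "b \<in> L2"
    and le: "\<And>x. cmod (v x) \<le> C * cmod (a x) + cmod (b x)"
  shows "v \<in> L2"
proof -
  have "integrable lebesgue (\<lambda>x. 2 * C\<^sup>2 * (cmod (a x))\<^sup>2 + 2 * (cmod (b x))\<^sup>2)"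
    using ab unfolding L2_def by auto
  then have "integrable lebesgue (\<lambda>x. (cmod (v x))\<^sup>2)"
  proof (rule Bochner_Integration.integrable_bound)
    show "AE x in lebesgue. norm ((cmod (v x))\<^sup>2) \<le> norm (2 * C\<^sup>2 * (cmod (a x))\<^sup>2 + 2 * (cmod (b x))\<^sup>2)"
    proof (rule AE_I2)
      fix x
      have "(cmod (v x))\<^sup>2 \<le> (C * cmod (a x) + cmod (b x))\<^sup>2" using le by (intro power_mono) auto
      also have "\<dots> \<le> 2 * (C * cmod (a x))\<^sup>2 + 2 * (cmod (b x))\<^sup>2"
        using norm_add_sq[of "C * cmod (a x)" "cmod (b x)"] by simp
      finally show "norm ((cmod (v x))\<^sup>2) \<le> norm (2 * C\<^sup>2 * (cmod (a x))\<^sup>2 + 2 * (cmod (b x))\<^sup>2)"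
        by (simp add: power_mult_distrib)
    qed
  qed measurable
  then show ?thesis by (simp add: L2_def)
qed

lemma L2_set_integrable:
  assumes "g \<in> L2"
  shows "set_integrable lebesgue {a..b} g"
proof -
  have [measurable]: "g \<in> borel_measurable lebesgue" using assms by (simp add: L2_def)
  have "integrable lebesgue (\<lambda>x. indicator {a..b} x + (cmod (g x))\<^sup>2)"
    using assms by (intro Bochner_Integration.integrable_add) (auto simp: L2_def intro!: integrable_real_indicator simp: emeasure_lborel_Icc_eq)
  then show ?thesis unfolding set_integrable_def
  proof (rule Bochner_Integration.integrable_bound)
    show "AE x in lebesgue. norm (indicat_real {a..b} x *\<^sub>R g x) \<le> norm (indicat_real {a..b} x + (cmod (g x))\<^sup>2)"
    proof (rule AE_I2)
      fix x
      have "2 * cmod (g x) \<le> 1 + (cmod (g x))\<^sup>2"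
        using zero_le_power2[of "cmod (g x) - 1"] by (simp add: power2_eq_square algebra_simps)
      then have "cmod (g x) \<le> 1 + (cmod (g x))\<^sup>2" using norm_ge_zero[of "g x"] by linarith
      then show "norm (indicat_real {a..b} x *\<^sub>R g x) \<le> norm (indicat_real {a..b} x + (cmod (g x))\<^sup>2)"
        by (auto split: split_indicator)
    qed
    show "(\<lambda>x. indicat_real {a..b} x *\<^sub>R g x) \<in> borel_measurable lebesgue"
      by (intro borel_measurable_scaleR borel_measurable_indicator) (auto simp: assms[unfolded L2_def])
  qed
qed

text \<open>Cauchy-Schwarz on an interval, from the nonnegativity of the integral of
  \<open>((b - a) * cmod (g x) - N)\<^sup>2\<close>. It links the gauge integral used in
  \<open>dx\<close> with the Lebesgue integral of the L2 norm.\<close>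

lemma has_integral_sq_bound:
  assumes g: "g \<in> L2" and "a \<le> b" and I: "(g has_integral I) {a..b}"
  shows "(cmod I)\<^sup>2 \<le> (b - a) * enn2real (\<integral>\<^sup>+x. ennreal ((cmod (g x))\<^sup>2) * indicator {a..b} x \<partial>lebesgue)"
proof -
  have [measurable]: "g \<in> borel_measurable lebesgue" using g by (simp add: L2_def)
  let ?i = "indicat_real {a..b}"
  have int: "integrable lebesgue (\<lambda>x. ?i x *\<^sub>R g x)"
    using L2_set_integrable[OF g] by (simp add: set_integrable_def)
  have int1: "integrable lebesgue (\<lambda>x. ?i x * cmod (g x))"
    using integrable_norm[OF int] by simp
  have int2: "integrable lebesgue (\<lambda>x. ?i x * (cmod (g x))\<^sup>2)"
    using g integrable_mult_indicator[of "{a..b}" lebesgue "\<lambda>x. (cmod (g x))\<^sup>2"] by (simp add: L2_def)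
  have int0: "integrable lebesgue ?i" by (auto intro!: integrable_real_indicator simp: emeasure_lborel_Icc_eq)
  have len: "(\<integral>x. ?i x \<partial>lebesgue) = b - a" using \<open>a \<le> b\<close> by simp
  define N R where "N = (\<integral>x. ?i x * cmod (g x) \<partial>lebesgue)" and "R = (\<integral>x. ?i x * (cmod (g x))\<^sup>2 \<partial>lebesgue)"
  have "I = (LINT x:{a..b}|lebesgue. g x)"
    using has_integral_unique[OF I has_integral_set_lebesgue[OF L2_set_integrable[OF g]]] .
  then have "cmod I \<le> N"
    unfolding N_def set_lebesgue_integral_def using integral_norm_bound[of lebesgue "\<lambda>x. ?i x *\<^sub>R g x"] by simp
  have R: "R = enn2real (\<integral>\<^sup>+x. ennreal ((cmod (g x))\<^sup>2) * indicator {a..b} x \<partial>lebesgue)"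
    unfolding R_def using int2
    by (subst integral_eq_nn_integral) (auto intro!: arg_cong[where f = enn2real] nn_integral_cong split: split_indicator)
  have N0: "0 \<le> N" unfolding N_def by (rule integral_nonneg_AE) auto
  have "N\<^sup>2 \<le> (b - a) * R"
  proof -
    have "0 \<le> (\<integral>x. ?i x * ((b - a) * cmod (g x) - N)\<^sup>2 \<partial>lebesgue)"
      by (rule integral_nonneg_AE) auto
    also have "\<dots> = (\<integral>x. (b - a)\<^sup>2 * (?i x * (cmod (g x))\<^sup>2) - 2 * (b - a) * N * (?i x * cmod (g x)) + N\<^sup>2 * ?i x \<partial>lebesgue)"
      by (intro Bochner_Integration.integral_cong) (auto simp: power2_eq_square algebra_simps)
    also have "\<dots> = (b - a)\<^sup>2 * R - 2 * (b - a) * N * N + N\<^sup>2 * (b - a)"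
      using int0 int1 int2 by (simp add: N_def R_def len)
    finally have "0 \<le> (b - a) * ((b - a) * R - N\<^sup>2)" by (simp add: power2_eq_square algebra_simps)
    \<comment> \<open>A degenerate interval does not allow division by \<open>b - a\<close>; there
      the integrand vanishes outside a null set.\<close>
    moreover have "N = 0" if "b = a"
    proof -
      have "AE x in lebesgue. ?i x * cmod (g x) = 0"
        using that by (intro AE_I'[of "{a}"]) (auto split: split_indicator)
      then show ?thesis unfolding N_def by (simp add: integral_eq_zero_AE)
    qed
    ultimately show ?thesis using \<open>a \<le> b\<close> by (cases "a = b") (auto simp: zero_le_mult_iff)
  qed
  moreover have "(cmod I)\<^sup>2 \<le> N\<^sup>2" using \<open>cmod I \<le> N\<close> by (intro power_mono) auto
  ultimately show ?thesis by (simp add: R)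
qed

section \<open>Antiderivatives of square-integrable functions\<close>

definition antiderivative :: "(real \<Rightarrow> complex) \<Rightarrow> (real \<Rightarrow> complex) \<Rightarrow> bool" where
  "antiderivative g G \<longleftrightarrow> (\<forall>x y. x \<le> y \<longrightarrow> (g has_integral (G y - G x)) {x..y})"

lemma dx_iff: "(v, w) \<in> dx \<longleftrightarrow> v \<in> L2 \<and> w \<in> L2 \<and> antiderivative w v"
  by (auto simp: dx_def antiderivative_def)

lemma antiderivative_L2_exists:
  assumes g: "g \<in> L2"
  obtains G where "antiderivative g G"
proof -
  have int: "g integrable_on {a..b}" for a b
    using has_integral_set_lebesgue[OF L2_set_integrable[OF g]] by blast
  \<comment> \<open>An interval with reversed end points is empty, so at most one of the two
    integrals differs from zero.\<close>
  define G where "G x = integral {0..x} g - integral {x..0} g" for x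
  have "G y - G x = integral {x..y} g" if "x \<le> y" for x y
  proof -
    have z: "integral {s..t} g = 0" if "t \<le> s" for s t
      using that by (cases "s = t") auto
    note c = Henstock_Kurzweil_Integration.integral_combine[OF _ _ int]
    consider "0 \<le> x" | "x \<le> 0" "0 \<le> y" | "y \<le> 0" by linarith
    then show ?thesis
    proof cases
      case 1
      then show ?thesis using c[of 0 x y] that z[where s=x and t=0] z[where s=y and t=0]
        by (simp add: G_def algebra_simps)
    next
      case 2
      then show ?thesis using c[of x 0 y] that z[where s=0 and t=x] z[where s=y and t=0]
        by (simp add: G_def algebra_simps)
    next
      case 3
      then show ?thesis using c[of x y 0] that z[where s=0 and t=x] z[where s=0 and t=y]
        by (simp add: G_def algebra_simps)
    qed
  qed
  then show ?thesis
    using int by (intro that[of G]) (auto simp: antiderivative_def intro!: integrable_integral)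
qed

text \<open>By Cauchy-Schwarz the antiderivative is even Hoelder continuous of exponent 1/2.\<close>

lemma antiderivative_L2_continuous:
  assumes g: "g \<in> L2" and G: "antiderivative g G"
  shows "continuous_on UNIV G"
proof -
  define m where "m = enn2real (mass_sq g)"
  have holder: "(cmod (G y - G x))\<^sup>2 \<le> (y - x) * m" if "x \<le> y" for x y
  proof -
    have "(\<integral>\<^sup>+t. ennreal ((cmod (g t))\<^sup>2) * indicator {x..y} t \<partial>lebesgue) \<le> mass_sq g"
      unfolding mass_sq_def by (intro nn_integral_mono) (auto split: split_indicator)
    then have "enn2real (\<integral>\<^sup>+t. ennreal ((cmod (g t))\<^sup>2) * indicator {x..y} t \<partial>lebesgue) \<le> m"
      unfolding m_def using g by (intro enn2real_mono) (auto simp: L2_iff)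
    then show ?thesis
      using has_integral_sq_bound[OF g that, of "G y - G x"] G that
        mult_left_mono[of _ m "y - x"]
      unfolding antiderivative_def by (meson diff_ge_0_iff_ge order_trans)
  qed
  have "dist (G y) (G x) \<le> sqrt (dist y x * m)" for x y
    using holder[of x y] holder[of y x]
    by (intro real_le_rsqrt) (cases "x \<le> y"; auto simp: dist_norm norm_minus_commute)
  moreover have "((\<lambda>y. sqrt (dist y x * m)) \<longlongrightarrow> 0) (at x)" for x :: real
  proof -
    have "((\<lambda>y. sqrt (dist y x * m)) \<longlongrightarrow> sqrt (dist x x * m)) (at x)"
      by (intro tendsto_intros)
    then show ?thesis by simp
  qed
  ultimately have "((\<lambda>y. dist (G y) (G x)) \<longlongrightarrow> 0) (at x)" for x
    by (auto intro: tendsto_sandwich[OF always_eventually always_eventually, of "\<lambda>_. 0" _ "\<lambda>y. sqrt (dist y x * m)"])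
  then have "(G \<longlongrightarrow> G x) (at x)" for x
    by (rule iffD2[OF tendsto_dist_iff])
  then show ?thesis by (simp add: continuous_on_def)
qed

text \<open>Comparison with a classical antiderivative that agrees at 0. The weak derivative of
  \<open>dx\<close> thus becomes a pointwise one as soon as it is continuous.\<close>

lemma antiderivative_continuous_deriv:
  assumes "continuous_on UNIV w" "antiderivative w v"
  shows "(v has_vector_derivative w x) (at x)"
proof -
  obtain F where F: "F 0 = v 0" "\<And>x. (F has_vector_derivative w x) (at x)"
    using antiderivative_exists[OF assms(1)] by metis
  have "F y - F x = v y - v x" if "x \<le> y" for x y
  proof -
    have "(w has_integral (F y - F x)) {x..y}"
      using that F(2) by (intro fundamental_theorem_of_calculus) (auto intro: has_vector_derivative_at_within)
    then show ?thesis using assms(2) that unfolding antiderivative_def by (blast dest: has_integral_unique)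
  qed
  from this[of 0] this[of _ 0] have "F y = v y" for y
    using F(1) by (cases "0 \<le> y") auto
  then have "F = v" by blast
  then show ?thesis using F(2) by simp
qed

lemma deriv_antiderivative:
  assumes "\<And>x. (v has_vector_derivative w x) (at x)"
  shows "antiderivative w v"
  unfolding antiderivative_def
  using assms by (auto intro!: fundamental_theorem_of_calculus intro: has_vector_derivative_at_within)

lemma antiderivative_add: "antiderivative g G \<Longrightarrow> antiderivative h H \<Longrightarrow> antiderivative (\<lambda>x. g x + h x) (\<lambda>x. G x + H x)"
  unfolding antiderivative_def
  by (intro allI impI, rule has_integral_eq_rhs[OF has_integral_add]) (auto simp: algebra_simps)

lemma antiderivative_diff: "antiderivative g G \<Longrightarrow> antiderivative h H \<Longrightarrow> antiderivative (\<lambda>x. g x - h x) (\<lambda>x. G x - H x)"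
  unfolding antiderivative_def
  by (intro allI impI, rule has_integral_eq_rhs[OF has_integral_diff]) (auto simp: algebra_simps)

lemma continuous_lebesgue_measurable:
  "continuous_on UNIV f \<Longrightarrow> (f :: real \<Rightarrow> 'a::topological_space) \<in> borel_measurable lebesgue"
  by (simp add: borel_measurable_continuous_onI measurable_completion)

lemma mass_sq_vec3:
  fixes Y :: "real \<Rightarrow> complex^3"
  assumes Y: "continuous_on UNIV Y"
  shows "mass_sq Y = mass_sq (\<lambda>x. Y x $ 1) + mass_sq (\<lambda>x. Y x $ 2) + mass_sq (\<lambda>x. Y x $ 3)"
proof -
  have [measurable]: "(\<lambda>x. Y x $ i) \<in> borel_measurable lebesgue" for i
    by (intro continuous_lebesgue_measurable continuous_on_component Y)
  have "ennreal ((norm (Y x))\<^sup>2) = ennreal ((cmod (Y x $ 1))\<^sup>2) + ennreal ((cmod (Y x $ 2))\<^sup>2) + ennreal ((cmod (Y x $ 3))\<^sup>2)" for x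
    by (simp add: norm_vec_def L2_set_def sum_3 ennreal_plus[symmetric] del: ennreal_plus)
  then show ?thesis
    unfolding mass_sq_def by (simp add: nn_integral_add)
qed

section \<open>The resolvent set\<close>

lemma cell_sq_closed:
  "(\<integral>\<^sup>+x. ennreal ((norm (v x))\<^sup>2) * indicator {of_int n * T..of_int (n + 1) * T} x \<partial>lebesgue) = cell_sq T v n"
  unfolding cell_sq_def
  by (intro nn_integral_cong_AE AE_I'[of "{of_int (n + 1) * T}"]) (auto split: split_indicator)

lemma cell_sq_le_mass_sq: "cell_sq T v n \<le> mass_sq v"
  unfolding cell_sq_def mass_sq_def by (intro nn_integral_mono) (auto split: split_indicator)

context hill
begin

text \<open>Subtracting the antiderivative of the forcing leaves a classical solution, so that only
  continuous coefficients have to be integrated.\<close>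

definition mild :: "complex \<Rightarrow> (real \<Rightarrow> complex) \<Rightarrow> (real \<Rightarrow> complex^3) \<Rightarrow> bool" where
  "mild \<mu> g Y \<longleftrightarrow> (\<exists>G. continuous_on UNIV G \<and> antiderivative g G \<and>
     (\<forall>x. ((\<lambda>x. Y x - G x *s axis 3 1) has_vector_derivative coef \<mu> x (Y x)) (at x)))"

lemma continuous_smult_axis: "continuous_on S G \<Longrightarrow> continuous_on S (\<lambda>x. G x *s (axis k 1 :: complex^'n))"
  unfolding vector_scalar_mult_def by (intro continuous_on_vec_lambda continuous_intros)

lemma mild_continuous: "mild \<mu> g Y \<Longrightarrow> continuous_on UNIV Y"
proof -
  assume "mild \<mu> g Y"
  then obtain G where G: "continuous_on UNIV G" "\<And>x. ((\<lambda>x. Y x - G x *s axis 3 1) has_vector_derivative coef \<mu> x (Y x)) (at x)"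
    unfolding mild_def by blast
  have "continuous_on UNIV (\<lambda>x. Y x - G x *s axis 3 1)"
    using G(2) by (meson continuous_at_imp_continuous_on has_vector_derivative_continuous)
  from continuous_on_add[OF this continuous_smult_axis[OF G(1), of 3]] show ?thesis by simp
qed

text \<open>Removing \<open>G x *s axis 3 1\<close> replaces the L2 forcing by the continuous
  forcing \<open>coef \<mu> x (G x *s axis 3 1)\<close>, to which the classical existence theorem
  applies.\<close>

lemma mild_exists:
  assumes "g \<in> L2"
  obtains Y where "mild \<mu> g Y"
proof -
  obtain G where G: "antiderivative g G" using antiderivative_L2_exists[OF assms] .
  note Gc = antiderivative_L2_continuous[OF assms G]
  obtain W where W: "solves \<mu> (\<lambda>x. coef \<mu> x (G x *s axis 3 1)) W"
    using solves_exists[OF coef_continuous[OF continuous_smult_axis[OF Gc]]] by metis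
  have "mild \<mu> g (\<lambda>x. W x + G x *s axis 3 1)"
    unfolding mild_def using W G Gc by (intro exI[of _ G]) (auto simp: coef_add solves_def)
  then show ?thesis by (rule that)
qed

lemma mild_add_solution: "mild \<mu> g Y \<Longrightarrow> solves \<mu> (\<lambda>x. 0) H \<Longrightarrow> mild \<mu> g (\<lambda>x. Y x + H x)"
proof -
  assume Y: "mild \<mu> g Y" and H: "solves \<mu> (\<lambda>x. 0) H"
  obtain G where G: "continuous_on UNIV G" "antiderivative g G"
      "\<And>x. ((\<lambda>x. Y x - G x *s axis 3 1) has_vector_derivative coef \<mu> x (Y x)) (at x)"
    using Y unfolding mild_def by blast
  have "((\<lambda>x. Y x + H x - G x *s axis 3 1) has_vector_derivative coef \<mu> x (Y x + H x)) (at x)" for x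
    using has_vector_derivative_add[OF G(3)[of x], of H "coef \<mu> x (H x)"] H
    by (simp add: solves_def coef_add algebra_simps)
  then show ?thesis unfolding mild_def using G by blast
qed

lemma norm_smult_axis: "norm (c *s (axis k 1 :: complex^'n)) = cmod c"
  by (simp add: norm_smult_vec norm_axis_1)

text \<open>One constant for all three estimates of \<open>mild_cell_bounds\<close>: a Gronwall
  factor over one period, times the weights of the initial value and of the forcing, plus
  \<open>2 * T\<close> for the part \<open>H\<close> that is split off from
  \<open>Y\<close>.\<close>

definition cell_const :: "complex \<Rightarrow> real" where
  "cell_const \<mu> = exp ((2 * coef_bound \<mu> + 1) * T) * (2 + 2 * T + 2 * (coef_bound \<mu>)\<^sup>2 * T\<^sup>2) + 2 * T"

lemma cell_const_nonneg: "0 \<le> cell_const \<mu>"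
  unfolding cell_const_def using T_pos by (intro add_nonneg_nonneg mult_nonneg_nonneg) auto

text \<open>Gronwall on one period, applied after the increment of the antiderivative of
  \<open>g\<close> is removed. The first two bounds make the samples at multiples of
  \<open>T\<close> comparable with the L2 norm; the third turns these samples into a recursion with
  square-summable forcing.\<close>

lemma mild_cell_bounds:
  fixes n :: int
  assumes g: "g \<in> L2" and Y: "mild \<mu> g Y"
  defines "a \<equiv> of_int n * T" and "E \<equiv> enn2real (cell_sq T g n)"
  shows "x \<in> {a..a + T} \<Longrightarrow> (norm (Y x))\<^sup>2 \<le> cell_const \<mu> * ((norm (Y a))\<^sup>2 + E)"
    and "x \<in> {a..a + T} \<Longrightarrow> (norm (Y a))\<^sup>2 \<le> cell_const \<mu> * ((norm (Y x))\<^sup>2 + E)"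
    and "(norm (Y (a + T) - monodromy \<mu> *v Y a))\<^sup>2 \<le> cell_const \<mu> * E"
proof -
  obtain G where G: "antiderivative g G"
      "\<And>x. ((\<lambda>x. Y x - G x *s axis 3 1) has_vector_derivative coef \<mu> x (Y x)) (at x)"
    using Y unfolding mild_def by blast
  define K where "K = coef_bound \<mu>"
  define X where "X = exp ((2 * K + 1) * T)"
  define c where "c = sqrt (T * E)"
  have K: "0 \<le> K" unfolding K_def by (rule coef_bound_nonneg)
  have X: "1 \<le> X" unfolding X_def using K T_pos by simp
  have E: "0 \<le> E" by (simp add: E_def)
  have c2: "c\<^sup>2 = T * E" and c0: "0 \<le> c" unfolding c_def using T_pos E by auto
  have cell_const: "cell_const \<mu> = X * (2 + 2 * T + 2 * K\<^sup>2 * T\<^sup>2) + 2 * T"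
    by (simp add: cell_const_def K_def X_def)
  \<comment> \<open>Normalized to vanish at \<open>a\<close>, so that \<open>W\<close> below starts
    from \<open>Y a\<close> and the correction is at most \<open>c\<close> throughout the
    period.\<close>
  define H where "H x = G x - G a" for x
  have H: "cmod (H x) \<le> c" "(cmod (H x))\<^sup>2 \<le> T * E" if x: "x \<in> {a..a + T}" for x
  proof -
    have "(g has_integral H x) {a..x}" using G(1) x unfolding antiderivative_def H_def by auto
    then have "(cmod (H x))\<^sup>2 \<le> (x - a) * enn2real (\<integral>\<^sup>+t. ennreal ((cmod (g t))\<^sup>2) * indicator {a..x} t \<partial>lebesgue)"
      using x by (intro has_integral_sq_bound[OF g]) auto
    also have "\<dots> \<le> T * E"
    proof (rule mult_mono)
      have "(\<integral>\<^sup>+t. ennreal ((cmod (g t))\<^sup>2) * indicator {a..x} t \<partial>lebesgue) \<le> cell_sq T g n"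
        unfolding cell_sq_closed[symmetric] using x
        by (intro nn_integral_mono) (auto split: split_indicator simp: a_def algebra_simps)
      moreover have "cell_sq T g n < \<infinity>"
        using cell_sq_le_mass_sq[of T g n] g by (auto simp: L2_iff intro: order_le_less_trans)
      ultimately show "enn2real (\<integral>\<^sup>+t. ennreal ((cmod (g t))\<^sup>2) * indicator {a..x} t \<partial>lebesgue) \<le> E"
        unfolding E_def by (intro enn2real_mono) auto
    qed (use x T_pos in auto)
    finally show 2: "(cmod (H x))\<^sup>2 \<le> T * E" .
    then show "cmod (H x) \<le> c" unfolding c_def by (rule real_le_rsqrt)
  qed
  define W where "W x = Y x - H x *s axis 3 1" for x
  have W_eq: "W x = (Y x - G x *s axis 3 1) + G a *s axis 3 1" for x
    by (simp add: W_def H_def vec_eq_iff algebra_simps)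
  have dW: "(W has_vector_derivative coef \<mu> x (Y x)) (at x)" for x
    unfolding W_eq[abs_def] using has_vector_derivative_add[OF G(2) has_vector_derivative_const] by fastforce
  have Wa: "W a = Y a" by (simp add: W_def H_def vec_eq_iff)
  have YW: "norm (Y x) \<le> norm (W x) + c" "norm (W x) \<le> norm (Y x) + c" if "x \<in> {a..a + T}" for x
    using H(1)[OF that] norm_triangle_ineq[of "W x" "H x *s axis 3 1"] norm_triangle_ineq4[of "Y x" "H x *s axis 3 1"]
    by (simp_all add: W_def norm_smult_axis)
  have sq: "r\<^sup>2 \<le> 2 * s\<^sup>2 + 2 * (T * E)" if "r \<le> s + c" "0 \<le> r" for r s
  proof -
    have "r\<^sup>2 \<le> (s + c)\<^sup>2" using that by (intro power_mono)
    also have "\<dots> \<le> 2 * s\<^sup>2 + 2 * c\<^sup>2" using norm_add_sq[of s c] by simp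
    finally show ?thesis by (simp add: c2)
  qed
  have der: "norm (coef \<mu> x (Y x)) \<le> K * norm (W x) + K * c" if "x \<in> {a..a + T}" for x
  proof -
    have "norm (coef \<mu> x (Y x)) \<le> K * norm (Y x)" unfolding K_def by (rule coef_norm)
    also have "\<dots> \<le> K * (norm (W x) + c)" using YW(1)[OF that] K by (intro mult_left_mono)
    finally show ?thesis by (simp add: algebra_simps)
  qed
  have Xle: "exp ((2 * K + 1) * (x - a)) * (r + (K * c)\<^sup>2 * (x - a)) \<le> X * (r + K\<^sup>2 * T\<^sup>2 * E)"
    if "x \<in> {a..a + T}" "0 \<le> r" for x r
  proof (rule mult_mono)
    show "exp ((2 * K + 1) * (x - a)) \<le> X" unfolding X_def using that K by auto
    have "(K * c)\<^sup>2 * (x - a) \<le> (K * c)\<^sup>2 * T" using that by (intro mult_left_mono) auto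
    also have "\<dots> = K\<^sup>2 * T\<^sup>2 * E" by (simp add: power_mult_distrib c2) (simp add: power2_eq_square)
    finally show "r + (K * c)\<^sup>2 * (x - a) \<le> r + K\<^sup>2 * T\<^sup>2 * E" by simp
  qed (use that X in auto)
  have T0: "0 \<le> T" using T_pos by simp
  have prods: "0 \<le> X * T" "0 \<le> X * (K\<^sup>2 * T\<^sup>2)" "0 \<le> X * T * E" "0 \<le> X * (K\<^sup>2 * T\<^sup>2) * E" "0 \<le> T * E" "E \<le> X * E"
    using X T0 E mult_right_mono[of 1 X E] by auto
  have finish: "2 * (X * (r + K\<^sup>2 * T\<^sup>2 * E)) + 2 * (T * E) \<le> cell_const \<mu> * (r + E)"
    "X * ((2 * r + 2 * (T * E)) + K\<^sup>2 * T\<^sup>2 * E) \<le> cell_const \<mu> * (r + E)" if "0 \<le> r" for r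
  proof -
    have "0 \<le> X * T * r" "0 \<le> X * (K\<^sup>2 * T\<^sup>2) * r" "0 \<le> T * r" "0 \<le> X * r"
      using X T0 that by auto
    then show "2 * (X * (r + K\<^sup>2 * T\<^sup>2 * E)) + 2 * (T * E) \<le> cell_const \<mu> * (r + E)"
      "X * ((2 * r + 2 * (T * E)) + K\<^sup>2 * T\<^sup>2 * E) \<le> cell_const \<mu> * (r + E)"
      using prods E unfolding cell_const by (simp_all add: algebra_simps)
  qed
  show "(norm (Y x))\<^sup>2 \<le> cell_const \<mu> * ((norm (Y a))\<^sup>2 + E)" if x: "x \<in> {a..a + T}"
  proof -
    have "(norm (W x))\<^sup>2 \<le> exp ((2 * K + 1) * (x - a)) * ((norm (W a))\<^sup>2 + (K * c)\<^sup>2 * (x - a))"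
      by (rule gronwall[OF _ K dW der]) (use x in auto)
    also have "\<dots> \<le> X * ((norm (Y a))\<^sup>2 + K\<^sup>2 * T\<^sup>2 * E)"
      unfolding Wa using x by (intro Xle) auto
    finally show ?thesis
      using sq[OF YW(1)[OF x]] finish(1)[of "(norm (Y a))\<^sup>2"] by auto
  qed
  show "(norm (Y a))\<^sup>2 \<le> cell_const \<mu> * ((norm (Y x))\<^sup>2 + E)" if x: "x \<in> {a..a + T}"
  proof -
    have "(norm (W a))\<^sup>2 \<le> exp ((2 * K + 1) * (x - a)) * ((norm (W x))\<^sup>2 + (K * c)\<^sup>2 * (x - a))"
      by (rule gronwall_backward[OF _ K dW der]) (use x in auto)
    also have "\<dots> \<le> X * ((norm (W x))\<^sup>2 + K\<^sup>2 * T\<^sup>2 * E)"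
      using x by (intro Xle) auto
    also have "\<dots> \<le> X * ((2 * (norm (Y x))\<^sup>2 + 2 * (T * E)) + K\<^sup>2 * T\<^sup>2 * E)"
      using sq[OF YW(2)[OF x]] X by (intro mult_left_mono add_right_mono) auto
    finally show ?thesis
      using finish(2)[of "(norm (Y x))\<^sup>2"] unfolding Wa by auto
  qed
  show "(norm (Y (a + T) - monodromy \<mu> *v Y a))\<^sup>2 \<le> cell_const \<mu> * E"
  proof -
    \<comment> \<open>The homogeneous flow started at \<open>Y a\<close> and moved to the current
      period; by periodicity of the coefficient it ends at
      \<open>monodromy \<mu> *v Y a\<close>.\<close>
    define Z where "Z x = flow \<mu> (Y a) (x + of_int (- n) * T)" for x
    have Z: "(Z has_vector_derivative coef \<mu> x (Z x)) (at x)" for x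
      using solves_shift[OF flow(2), of \<mu> "Y a" "-n"] by (simp add: solves_def Z_def[abs_def])
    have Za: "Z a = Y a" "Z (a + T) = monodromy \<mu> *v Y a"
      by (simp_all add: Z_def a_def flow monodromy_flow)
    have "(norm (W (a + T) - Z (a + T)))\<^sup>2 \<le> exp ((2 * K + 1) * (a + T - a)) * ((norm (W a - Z a))\<^sup>2 + (K * c)\<^sup>2 * (a + T - a))"
    proof (rule gronwall[where Y = "\<lambda>x. W x - Z x", OF _ K has_vector_derivative_diff[OF dW Z]])
      fix x assume "a \<le> x" "x \<le> a + T"
      then have x: "x \<in> {a..a + T}" by simp
      have "norm (coef \<mu> x (Y x) - coef \<mu> x (Z x)) \<le> K * norm (Y x - Z x)"
        unfolding K_def coef_diff[symmetric] by (rule coef_norm)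
      also have "Y x - Z x = (W x - Z x) + H x *s axis 3 1" by (simp add: W_def)
      also have "K * norm \<dots> \<le> K * (norm (W x - Z x) + c)"
        using H(1)[OF x] norm_triangle_ineq[of "W x - Z x" "H x *s axis 3 1"] K
        by (intro mult_left_mono) (auto simp: norm_smult_axis)
      finally show "norm (coef \<mu> x (Y x) - coef \<mu> x (Z x)) \<le> K * norm (W x - Z x) + K * c"
        by (simp add: algebra_simps)
    qed (use T_pos in auto)
    also have "\<dots> \<le> X * (0 + K\<^sup>2 * T\<^sup>2 * E)"
      unfolding Wa Za by (rule order_trans[OF _ Xle[of "a + T" 0]]) (use T_pos in auto)
    finally have 1: "(norm (W (a + T) - Z (a + T)))\<^sup>2 \<le> X * (0 + K\<^sup>2 * T\<^sup>2 * E)" .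
    have "Y (a + T) - monodromy \<mu> *v Y a = (W (a + T) - Z (a + T)) + H (a + T) *s axis 3 1"
      by (simp add: W_def Za)
    then have "norm (Y (a + T) - monodromy \<mu> *v Y a) \<le> norm (W (a + T) - Z (a + T)) + c"
      using H(1)[of "a + T"] norm_triangle_ineq[of "W (a + T) - Z (a + T)" "H (a + T) *s axis 3 1"] T_pos
      by (simp add: norm_smult_axis)
    from sq[OF this] 1 finish(1)[of 0] show ?thesis by simp
  qed
qed

text \<open>Integration of the pointwise comparisons over one cell, in \<open>ennreal\<close> so
  that the cells can be summed.\<close>

lemma mild_cell_ennreal:
  assumes g: "g \<in> L2" and Y: "mild \<mu> g Y"
  shows "ennreal T * ennreal ((norm (Y (of_int n * T)))\<^sup>2) \<le> ennreal (cell_const \<mu>) * (cell_sq T Y n + ennreal T * cell_sq T g n)"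
    and "cell_sq T Y n \<le> ennreal (cell_const \<mu> * T) * (ennreal ((norm (Y (of_int n * T)))\<^sup>2) + cell_sq T g n)"
proof -
  let ?I = "{of_int n * T..<of_int (n + 1) * T}"
  have [measurable]: "Y \<in> borel_measurable lebesgue"
    by (intro continuous_lebesgue_measurable mild_continuous[OF Y])
  have fin: "cell_sq T g n < \<infinity>"
    using cell_sq_le_mass_sq[of T g n] g by (auto simp: L2_iff intro: order_le_less_trans)
  have E: "ennreal (enn2real (cell_sq T g n)) = cell_sq T g n" using fin by (simp add: ennreal_enn2real_if)
  have I: "emeasure lebesgue ?I = ennreal T" using T_pos by (simp add: algebra_simps)
  have const: "(\<integral>\<^sup>+x. c * indicator ?I x \<partial>lebesgue) = c * ennreal T" for c
  proof -
    have "(\<integral>\<^sup>+x. c * indicator ?I x \<partial>lebesgue) = c * emeasure lebesgue ?I"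
      by (rule nn_integral_cmult_indicator) simp
    then show ?thesis unfolding I .
  qed
  have m: "(\<lambda>x. ennreal ((norm (Y x))\<^sup>2) * indicator ?I x) \<in> borel_measurable lebesgue"
    "(\<lambda>x. cell_sq T g n * indicator ?I x) \<in> borel_measurable lebesgue"
    by (intro borel_measurable_times_ennreal norm_sq_measurable interval_indicator_measurable borel_measurable_const; measurable)+
  have x: "x \<in> {of_int n * T..of_int n * T + T}" if "x \<in> ?I" for x using that by (auto simp: algebra_simps)
  have "ennreal ((norm (Y (of_int n * T)))\<^sup>2) * ennreal T = (\<integral>\<^sup>+x. ennreal ((norm (Y (of_int n * T)))\<^sup>2) * indicator ?I x \<partial>lebesgue)"
    by (rule const[symmetric])
  also have "\<dots> \<le> (\<integral>\<^sup>+x. ennreal (cell_const \<mu>) * (ennreal ((norm (Y x))\<^sup>2) * indicator ?I x + cell_sq T g n * indicator ?I x) \<partial>lebesgue)"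
  proof (rule nn_integral_mono)
    fix t
    show "ennreal ((norm (Y (of_int n * T)))\<^sup>2) * indicator ?I t \<le> ennreal (cell_const \<mu>) * (ennreal ((norm (Y t))\<^sup>2) * indicator ?I t + cell_sq T g n * indicator ?I t)"
    proof (cases "t \<in> ?I")
      case True
      have "ennreal ((norm (Y (of_int n * T)))\<^sup>2) \<le> ennreal (cell_const \<mu> * ((norm (Y t))\<^sup>2 + enn2real (cell_sq T g n)))"
        by (intro ennreal_leI mild_cell_bounds(2)[OF g Y x[OF True]])
      also have "\<dots> = ennreal (cell_const \<mu>) * (ennreal ((norm (Y t))\<^sup>2) + cell_sq T g n)"
        using cell_const_nonneg by (simp add: ennreal_mult ennreal_plus E)
      finally show ?thesis using True by simp
    qed simp
  qed
  also have "\<dots> = ennreal (cell_const \<mu>) * (cell_sq T Y n + cell_sq T g n * ennreal T)"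
    by (subst nn_integral_cmult, intro borel_measurable_add m, subst nn_integral_add[OF m])
      (simp only: const cell_sq_def[of T Y])
  finally show "ennreal T * ennreal ((norm (Y (of_int n * T)))\<^sup>2) \<le> ennreal (cell_const \<mu>) * (cell_sq T Y n + ennreal T * cell_sq T g n)"
    by (simp add: mult.commute)
  have "cell_sq T Y n \<le> (\<integral>\<^sup>+x. (ennreal (cell_const \<mu>) * (ennreal ((norm (Y (of_int n * T)))\<^sup>2) + cell_sq T g n)) * indicator ?I x \<partial>lebesgue)"
    unfolding cell_sq_def[of T Y]
  proof (rule nn_integral_mono)
    fix t
    show "ennreal ((norm (Y t))\<^sup>2) * indicator ?I t \<le> ennreal (cell_const \<mu>) * (ennreal ((norm (Y (of_int n * T)))\<^sup>2) + cell_sq T g n) * indicator ?I t"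
    proof (cases "t \<in> ?I")
      case True
      have "ennreal ((norm (Y t))\<^sup>2) \<le> ennreal (cell_const \<mu> * ((norm (Y (of_int n * T)))\<^sup>2 + enn2real (cell_sq T g n)))"
        by (intro ennreal_leI mild_cell_bounds(1)[OF g Y x[OF True]])
      also have "\<dots> = ennreal (cell_const \<mu>) * (ennreal ((norm (Y (of_int n * T)))\<^sup>2) + cell_sq T g n)"
        using cell_const_nonneg by (simp add: ennreal_mult ennreal_plus E)
      finally show ?thesis using True by simp
    qed simp
  qed
  also have "\<dots> = ennreal (cell_const \<mu> * T) * (ennreal ((norm (Y (of_int n * T)))\<^sup>2) + cell_sq T g n)"
    unfolding const using cell_const_nonneg T_pos by (simp add: ennreal_mult ac_simps)
  finally show "cell_sq T Y n \<le> ennreal (cell_const \<mu> * T) * (ennreal ((norm (Y (of_int n * T)))\<^sup>2) + cell_sq T g n)" .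
qed

lemma mild_mass_sq:
  assumes g: "g \<in> L2" and Y: "mild \<mu> g Y"
  shows "ennreal T * sq_sum (\<lambda>n. Y (of_int n * T)) \<le> ennreal (cell_const \<mu>) * (mass_sq Y + ennreal T * mass_sq g)"
    and "mass_sq Y \<le> ennreal (cell_const \<mu> * T) * (sq_sum (\<lambda>n. Y (of_int n * T)) + mass_sq g)"
    and "sq_sum (\<lambda>n. Y (of_int (n + 1) * T) - monodromy \<mu> *v Y (of_int n * T)) \<le> ennreal (cell_const \<mu>) * mass_sq g"
proof -
  have gm: "g \<in> borel_measurable lebesgue" using g by (simp add: L2_def)
  have Ym: "Y \<in> borel_measurable lebesgue"
    by (intro continuous_lebesgue_measurable mild_continuous[OF Y])
  note cells = mass_sq_cells[OF T_pos gm] mass_sq_cells[OF T_pos Ym]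
  have "ennreal T * sq_sum (\<lambda>n. Y (of_int n * T)) = (\<integral>\<^sup>+n. ennreal T * ennreal ((norm (Y (of_int n * T)))\<^sup>2) \<partial>count_space UNIV)"
    by (simp add: sq_sum_def nn_integral_cmult)
  also have "\<dots> \<le> (\<integral>\<^sup>+n. ennreal (cell_const \<mu>) * (cell_sq T Y n + ennreal T * cell_sq T g n) \<partial>count_space UNIV)"
    by (intro nn_integral_mono mild_cell_ennreal g Y)
  also have "\<dots> = ennreal (cell_const \<mu>) * (mass_sq Y + ennreal T * mass_sq g)"
    by (simp add: cells nn_integral_cmult nn_integral_add)
  finally show "ennreal T * sq_sum (\<lambda>n. Y (of_int n * T)) \<le> ennreal (cell_const \<mu>) * (mass_sq Y + ennreal T * mass_sq g)" .
  have "mass_sq Y \<le> (\<integral>\<^sup>+n. ennreal (cell_const \<mu> * T) * (ennreal ((norm (Y (of_int n * T)))\<^sup>2) + cell_sq T g n) \<partial>count_space UNIV)"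
    unfolding cells by (intro nn_integral_mono mild_cell_ennreal g Y)
  also have "\<dots> = ennreal (cell_const \<mu> * T) * (sq_sum (\<lambda>n. Y (of_int n * T)) + mass_sq g)"
    by (simp add: cells nn_integral_cmult nn_integral_add sq_sum_def)
  finally show "mass_sq Y \<le> ennreal (cell_const \<mu> * T) * (sq_sum (\<lambda>n. Y (of_int n * T)) + mass_sq g)" .
  have "ennreal ((norm (Y (of_int (n + 1) * T) - monodromy \<mu> *v Y (of_int n * T)))\<^sup>2) \<le> ennreal (cell_const \<mu>) * cell_sq T g n" for n
  proof -
    have fin: "cell_sq T g n < \<infinity>"
      using cell_sq_le_mass_sq[of T g n] g by (auto simp: L2_iff intro: order_le_less_trans)
    have "of_int (n + 1) * T = of_int n * T + T" by (simp add: algebra_simps)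
    then have "ennreal ((norm (Y (of_int (n + 1) * T) - monodromy \<mu> *v Y (of_int n * T)))\<^sup>2)
        \<le> ennreal (cell_const \<mu> * enn2real (cell_sq T g n))"
      using mild_cell_bounds(3)[OF g Y, of n] by (intro ennreal_leI) simp
    also have "\<dots> = ennreal (cell_const \<mu>) * cell_sq T g n"
      using cell_const_nonneg fin by (simp add: ennreal_mult ennreal_enn2real_if)
    finally show ?thesis .
  qed
  then have "sq_sum (\<lambda>n. Y (of_int (n + 1) * T) - monodromy \<mu> *v Y (of_int n * T)) \<le> (\<integral>\<^sup>+n. ennreal (cell_const \<mu>) * cell_sq T g n \<partial>count_space UNIV)"
    unfolding sq_sum_def by (intro nn_integral_mono) blast
  also have "\<dots> = ennreal (cell_const \<mu>) * mass_sq g"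
    by (simp add: cells nn_integral_cmult)
  finally show "sq_sum (\<lambda>n. Y (of_int (n + 1) * T) - monodromy \<mu> *v Y (of_int n * T)) \<le> ennreal (cell_const \<mu>) * mass_sq g" .
qed

end

section \<open>Solution of the resolvent equation in L2\<close>

context hill
begin

text \<open>An arbitrary mild solution may grow, but its samples follow the monodromy matrix up to a
  square-summable defect. The l2 solution \<open>y\<close> of the recursion with this defect
  prescribes which homogeneous solution has to be added.\<close>

lemma mild_L2_exists:
  assumes M: "\<And>l y. cmod l = 1 \<Longrightarrow> monodromy \<mu> *v y = l *s y \<Longrightarrow> y = 0" and g: "g \<in> L2"
  obtains Y where "mild \<mu> g Y" "mass_sq Y < \<infinity>"
proof -
  obtain Y0 where Y0: "mild \<mu> g Y0" using mild_exists[OF g] .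
  define b where "b n = Y0 (of_int (n + 1) * T) - monodromy \<mu> *v Y0 (of_int n * T)" for n
  have gfin: "mass_sq g < \<infinity>" using g by (simp add: L2_iff)
  have "sq_sum b < \<infinity>"
    using mild_mass_sq(3)[OF g Y0] gfin unfolding b_def[abs_def]
    by (auto intro: order_le_less_trans simp: ennreal_mult_less_top)
  then obtain y where y: "sq_sum y < \<infinity>" "\<And>n. y (n + 1) = monodromy \<mu> *v y n + b n"
    using matrix_recursion_exists[of "monodromy \<mu>" b] M by blast
  define H where "H = flow \<mu> (y 0 - Y0 0)"
  have H: "solves \<mu> (\<lambda>x. 0) H" unfolding H_def by (rule flow)
  have Hn: "H (of_int n * T) = y n - Y0 (of_int n * T)" for n
  proof (induction n rule: int_induct[where k = 0])
    case base
    then show ?case by (simp add: H_def flow)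
  next
    case (step1 i)
    then show ?case
      using monodromy_solves[OF H, of i] y(2)[of i] by (simp add: b_def matrix_vector_mult_diff_distrib)
  next
    \<comment> \<open>The recursion determines only later samples from earlier ones; the downward
      step uses that the monodromy matrix is injective.\<close>
    case (step2 i)
    have "monodromy \<mu> *v (H (of_int (i - 1) * T) - (y (i - 1) - Y0 (of_int (i - 1) * T))) = 0"
      using monodromy_solves[OF H, of "i - 1"] y(2)[of "i - 1"] step2.IH
      by (simp add: b_def matrix_vector_mult_diff_distrib)
    from monodromy_inj[OF this] show ?case by simp
  qed
  define Y where "Y x = Y0 x + H x" for x
  have Y: "mild \<mu> g Y" unfolding Y_def by (rule mild_add_solution[OF Y0 H])
  have "(\<lambda>n. Y (of_int n * T)) = y" by (auto simp: Y_def Hn)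
  then have "mass_sq Y < \<infinity>"
    using mild_mass_sq(2)[OF g Y] y(1) gfin
    by (auto intro: order_le_less_trans simp: ennreal_mult_less_top)
  with Y show ?thesis by (rule that)
qed

text \<open>Finiteness of \<open>mass_sq Y\<close> makes the samples square-summable, so the a
  priori bound for the recursion applies and is carried back from the samples to the
  function.\<close>

lemma mild_L2_bound:
  assumes M: "\<And>l y. cmod l = 1 \<Longrightarrow> monodromy \<mu> *v y = l *s y \<Longrightarrow> y = 0"
  obtains C where "0 \<le> C"
    "\<And>g Y. g \<in> L2 \<Longrightarrow> mild \<mu> g Y \<Longrightarrow> mass_sq Y < \<infinity> \<Longrightarrow> mass_sq Y \<le> ennreal C * mass_sq g"
proof -
  obtain D where D: "0 \<le> D" "\<And>z b. sq_sum z < \<infinity> \<Longrightarrow> (\<And>n. z (n + 1) = monodromy \<mu> *v z n + b n)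
    \<Longrightarrow> sq_sum z \<le> ennreal D * sq_sum b"
    using matrix_recursion_bound[of "monodromy \<mu>"] M by blast
  let ?K = "cell_const \<mu>"
  have K: "0 \<le> ?K" by (rule cell_const_nonneg)
  show ?thesis
  proof (rule that[of "?K * T * (D * ?K + 1)"])
    show "0 \<le> ?K * T * (D * ?K + 1)" using K D(1) T_pos by auto
    fix g Y assume g: "g \<in> L2" and Y: "mild \<mu> g Y" and fin: "mass_sq Y < \<infinity>"
    define y where "y n = Y (of_int n * T)" for n
    define b where "b n = Y (of_int (n + 1) * T) - monodromy \<mu> *v Y (of_int n * T)" for n
    have "mass_sq g < \<infinity>" using g by (simp add: L2_iff)
    then have "ennreal ?K * (mass_sq Y + ennreal T * mass_sq g) < \<infinity>"
      using fin by (simp add: ennreal_mult_less_top)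
    then have "ennreal T * sq_sum y < \<infinity>"
      unfolding y_def[abs_def] by (rule order_le_less_trans[OF mild_mass_sq(1)[OF g Y]])
    then have "sq_sum y < \<infinity>" using T_pos by (auto simp: ennreal_mult_less_top)
    then have "sq_sum y \<le> ennreal D * sq_sum b" by (rule D(2)) (simp add: y_def b_def)
    also have "\<dots> \<le> ennreal D * (ennreal ?K * mass_sq g)"
      using mild_mass_sq(3)[OF g Y] unfolding b_def[abs_def] by (intro mult_left_mono) auto
    finally have "ennreal (?K * T) * (sq_sum y + mass_sq g) \<le> ennreal (?K * T) * (ennreal D * (ennreal ?K * mass_sq g) + mass_sq g)"
      by (intro mult_left_mono add_right_mono) auto
    also have "\<dots> = ennreal (?K * T * (D * ?K + 1)) * mass_sq g"
      using K D(1) T_pos by (simp add: ennreal_mult ennreal_plus algebra_simps)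
    finally show "mass_sq Y \<le> ennreal (?K * T * (D * ?K + 1)) * mass_sq g"
      using mild_mass_sq(2)[OF g Y] unfolding y_def[abs_def] by simp
  qed
qed

lemma L2_smult: "v \<in> L2 \<Longrightarrow> (\<lambda>x. c * v x) \<in> L2"
  by (rule L2_domination[of _ v v "cmod c"]) (auto simp: norm_mult L2_def)

lemma L2_add: "v \<in> L2 \<Longrightarrow> w \<in> L2 \<Longrightarrow> (\<lambda>x. v x + w x) \<in> L2"
  by (rule L2_domination[of _ v w 1]) (auto simp: L2_def intro: norm_triangle_ineq)

lemma L2_diff: "v \<in> L2 \<Longrightarrow> w \<in> L2 \<Longrightarrow> (\<lambda>x. v x - w x) \<in> L2"
  by (rule L2_domination[of _ v w 1]) (auto simp: L2_def intro: norm_triangle_ineq4)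

text \<open>The components of a mild solution form an element of the operator graph. The second
  derivative \<open>v2\<close> stays in L2 because \<open>q\<close> is bounded.\<close>

lemma mild_imp_linearized:
  assumes g: "g \<in> L2" and Y: "mild \<mu> g Y" and fin: "mass_sq Y < \<infinity>"
  defines "v2 \<equiv> \<lambda>x. of_real (q x) * Y x $ 1 - Y x $ 3"
  shows "(\<lambda>x. Y x $ 1, \<lambda>x. Y x $ 2) \<in> dx" "(\<lambda>x. Y x $ 2, v2) \<in> dx"
    "(\<lambda>x. Y x $ 3, \<lambda>x. \<mu> * Y x $ 1 + g x) \<in> dx"
proof -
  note Yc = mild_continuous[OF Y]
  have Yi: "(\<lambda>x. Y x $ i) \<in> L2" for i
    using fin exhaust_3[of i] unfolding mass_sq_vec3[OF Yc] L2_iff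
    by (auto intro!: continuous_lebesgue_measurable continuous_on_component Yc)
  obtain G where G: "antiderivative g G"
      "\<And>x. ((\<lambda>x. Y x - G x *s axis 3 1) has_vector_derivative coef \<mu> x (Y x)) (at x)"
    using Y unfolding mild_def by blast
  have d: "((\<lambda>x. Y x $ i - G x * axis 3 1 $ i) has_vector_derivative coef \<mu> x (Y x) $ i) (at x)" for i x
    using G(2)[of x] unfolding has_vector_derivative_componentwise by simp
  have "antiderivative (\<lambda>x. Y x $ 2) (\<lambda>x. Y x $ 1)"
    using d[of 1] by (intro deriv_antiderivative) (simp add: axis_def coef_def)
  then show "(\<lambda>x. Y x $ 1, \<lambda>x. Y x $ 2) \<in> dx" by (simp add: dx_iff Yi)
  have "antiderivative v2 (\<lambda>x. Y x $ 2)"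
    using d[of 2] by (intro deriv_antiderivative) (simp add: axis_def coef_def v2_def)
  moreover have "v2 \<in> L2"
  proof (rule L2_domination[of _ "\<lambda>x. Y x $ 1" "\<lambda>x. Y x $ 3" q_bound])
    show "v2 \<in> borel_measurable lebesgue"
      unfolding v2_def by (intro continuous_lebesgue_measurable continuous_intros Yc q_cont continuous_on_component)
    show "cmod (v2 x) \<le> q_bound * cmod (Y x $ 1) + cmod (Y x $ 3)" for x
      unfolding v2_def using norm_triangle_ineq4[of "of_real (q x) * Y x $ 1" "Y x $ 3"]
        mult_right_mono[OF q_bound(2)[of x] norm_ge_zero[of "Y x $ 1"]]
      by (simp add: norm_mult)
  qed (rule Yi)+
  ultimately show "(\<lambda>x. Y x $ 2, v2) \<in> dx" by (simp add: dx_iff Yi)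
  have "antiderivative (\<lambda>x. \<mu> * Y x $ 1) (\<lambda>x. Y x $ 3 - G x)"
    using d[of 3] by (intro deriv_antiderivative) (simp add: axis_def coef_def)
  from antiderivative_add[OF this G(1)]
  show "(\<lambda>x. Y x $ 3, \<lambda>x. \<mu> * Y x $ 1 + g x) \<in> dx" by (simp add: dx_iff Yi L2_add L2_smult g)
qed

text \<open>The passage back to the system, by which the estimate for mild solutions reaches every
  element of the operator graph.\<close>

lemma linearized_imp_mild:
  assumes v: "(v, v1) \<in> dx" "(v1, v2) \<in> dx" "((\<lambda>x. of_real (q x) * v x - v2 x), h) \<in> dx"
  defines "Y \<equiv> \<lambda>x. vector [v x, v1 x, of_real (q x) * v x - v2 x] :: complex^3"
  shows "(\<lambda>x. h x - \<mu> * v x) \<in> L2" "mild \<mu> (\<lambda>x. h x - \<mu> * v x) Y" "mass_sq v \<le> mass_sq Y" "mass_sq Y < \<infinity>"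
proof -
  let ?y3 = "\<lambda>x. of_real (q x) * v x - v2 x"
  show "(\<lambda>x. h x - \<mu> * v x) \<in> L2" using v by (simp add: dx_iff L2_diff L2_smult)
  have c: "continuous_on UNIV v" "continuous_on UNIV v1" "continuous_on UNIV ?y3"
    using v antiderivative_L2_continuous unfolding dx_iff by blast+
  \<comment> \<open>\<open>v2\<close> inherits continuity from \<open>\<L> v\<close>, which lies in
    the domain of \<open>dx\<close>. Hence \<open>v\<close> and \<open>v1\<close> are classically
    differentiable.\<close>
  have "continuous_on UNIV (\<lambda>x. of_real (q x) * v x - ?y3 x)"
    by (intro continuous_on_diff c continuous_on_mult continuous_on_of_real q_cont)
  then have c2: "continuous_on UNIV v2" by simp
  have Yc: "continuous_on UNIV Y" unfolding Y_def by (intro continuous_on_vector_3 c)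
  have "mass_sq Y = mass_sq v + mass_sq v1 + mass_sq ?y3"
    unfolding mass_sq_vec3[OF Yc] by (simp add: Y_def)
  then show "mass_sq v \<le> mass_sq Y" "mass_sq Y < \<infinity>"
    using v by (auto simp: dx_iff L2_iff add_increasing2 add.assoc)
  obtain P where P: "\<And>x. (P has_vector_derivative \<mu> * v x) (at x)"
    using antiderivative_exists[of "\<lambda>x. \<mu> * v x" 0] continuous_on_mult_left[OF c(1)] by metis
  have d1: "(v has_vector_derivative v1 x) (at x)" "(v1 has_vector_derivative v2 x) (at x)" for x
    using antiderivative_continuous_deriv[OF c(2)] antiderivative_continuous_deriv[OF c2] v by (auto simp: dx_iff)
  show "mild \<mu> (\<lambda>x. h x - \<mu> * v x) Y"
    unfolding mild_def
  \<comment> \<open>\<open>\<L> v\<close> is an antiderivative of \<open>h\<close>; subtracting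
    \<open>P\<close> leaves one of the forcing \<open>h - \<mu> * v\<close>.\<close>
  proof (intro exI[of _ "\<lambda>x. ?y3 x - P x"] conjI allI)
    show "continuous_on UNIV (\<lambda>x. ?y3 x - P x)"
      by (intro continuous_on_diff c) (use P in \<open>meson continuous_at_imp_continuous_on has_vector_derivative_continuous\<close>)
    show "antiderivative (\<lambda>x. h x - \<mu> * v x) (\<lambda>x. ?y3 x - P x)"
      using v by (intro antiderivative_diff[OF _ deriv_antiderivative[OF P]]) (simp add: dx_iff)
    show "((\<lambda>x. Y x - (?y3 x - P x) *s axis 3 1) has_vector_derivative coef \<mu> x (Y x)) (at x)" for x
      unfolding has_vector_derivative_componentwise forall_3
      using d1 P by (simp add: Y_def coef_def axis_def)
  qed
qed

text \<open>Mild solutions provide the preimages, and their a priori bound the norm estimate. The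
  absence of unimodular multipliers is what makes both available.\<close>

theorem resolvent_of_linearized_op:
  assumes q: "\<And>x. q x = c - deriv f (w x)"
    and M: "\<And>l y. cmod l = 1 \<Longrightarrow> monodromy \<mu> *v y = l *s y \<Longrightarrow> y = 0"
  shows "\<mu> \<in> L2_resolvent_set (linearized_op f w c)"
proof -
  have hess: "(\<lambda>x. - v2 x - complex_of_real (deriv f (w x)) * v x + complex_of_real c * v x)
      = (\<lambda>x. of_real (q x) * v x - v2 x)" for v v2 :: "real \<Rightarrow> complex"
    by (simp add: q algebra_simps)
  have op: "(v, h) \<in> linearized_op f w c \<longleftrightarrow>
      (\<exists>v1 v2. (v, v1) \<in> dx \<and> (v1, v2) \<in> dx \<and> ((\<lambda>x. of_real (q x) * v x - v2 x), h) \<in> dx)" for v h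
    by (auto simp: linearized_op_def hessian_op_def relcomp_unfold hess)
  have "\<exists>(v, h)\<in>linearized_op f w c. AE x in lebesgue. h x - \<mu> * v x = g x" if g: "g \<in> L2" for g
  proof -
    obtain Y where Y: "mild \<mu> g Y" "mass_sq Y < \<infinity>" using mild_L2_exists[of \<mu> g] M g by blast
    have "(\<lambda>x. Y x $ 1, \<lambda>x. \<mu> * Y x $ 1 + g x) \<in> linearized_op f w c"
      unfolding op using mild_imp_linearized[OF g Y]
      by (intro exI[of _ "\<lambda>x. Y x $ 2"] exI[of _ "\<lambda>x. of_real (q x) * Y x $ 1 - Y x $ 3"]) simp
    then show ?thesis by (rule bexI[rotated]) simp
  qed
  moreover have "\<exists>C. \<forall>(v, h)\<in>linearized_op f w c. L2_norm v \<le> C * L2_norm (\<lambda>x. h x - \<mu> * v x)"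
  proof -
    obtain C where C: "0 \<le> C"
      "\<And>g Y. g \<in> L2 \<Longrightarrow> mild \<mu> g Y \<Longrightarrow> mass_sq Y < \<infinity> \<Longrightarrow> mass_sq Y \<le> ennreal C * mass_sq g"
      using mild_L2_bound[of \<mu>] M by blast
    have "L2_norm v \<le> sqrt C * L2_norm (\<lambda>x. h x - \<mu> * v x)" if vh: "(v, h) \<in> linearized_op f w c" for v h
    proof -
      obtain v1 v2 where v: "(v, v1) \<in> dx" "(v1, v2) \<in> dx" "((\<lambda>x. of_real (q x) * v x - v2 x), h) \<in> dx"
        using vh unfolding op by blast
      note l = linearized_imp_mild(1,2)[OF v, where \<mu> = \<mu>] linearized_imp_mild(3,4)[OF v]
      have "mass_sq v \<le> ennreal C * mass_sq (\<lambda>x. h x - \<mu> * v x)"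
        using C(2)[OF l(1,2,4)] l(3) by simp
      moreover have "mass_sq (\<lambda>x. h x - \<mu> * v x) < \<infinity>" using l(1) by (simp add: L2_iff)
      ultimately have "enn2real (mass_sq v) \<le> C * enn2real (mass_sq (\<lambda>x. h x - \<mu> * v x))"
        using C(1) enn2real_mono[of "mass_sq v" "ennreal C * mass_sq (\<lambda>x. h x - \<mu> * v x)"]
        by (simp add: enn2real_mult ennreal_mult_less_top)
      moreover have "v \<in> L2" using v by (simp add: dx_iff)
      ultimately show ?thesis
        using l(1) by (simp add: L2_norm_eq real_sqrt_mult[symmetric])
    qed
    then show ?thesis by blast
  qed
  ultimately show ?thesis unfolding L2_resolvent_set_def by blast
qed

end

section \<open>Period of the profile\<close>

lemma C2_fun_D:
  assumes "C2_fun f"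
  shows "(f has_real_derivative deriv f x) (at x)" "(deriv f has_real_derivative deriv (deriv f) x) (at x)"
    "continuous_on S f" "continuous_on S (deriv f)"
proof -
  show d: "(f has_real_derivative deriv f x) (at x)" "(deriv f has_real_derivative deriv (deriv f) x) (at x)" for x
    using assms by (auto simp: C2_fun_def DERIV_deriv_iff_real_differentiable)
  show "continuous_on S f" "continuous_on S (deriv f)"
    using d by (meson DERIV_isCont continuous_at_imp_continuous_on)+
qed

lemma potential_derivative:
  assumes "\<And>v. (F has_real_derivative f v) (at v)"
  shows "((\<lambda>v. E - potential F a c v) has_real_derivative (a + c * v - f v)) (at v)"
  unfolding potential_def by (rule derivative_eq_intros assms refl)+ (simp add: algebra_simps)

text \<open>The third-order equation makes \<open>r\<close> constant, and differentiating the energy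
  gives \<open>deriv w x * (r x - a) = 0\<close>. A nonconstant profile has a point of nonzero
  slope, which fixes the constant to \<open>a\<close> everywhere, the turning points
  included.\<close>

lemma profile_second_order:
  assumes f: "C2_fun f" and F: "\<And>v. (F has_real_derivative f v) (at v)"
    and w: "periodic_profile f F a E c w"
  shows "(w has_real_derivative deriv w x) (at x)"
    and "(deriv w has_real_derivative (a + c * w x - f (w x))) (at x)"
    and "(deriv w x)\<^sup>2 / 2 = E - potential F a c (w x)"
proof -
  show dw: "(w has_real_derivative deriv w x) (at x)" for x
    using w by (auto simp: periodic_profile_def DERIV_deriv_iff_real_differentiable)
  have d2w: "(deriv w has_real_derivative deriv (deriv w) x) (at x)" for x
    using w by (auto simp: periodic_profile_def DERIV_deriv_iff_real_differentiable)
  have d3w: "(deriv (deriv w) has_real_derivative deriv (deriv (deriv w)) x) (at x)" for x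
    using w by (auto simp: periodic_profile_def DERIV_deriv_iff_real_differentiable)
  have dfw: "((\<lambda>y. f (w y)) has_real_derivative deriv f (w x) * deriv w x) (at x)" for x
    using DERIV_chain2[OF C2_fun_D(1)[OF f] dw] .
  show first: "(deriv w x)\<^sup>2 / 2 = E - potential F a c (w x)" for x
    using w by (auto simp: periodic_profile_def)
  define r where "r x = deriv (deriv w) x + f (w x) - c * w x" for x
  have "(r has_real_derivative 0) (at x)" for x
  proof -
    have "(r has_real_derivative deriv (deriv (deriv w)) x + deriv (\<lambda>y. f (w y)) x - c * deriv w x) (at x)"
      unfolding r_def DERIV_imp_deriv[OF dfw]
      by (rule derivative_eq_intros d3w dfw dw refl)+ simp
    then show ?thesis using w by (simp add: periodic_profile_def)
  qed
  then have r: "r x = r y" for x y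
    using DERIV_const_ratio_const2[of x y r 0] DERIV_isconst_all by blast
  have "deriv w x * (r x - a) = 0" for x
  proof -
    have "((\<lambda>x. (deriv w x)\<^sup>2 / 2) has_real_derivative deriv w x * deriv (deriv w) x) (at x)"
      by (rule derivative_eq_intros d2w refl | simp)+
    moreover have "((\<lambda>x. (deriv w x)\<^sup>2 / 2) has_real_derivative (a + c * w x - f (w x)) * deriv w x) (at x)"
      unfolding first using DERIV_chain2[OF potential_derivative[OF F] dw] .
    ultimately have "deriv w x * deriv (deriv w) x = (a + c * w x - f (w x)) * deriv w x"
      by (rule DERIV_unique)
    then show ?thesis by (simp add: r_def algebra_simps)
  qed
  moreover obtain x0 where "deriv w x0 \<noteq> 0"
  proof (rule ccontr)
    assume "\<not> thesis"
    then have "\<forall>x. (w has_real_derivative 0) (at x)" using dw that by metis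
    then have "w constant_on UNIV" unfolding constant_on_def using DERIV_isconst_all by blast
    then show False using w by (simp add: periodic_profile_def)
  qed
  ultimately have "r x = a" using r[of x x0] by (metis eq_iff_diff_eq_0 mult_eq_0_iff)
  then have "a + c * w x - f (w x) = deriv (deriv w) x" by (simp add: r_def)
  then show "(deriv w has_real_derivative (a + c * w x - f (w x))) (at x)"
    using d2w[of x] by simp
qed

section \<open>Turning points, quadrature and reflection symmetry\<close>

text \<open>On a bounded range the C1 nonlinearity is Lipschitz, so the difference of the two
  solutions obeys a linear bound.\<close>

lemma second_order_unique:
  fixes w z w' z' g :: "real \<Rightarrow> real"
  assumes g: "\<And>v. (g has_real_derivative g' v) (at v)" "continuous_on UNIV g'"
    and w: "\<And>x. (w has_real_derivative w' x) (at x)" "\<And>x. (w' has_real_derivative g (w x)) (at x)"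
    and z: "\<And>x. (z has_real_derivative z' x) (at x)" "\<And>x. (z' has_real_derivative g (z x)) (at x)"
    and bounded: "\<And>x. \<bar>w x\<bar> \<le> B" "\<And>x. \<bar>z x\<bar> \<le> B"
    and init: "w 0 = z 0" "w' 0 = z' 0"
  shows "w x = z x"
proof -
  have "compact (g' ` {-B..B})"
    by (intro compact_continuous_image continuous_on_subset[OF g(2)]) auto
  then obtain L where L: "\<And>v. v \<in> {-B..B} \<Longrightarrow> \<bar>g' v\<bar> \<le> L"
    by (metis bounded_iff compact_imp_bounded imageI real_norm_def)
  have lip: "\<bar>g (w x) - g (z x)\<bar> \<le> L * \<bar>w x - z x\<bar>" for x
    using field_differentiable_bound[of "{-B..B}" g g' L "w x" "z x"] g(1) L bounded[of x]
    by (auto simp: abs_le_iff intro: has_field_derivative_at_within)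
  have "0 \<le> L" using L[of 0] bounded(1)[of 0] by fastforce
  have "(w x - z x, w' x - z' x) = 0"
  proof (rule linear_ode_unique[where a = 0 and K = "1 + L" and Y = "\<lambda>x. (w x - z x, w' x - z' x)" and Y' = "\<lambda>x. (w' x - z' x, g (w x) - g (z x))"])
    fix x
    show "((\<lambda>x. (w x - z x, w' x - z' x)) has_vector_derivative (w' x - z' x, g (w x) - g (z x))) (at x)"
      using w z by (intro has_vector_derivative_Pair has_vector_derivative_diff)
        (auto simp: has_real_derivative_iff_has_vector_derivative[symmetric])
    have "norm (w' x - z' x, g (w x) - g (z x)) \<le> \<bar>w' x - z' x\<bar> + \<bar>g (w x) - g (z x)\<bar>"
      using norm_Pair_le[of "w' x - z' x" "g (w x) - g (z x)"] by simp
    also have "\<dots> \<le> \<bar>w' x - z' x\<bar> + L * \<bar>w x - z x\<bar>" using lip by simp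
    also have "\<dots> \<le> norm (w x - z x, w' x - z' x) + L * norm (w x - z x, w' x - z' x)"
      using norm_fst_le[of "w x - z x" "w' x - z' x"] norm_snd_le[of "w' x - z' x" "w x - z x"] \<open>0 \<le> L\<close>
      by (intro add_mono mult_left_mono) auto
    finally show "norm (w' x - z' x, g (w x) - g (z x)) \<le> (1 + L) * norm (w x - z x, w' x - z' x)"
      by (simp add: algebra_simps)
  qed (use init in \<open>auto simp: zero_prod_def\<close>)
  then show ?thesis by (simp add: zero_prod_def)
qed

lemma first_zero:
  fixes g :: "real \<Rightarrow> real"
  assumes "continuous_on UNIV g" "g a < 0" "a < b" "0 \<le> g b"
  obtains t where "a < t" "t \<le> b" "g t = 0" "\<And>x. a \<le> x \<Longrightarrow> x < t \<Longrightarrow> g x < 0"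
proof -
  define S where "S = {x \<in> {a..b}. 0 \<le> g x}"
  have "closed {x. 0 \<le> g x}"
    using assms(1) by (intro closed_Collect_le) (auto intro: continuous_intros)
  moreover have "S = {a..b} \<inter> {x. 0 \<le> g x}" by (auto simp: S_def)
  ultimately have "compact S" by (simp add: compact_Int_closed)
  moreover have "S \<noteq> {}" using assms by (auto simp: S_def)
  ultimately obtain t where t: "t \<in> S" "\<And>x. x \<in> S \<Longrightarrow> t \<le> x"
    using compact_attains_inf by metis
  have lt: "g x < 0" if "a \<le> x" "x < t" for x
    using t(2)[of x] t(1) that by (auto simp: S_def not_le[symmetric])
  have "a < t" using t(1) assms(2) by (cases "t = a") (auto simp: S_def)
  have "g t = 0"
  proof (rule ccontr)
    assume "g t \<noteq> 0"
    then have "0 < g t" using t(1) by (auto simp: S_def)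
    then obtain x where "a \<le> x" "x \<le> t" "g x = 0"
      using IVT'[of g a 0 t] assms(2) \<open>a < t\<close> continuous_on_subset[OF assms(1)] by auto
    then show False using lt[of x] \<open>0 < g t\<close> by (cases "x = t") auto
  qed
  with \<open>a < t\<close> t(1) lt show ?thesis by (intro that[of t]) (auto simp: S_def)
qed

text \<open>\<open>a + c * um - f um\<close> is the slope of \<open>E - V\<close> at
  \<open>um\<close>. It is nonzero since the root is simple, and positive since the well lies to the
  right; it is also the second derivative of \<open>w\<close> at 0. The wave then rises while it is
  between the turning points, because the energy forbids zero slope there, and periodicity keeps it
  from staying below \<open>up\<close> forever.\<close>

lemma profile_rise:
  assumes f: "C2_fun f" and F: "\<And>v. (F has_real_derivative f v) (at v)"
    and well: "potential_well F a E c um up" and w: "periodic_profile f F a E c w" and w0: "w 0 = um"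
  shows "deriv w 0 = 0" and "a + c * um - f um > 0"
    and "\<exists>h>0. w h = up \<and> (\<forall>x. 0 < x \<and> x < h \<longrightarrow> 0 < deriv w x \<and> um < w x \<and> w x < up)"
proof -
  note so = profile_second_order[OF f F w]
  have E: "E - potential F a c um = 0" "E - potential F a c up = 0" "um < up"
      "\<And>v. um < v \<Longrightarrow> v < up \<Longrightarrow> 0 < E - potential F a c v"
    using well by (auto simp: potential_well_def simple_root_def)
  show w'0: "deriv w 0 = 0" using so(3)[of 0] w0 E(1) by simp
  have "a + c * um - f um \<noteq> 0"
    using well DERIV_imp_deriv[OF potential_derivative[OF F, of E a c um]]
    by (auto simp: potential_well_def simple_root_def)
  moreover have "\<not> a + c * um - f um < 0"
  proof
    assume "a + c * um - f um < 0"
    from DERIV_neg_dec_right[OF potential_derivative[OF F] this, of E]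
    obtain d where d: "d > 0" "\<And>h. 0 < h \<Longrightarrow> h < d \<Longrightarrow> E - potential F a c (um + h) < E - potential F a c um" by auto
    define h where "h = min (d / 2) ((up - um) / 2)"
    have "0 < h" "h < d" "um + h < up" using d E(3) by (auto simp: h_def min_def field_simps)
    then show False using d(2)[of h] E(1) E(4)[of "um + h"] by auto
  qed
  ultimately show pos: "a + c * um - f um > 0" by linarith
  have cw: "continuous_on UNIV w" "continuous_on UNIV (deriv w)"
    using so by (meson DERIV_isCont continuous_at_imp_continuous_on)+
  obtain \<epsilon> where \<epsilon>: "\<epsilon> > 0" "\<And>h. 0 < h \<Longrightarrow> h < \<epsilon> \<Longrightarrow> 0 < deriv w h"
    using DERIV_pos_inc_right[OF so(2)[of 0]] pos w0 w'0 by auto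
  have rise: "um < w x" if "0 < x" "\<And>t. 0 < t \<Longrightarrow> t < x \<Longrightarrow> 0 < deriv w t" for x
    using DERIV_pos_imp_increasing_open[of 0 x w] that so(1) w0 cw(1) by (metis continuous_on_subset subset_UNIV)
  have up: "0 < deriv w x" if x: "0 < x" and below: "\<And>t. 0 < t \<Longrightarrow> t \<le> x \<Longrightarrow> w t < up" for x
  proof (rule ccontr)
    assume neg: "\<not> 0 < deriv w x"
    \<comment> \<open>The slope vanishes at 0 itself, so the search for its first later zero starts
      at an interior point where it is already positive.\<close>
    define b where "b = min (\<epsilon> / 2) (x / 2)"
    have b: "0 < b" "b < \<epsilon>" "b < x" using \<epsilon> x by (auto simp: b_def min_def)
    obtain t where t: "b < t" "t \<le> x" "- deriv w t = 0" "\<And>y. b \<le> y \<Longrightarrow> y < t \<Longrightarrow> - deriv w y < 0"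
    proof (rule first_zero[of "\<lambda>x. - deriv w x" b x])
      show "continuous_on UNIV (\<lambda>x. - deriv w x)" by (intro continuous_intros cw)
    qed (use b \<epsilon>(2)[of b] neg in auto)
    have "0 < deriv w y" if "0 < y" "y < t" for y
      using \<epsilon>(2)[of y] t(4)[of y] that b by (cases "y < b") auto
    then have "um < w t" using rise[of t] t b by auto
    moreover have "w t < up" using below[of t] t b by auto
    ultimately have "0 < E - potential F a c (w t)" by (rule E(4))
    then show False using so(3)[of t] t(3) by simp
  qed
  obtain x where x: "0 < x" "up \<le> w x"
  proof (rule ccontr)
    assume "\<not> thesis"
    then have "\<And>x. 0 < x \<Longrightarrow> w x < up" using that by force
    then have "\<And>x. 0 < x \<Longrightarrow> 0 < deriv w x" using up by auto
    then have "\<And>x. 0 < x \<Longrightarrow> um < w x" using rise by auto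
    \<comment> \<open>Staying above \<open>um\<close> for all positive \<open>x\<close> contradicts
      the return to \<open>um\<close> after one period.\<close>
    moreover obtain \<tau> where "\<tau> > 0" "w (0 + \<tau>) = w 0" using w unfolding periodic_profile_def by metis
    ultimately show False using w0 by fastforce
  qed
  obtain h where h: "0 < h" "w h - up = 0" "\<And>t. 0 \<le> t \<Longrightarrow> t < h \<Longrightarrow> w t - up < 0"
  proof (rule first_zero[of "\<lambda>x. w x - up" 0 x])
    show "continuous_on UNIV (\<lambda>x. w x - up)" by (intro continuous_intros cw)
  qed (use x w0 E(3) in auto)
  have "0 < deriv w t" if "0 < t" "t < h" for t
    using up[of t] h(3) that by auto
  moreover from this have "um < w t" if "0 < t" "t < h" for t
    using rise[of t] that by auto
  ultimately show "\<exists>h>0. w h = up \<and> (\<forall>x. 0 < x \<and> x < h \<longrightarrow> 0 < deriv w x \<and> um < w x \<and> w x < up)"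
    using h by (intro exI[of _ h]) auto
qed

text \<open>Substitution \<open>v = w x\<close> on the rising half. The integrand may be singular at
  both ends, so the fundamental theorem is applied to the inverse function \<open>\<theta>\<close>,
  which is continuous on the closed interval and differentiable inside.\<close>

lemma quadrature_half_period:
  fixes w w' V :: "real \<Rightarrow> real"
  assumes "0 < h" and w: "\<And>x. (w has_real_derivative w' x) (at x)"
    and rise: "\<And>x. 0 < x \<Longrightarrow> x < h \<Longrightarrow> 0 < w' x"
    and energy: "\<And>x. (w' x)\<^sup>2 / 2 = V (w x)"
  shows "((\<lambda>v. 1 / sqrt (V v)) has_integral sqrt 2 * h) {w 0..w h}"
proof -
  have cw: "continuous_on S w" for S using w by (meson DERIV_isCont continuous_at_imp_continuous_on)
  have mono: "w x < w y" if "0 \<le> x" "x < y" "y \<le> h" for x y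
    by (rule DERIV_pos_imp_increasing_open[OF that(2)]) (use w rise that cw in force)+
  have inj: "inj_on w {0..h}"
    by (rule linorder_inj_onI) (use mono in force)+
  define \<theta> where "\<theta> = inv_into {0..h} w"
  have \<theta>w: "\<theta> (w x) = x" if "x \<in> {0..h}" for x unfolding \<theta>_def using inv_into_f_f[OF inj that] .
  have img: "w ` {0..h} = {w 0..w h}"
  proof
    show "w ` {0..h} \<subseteq> {w 0..w h}" using mono by (auto simp: le_less)
    show "{w 0..w h} \<subseteq> w ` {0..h}"
    proof
      fix v assume "v \<in> {w 0..w h}"
      then obtain x where "0 \<le> x" "x \<le> h" "w x = v" using IVT'[of w 0 v h] cw \<open>0 < h\<close> by auto
      then show "v \<in> w ` {0..h}" by auto
    qed
  qed
  have c\<theta>: "continuous_on {w 0..w h} \<theta>"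
    using continuous_on_inv[of "{0..h}" w \<theta>] cw \<theta>w img by auto
  have "((\<lambda>v. 1 / sqrt (2 * V v)) has_integral (\<theta> (w h) - \<theta> (w 0))) {w 0..w h}"
  proof (rule fundamental_theorem_of_calculus_interior[OF _ c\<theta>])
    show "w 0 \<le> w h" using mono[of 0 h] \<open>0 < h\<close> by simp
    fix v assume v: "v \<in> {w 0<..<w h}"
    then obtain x where x: "x \<in> {0..h}" "v = w x" using img by (metis atLeastAtMost_iff greaterThanLessThan_iff imageE less_imp_le)
    then have x': "0 < x" "x < h" using v by (auto simp: le_less)
    have "(\<theta> has_real_derivative inverse (w' x)) (at v)"
    proof (rule DERIV_inverse_function[of w "w' x" \<theta> v "w 0" "w h"])
      show "(w has_real_derivative w' x) (at (\<theta> v))" using w x \<theta>w by simp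
      show "w' x \<noteq> 0" using rise[OF x'] by simp
      show "w 0 < v" "v < w h" using v by auto
      show "w (\<theta> y) = y" if "w 0 < y" "y < w h" for y
        using that img \<theta>w by (metis atLeastAtMost_iff imageE less_imp_le)
      show "isCont \<theta> v"
        using continuous_on_interior[OF c\<theta>] v by (simp add: interior_atLeastAtMost_real)
    qed
    moreover have "w' x = sqrt (2 * V v)"
      using energy[of x] rise[OF x'] x by (intro real_sqrt_unique[symmetric]) auto
    ultimately show "(\<theta> has_vector_derivative 1 / sqrt (2 * V v)) (at v)"
      by (simp add: has_real_derivative_iff_has_vector_derivative inverse_eq_divide)
  qed
  then have "((\<lambda>v. 1 / sqrt (2 * V v)) has_integral h) {w 0..w h}"
    using \<theta>w \<open>0 < h\<close> by simp
  from has_integral_mult_right[OF this, of "sqrt 2"] show ?thesis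
    by (simp add: real_sqrt_mult)
qed

text \<open>The quadrature identifies \<open>T\<close> with twice the time \<open>h\<close> of the
  rise. By uniqueness the profile is symmetric about each of its critical points, in particular
  about 0 and \<open>h\<close>, and these two reflections compose to the translation by
  \<open>2 * h\<close>.\<close>

theorem profile_period:
  assumes f: "C2_fun f" and F: "\<And>v. (F has_real_derivative f v) (at v)"
    and well: "potential_well F a E c um up" and w: "periodic_profile f F a E c w" and w0: "w 0 = um"
  defines "T \<equiv> sqrt 2 * integral {um..up} (\<lambda>v. 1 / sqrt (E - potential F a c v))"
  shows "0 < T" and "w (x + T) = w x"
proof -
  note so = profile_second_order[OF f F w] and ri = profile_rise[OF f F well w w0]
  obtain h where h: "0 < h" "w h = up" "\<And>x. 0 < x \<Longrightarrow> x < h \<Longrightarrow> 0 < deriv w x" using ri(3) by auto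
  have "((\<lambda>v. 1 / sqrt (E - potential F a c v)) has_integral sqrt 2 * h) {w 0..w h}"
    using h so by (intro quadrature_half_period[where w' = "deriv w"]) auto
  then have T: "T = 2 * h" unfolding T_def w0 h(2) by (simp add: integral_unique)
  then show "0 < T" using h by simp
  have cw: "continuous_on UNIV w" using so(1) by (meson DERIV_isCont continuous_at_imp_continuous_on)
  obtain \<tau> where "\<tau> > 0" "\<And>x. w (x + \<tau>) = w x" using w unfolding periodic_profile_def by metis
  then obtain B where B: "\<And>x. \<bar>w x\<bar> \<le> B" using periodic_continuous_bounded[OF cw] by metis
  have g: "((\<lambda>v. a + c * v - f v) has_real_derivative c - deriv f v) (at v)" for v
    by (rule derivative_eq_intros C2_fun_D[OF f] refl)+ simp
  have gc: "continuous_on UNIV (\<lambda>v. c - deriv f v)" by (intro continuous_intros C2_fun_D[OF f])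
  have refl: "w (s + x) = w (s - x)" if "deriv w s = 0" for s x
  proof (rule second_order_unique[OF g gc, where w = "\<lambda>x. w (s + x)" and z = "\<lambda>x. w (s - x)"
        and w' = "\<lambda>x. deriv w (s + x)" and z' = "\<lambda>x. - deriv w (s - x)" and B = B])
    fix x
    have s: "((\<lambda>x. s + x) has_real_derivative 1) (at x)" "((\<lambda>x. s - x) has_real_derivative -1) (at x)"
      by (auto intro!: derivative_eq_intros)
    show "((\<lambda>x. w (s + x)) has_real_derivative deriv w (s + x)) (at x)"
      using DERIV_chain2[OF so(1) s(1)] by simp
    show "((\<lambda>x. deriv w (s + x)) has_real_derivative a + c * w (s + x) - f (w (s + x))) (at x)"
      using DERIV_chain2[OF so(2) s(1)] by simp
    show "((\<lambda>x. w (s - x)) has_real_derivative - deriv w (s - x)) (at x)"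
      using DERIV_chain2[OF so(1) s(2)] by simp
    show "((\<lambda>x. - deriv w (s - x)) has_real_derivative a + c * w (s - x) - f (w (s - x))) (at x)"
      using DERIV_minus[OF DERIV_chain2[OF so(2) s(2)]] by simp
  qed (use B that in auto)
  have "deriv w h = 0"
    using so(3)[of h] h(2) well by (auto simp: potential_well_def simple_root_def)
  from refl[OF this, of "h + x"] have "w (2 * h + x) = w (- x)" by simp
  also have "\<dots> = w x" using refl[OF ri(1), of x] by simp
  finally show "w (x + T) = w x" by (simp add: T add.commute)
qed

section \<open>Derivatives with respect to the parameters\<close>

text \<open>Quadratic Taylor remainder, uniform on bounded sets; it serves to linearize
  \<open>f\<close> along the family of waves.\<close>

lemma C2_fun_remainder:
  assumes "C2_fun f"
  obtains L where "0 \<le> L" "\<And>x y. \<bar>x\<bar> \<le> B \<Longrightarrow> \<bar>y\<bar> \<le> B \<Longrightarrow> \<bar>f y - f x - deriv f x * (y - x)\<bar> \<le> L * (y - x)\<^sup>2"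
proof -
  have c: "continuous_on UNIV (deriv (deriv f))" using assms by (simp add: C2_fun_def)
  have "compact (deriv (deriv f) ` {-B..B})"
    by (intro compact_continuous_image continuous_on_subset[OF c]) auto
  then obtain L where L: "\<And>v. v \<in> {-B..B} \<Longrightarrow> \<bar>deriv (deriv f) v\<bar> \<le> L"
    by (metis bounded_iff compact_imp_bounded imageI real_norm_def)
  have lip: "\<bar>deriv f z - deriv f x\<bar> \<le> \<bar>L\<bar> * \<bar>z - x\<bar>" if "\<bar>z\<bar> \<le> B" "\<bar>x\<bar> \<le> B" for x z
  proof -
    have "norm (deriv f z - deriv f x) \<le> \<bar>L\<bar> * norm (z - x)"
    proof (rule field_differentiable_bound[where S = "{-B..B}"])
      show "(deriv f has_field_derivative deriv (deriv f) v) (at v within {-B..B})" for v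
        by (rule has_field_derivative_at_within[OF C2_fun_D(2)[OF assms]])
      show "norm (deriv (deriv f) v) \<le> \<bar>L\<bar>" if "v \<in> {-B..B}" for v
        using L[OF that] by simp
    qed (use that in \<open>auto simp: abs_le_iff\<close>)
    then show ?thesis by simp
  qed
  show ?thesis
  proof (rule that[of "\<bar>L\<bar>"])
    fix x y assume xy: "\<bar>x\<bar> \<le> B" "\<bar>y\<bar> \<le> B"
    have "norm ((f y - deriv f x * y) - (f x - deriv f x * x)) \<le> (\<bar>L\<bar> * \<bar>y - x\<bar>) * norm (y - x)"
    proof (rule field_differentiable_bound[OF convex_closed_segment])
      show "((\<lambda>z. f z - deriv f x * z) has_field_derivative (deriv f z - deriv f x)) (at z within closed_segment x y)" for z
        by (rule has_field_derivative_at_within[OF DERIV_diff[OF C2_fun_D(1)[OF assms] DERIV_cmult_Id]])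
      fix z assume z: "z \<in> closed_segment x y"
      then have "\<bar>z\<bar> \<le> B" "\<bar>z - x\<bar> \<le> \<bar>y - x\<bar>" using xy by (auto simp: closed_segment_eq_real_ivl split: if_splits)
      then show "norm (deriv f z - deriv f x) \<le> \<bar>L\<bar> * \<bar>y - x\<bar>"
        using lip[of z x] xy mult_left_mono[of "\<bar>z - x\<bar>" "\<bar>y - x\<bar>" "\<bar>L\<bar>"] by auto
    qed auto
    moreover have 1: "(f y - deriv f x * y) - (f x - deriv f x * x) = f y - f x - deriv f x * (y - x)"
      by (simp add: algebra_simps)
    moreover have 2: "(\<bar>L\<bar> * \<bar>y - x\<bar>) * norm (y - x) = \<bar>L\<bar> * (y - x)\<^sup>2"
      by (simp add: power2_eq_square)
    ultimately show "\<bar>f y - f x - deriv f x * (y - x)\<bar> \<le> \<bar>L\<bar> * (y - x)\<^sup>2"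
      unfolding 1 2 by (simp only: real_norm_def)
  qed simp
qed

text \<open>The conclusion repeats the locally uniform convergence of the hypothesis one derivative
  lower, so that the lemma can be iterated.\<close>

lemma derivative_of_uniform_limit:
  fixes \<delta> \<delta>' :: "nat \<Rightarrow> real \<Rightarrow> real"
  assumes d: "\<And>n x. (\<delta> n has_real_derivative \<delta>' n x) (at x)"
    and lim: "\<And>K. compact K \<Longrightarrow> uniform_limit K \<delta>' r sequentially"
    and "(\<lambda>n. \<delta> n 0) \<longlonglongrightarrow> l"
  obtains \<psi> where "\<And>x. (\<psi> has_real_derivative r x) (at x)"
    "\<And>K. compact K \<Longrightarrow> uniform_limit K \<delta> \<psi> sequentially"
proof -
  have loc: "\<exists>g. \<forall>x\<in>{-R<..<R}. (\<lambda>n. \<delta> n x) \<longlonglongrightarrow> g x \<and> (g has_derivative (*) (r x)) (at x within {-R<..<R})"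
    if "R > 0" for R
  proof (rule has_derivative_sequence[where f' = "\<lambda>n x. (*) (\<delta>' n x)" and ?x0.0 = 0])
    show "(\<delta> n has_derivative (*) (\<delta>' n x)) (at x within {-R<..<R})" for n x
      using d[of n x] by (auto simp: has_field_derivative_def intro: has_derivative_at_withinI)
    fix e :: real assume "e > 0"
    from uniform_limitD[OF lim[OF compact_Icc[of "-R" R]] this]
    show "\<forall>\<^sub>F n in sequentially. \<forall>x\<in>{-R<..<R}. \<forall>h. norm (\<delta>' n x * h - r x * h) \<le> e * norm h"
    proof (eventually_elim, intro ballI allI)
      fix n x h assume "\<forall>x\<in>{-R..R}. dist (\<delta>' n x) (r x) < e" "x \<in> {-R<..<R}"
      then have "\<bar>\<delta>' n x - r x\<bar> \<le> e" by (auto simp: dist_real_def intro: less_imp_le)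
      then show "norm (\<delta>' n x * h - r x * h) \<le> e * norm h"
        by (simp add: left_diff_distrib[symmetric] abs_mult mult_right_mono)
    qed
  qed (use that assms(3) in auto)
  define \<psi> where "\<psi> x = lim (\<lambda>n. \<delta> n x)" for x
  have \<psi>: "(\<lambda>n. \<delta> n x) \<longlonglongrightarrow> \<psi> x" "(\<psi> has_real_derivative r x) (at x)" for x
  proof -
    let ?S = "{-(\<bar>x\<bar> + 1)<..<\<bar>x\<bar> + 1}"
    obtain g where g: "\<And>y. y \<in> ?S \<Longrightarrow> (\<lambda>n. \<delta> n y) \<longlonglongrightarrow> g y"
      "\<And>y. y \<in> ?S \<Longrightarrow> (g has_derivative (*) (r y)) (at y within ?S)"
      using loc[of "\<bar>x\<bar> + 1"] abs_ge_zero[of x] by (metis add_nonneg_pos zero_less_one)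
    have x: "x \<in> ?S" by auto
    have \<psi>: "\<psi> y = g y" if "y \<in> ?S" for y unfolding \<psi>_def using g(1)[OF that] by (rule limI)
    show "(\<lambda>n. \<delta> n x) \<longlonglongrightarrow> \<psi> x" using g(1)[OF x] \<psi>[OF x] by simp
    have "(\<psi> has_derivative (*) (r x)) (at x within ?S)"
      by (rule has_derivative_transform[OF x _ g(2)[OF x]]) (simp add: \<psi>)
    then show "(\<psi> has_real_derivative r x) (at x)"
      by (simp only: has_field_derivative_def at_within_open[OF x open_greaterThanLessThan])
  qed
  show ?thesis
  proof (rule that[of \<psi>])
    show "(\<psi> has_real_derivative r x) (at x)" for x by (rule \<psi>)
    fix K :: "real set" assume "compact K"
    then obtain R where R: "R > 0" "\<And>x. x \<in> K \<Longrightarrow> \<bar>x\<bar> \<le> R"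
      by (metis bounded_pos compact_imp_bounded real_norm_def)
    show "uniform_limit K \<delta> \<psi> sequentially"
    proof (rule uniform_limitI)
      fix e :: real assume "e > 0"
      \<comment> \<open>Half of the error is left for the value at 0, the other half for the
        derivative over a length of at most \<open>R\<close>.\<close>
      then have "e / (2 * R) > 0" using R by simp
      from uniform_limitD[OF lim[OF compact_Icc[of "-R" R]] this] tendstoD[OF \<psi>(1)[of 0], of "e / 2"] \<open>e > 0\<close>
      have "\<forall>\<^sub>F n in sequentially. (\<forall>x\<in>{-R..R}. dist (\<delta>' n x) (r x) < e / (2 * R)) \<and> dist (\<delta> n 0) (\<psi> 0) < e / 2"
        by (intro eventually_conj) auto
      then show "\<forall>\<^sub>F n in sequentially. \<forall>x\<in>K. dist (\<delta> n x) (\<psi> x) < e"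
      proof (eventually_elim, intro ballI)
        fix n x assume n: "(\<forall>x\<in>{-R..R}. dist (\<delta>' n x) (r x) < e / (2 * R)) \<and> dist (\<delta> n 0) (\<psi> 0) < e / 2" and "x \<in> K"
        then have x: "x \<in> {-R..R}" using R(2)[of x] by auto
        have "norm ((\<delta> n x - \<psi> x) - (\<delta> n 0 - \<psi> 0)) \<le> e / (2 * R) * norm (x - 0)"
        proof (rule field_differentiable_bound[where S = "{-R..R}" and f = "\<lambda>x. \<delta> n x - \<psi> x"])
          show "((\<lambda>x. \<delta> n x - \<psi> x) has_field_derivative \<delta>' n y - r y) (at y within {-R..R})" for y
            by (intro DERIV_diff has_field_derivative_at_within[OF d] has_field_derivative_at_within[OF \<psi>(2)])
          show "norm (\<delta>' n y - r y) \<le> e / (2 * R)" if "y \<in> {-R..R}" for y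
            using n that by (auto simp: dist_real_def intro: less_imp_le)
        qed (use x R in auto)
        also have "\<dots> \<le> e / (2 * R) * R" using x R \<open>e > 0\<close> by (intro mult_left_mono) (auto simp: abs_le_iff)
        also have "\<dots> = e / 2" using R by simp
        finally show "dist (\<delta> n x) (\<psi> x) < e" using n unfolding dist_real_def real_norm_def by linarith
      qed
    qed
  qed
qed

text \<open>The increment splits into the integral of the difference quotient over the moving
  interval and the effect of the moving end point on the fixed function \<open>V 0\<close>.\<close>

lemma moving_endpoint_integral_derivative:
  fixes V :: "real \<Rightarrow> real \<Rightarrow> real"
  assumes V: "\<forall>\<^sub>F t in nhds 0. continuous_on UNIV (V t)"
    and lim: "\<And>K. compact K \<Longrightarrow> uniform_limit K (\<lambda>t x. (V t x - V 0 x) / t) \<eta> (at 0)"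
    and \<eta>: "continuous_on UNIV \<eta>"
    and T: "(T has_real_derivative T') (at 0)" and T0: "0 < T 0"
  shows "((\<lambda>t. integral {0..T t} (V t)) has_real_derivative integral {0..T 0} \<eta> + V 0 (T 0) * T') (at 0)"
proof -
  have V0: "continuous_on UNIV (V 0)" using V by (rule eventually_nhds_x_imp_x)
  have Tc: "(T \<longlongrightarrow> T 0) (at 0)" using DERIV_isCont[OF T] by (simp add: isCont_def)
  have ii: "g integrable_on {0..x}" if "continuous_on UNIV g" for g :: "real \<Rightarrow> real" and x
    using that by (intro integrable_continuous_real) (auto intro: continuous_on_subset)
  have FTC: "((\<lambda>x. integral {0..x} g) has_real_derivative g (T 0)) (at (T 0))" if "continuous_on UNIV g" for g :: "real \<Rightarrow> real"
  proof -
    have "((\<lambda>x. integral {0..x} g) has_real_derivative g (T 0)) (at (T 0) within {0..T 0 + 1})"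
      by (rule integral_has_real_derivative) (use T0 that in \<open>auto intro: continuous_on_subset\<close>)
    moreover have "at (T 0) within {0..T 0 + 1} = at (T 0)"
      by (rule at_within_interior) (use T0 in auto)
    ultimately show ?thesis by simp
  qed
  have 1: "((\<lambda>t. integral {0..T t} (V 0)) has_real_derivative V 0 (T 0) * T') (at 0)"
    using DERIV_chain2[OF FTC[OF V0] T] .
  have 2: "((\<lambda>t. integral {0..T t} \<eta>) \<longlongrightarrow> integral {0..T 0} \<eta>) (at 0)"
    using isCont_tendsto_compose[OF DERIV_isCont[OF FTC[OF \<eta>]] Tc] .
  have 3: "((\<lambda>t. integral {0..T t} (\<lambda>x. (V t x - V 0 x) / t) - integral {0..T t} \<eta>) \<longlongrightarrow> 0) (at 0)"
  proof (rule tendstoI)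
    fix e :: real assume "e > 0"
    let ?e = "e / (2 * (T 0 + 1))"
    have "?e > 0" using \<open>e > 0\<close> T0 by simp
    from uniform_limitD[OF lim[of "{0..T 0 + 1}"] this]
    have "\<forall>\<^sub>F t in at 0. \<forall>x\<in>{0..T 0 + 1}. dist ((V t x - V 0 x) / t) (\<eta> x) < ?e" by simp
    moreover have "\<forall>\<^sub>F t in at 0. 0 < T t \<and> T t < T 0 + 1"
      using order_tendstoD[OF Tc, of 0] order_tendstoD[OF Tc, of "T 0 + 1"] T0 by (auto elim: eventually_elim2)
    moreover have "\<forall>\<^sub>F t in at 0. continuous_on UNIV (V t)"
      using V by (auto simp: eventually_at_filter elim: eventually_mono)
    ultimately show "\<forall>\<^sub>F t in at 0. dist (integral {0..T t} (\<lambda>x. (V t x - V 0 x) / t) - integral {0..T t} \<eta>) 0 < e"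
    proof eventually_elim
      case (elim t)
      have c: "continuous_on UNIV (\<lambda>x. (V t x - V 0 x) / t)"
        using elim V0 unfolding divide_inverse by (intro continuous_intros)
      have "norm (integral {0..T t} (\<lambda>x. (V t x - V 0 x) / t - \<eta> x)) \<le> ?e * (T t - 0)"
      proof (rule integral_bound)
        show "continuous_on {0..T t} (\<lambda>x. (V t x - V 0 x) / t - \<eta> x)"
          by (intro continuous_on_diff continuous_on_subset[OF c] continuous_on_subset[OF \<eta>]) auto
        show "norm ((V t x - V 0 x) / t - \<eta> x) \<le> ?e" if "x \<in> {0..T t}" for x
          using elim that by (auto simp: dist_real_def intro: less_imp_le)
      qed (use elim in auto)
      also have "\<dots> \<le> ?e * (T 0 + 1)" using elim \<open>?e > 0\<close> by (intro mult_left_mono) auto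
      also have "\<dots> = e / 2" using T0 by (simp add: field_simps)
      also have "\<dots> < e" using \<open>e > 0\<close> by simp
      finally show ?case by (simp add: integral_diff[OF ii[OF c] ii[OF \<eta>]])
    qed
  qed
  from tendsto_add[OF tendsto_add[OF 3 2] 1[unfolded DERIV_def]]
  have "((\<lambda>t. integral {0..T t} (\<lambda>x. (V t x - V 0 x) / t) + (integral {0..T t} (V 0) - integral {0..T 0} (V 0)) / t)
      \<longlongrightarrow> integral {0..T 0} \<eta> + V 0 (T 0) * T') (at 0)"
    by simp
  moreover have "\<forall>\<^sub>F t in at 0. continuous_on UNIV (V t)"
    using V by (auto simp: eventually_at_filter elim: eventually_mono)
  then have "\<forall>\<^sub>F t in at 0. integral {0..T t} (\<lambda>x. (V t x - V 0 x) / t) + (integral {0..T t} (V 0) - integral {0..T 0} (V 0)) / t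
      = (integral {0..T (0 + t)} (V (0 + t)) - integral {0..T 0} (V 0)) / t"
    by eventually_elim (simp add: integral_diff ii V0 add_divide_distrib[symmetric])
  ultimately show ?thesis
    unfolding DERIV_def by (rule Lim_transform_eventually)
qed

section \<open>Variation of the wave along a parameter direction\<close>

text \<open>\<open>(h1, h2, h3)\<close> is a direction in the variables \<open>(a, E, s)\<close>,
  whence \<open>c0 - t * h3\<close>. The limit \<phi> is postulated for the waves themselves, not
  for their derivatives in \<open>x\<close>.\<close>

locale wave_variation =
  fixes f F :: "real \<Rightarrow> real" and U U' :: "real \<Rightarrow> real \<Rightarrow> real" and \<phi> :: "real \<Rightarrow> real"
    and a0 E0 c0 h1 h2 h3 T' :: real and T :: "real \<Rightarrow> real"
  assumes f: "C2_fun f" and F: "\<And>v. (F has_real_derivative f v) (at v)"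
    and family: "\<forall>\<^sub>F t in nhds 0. (\<forall>x. (U t has_real_derivative U' t x) (at x)) \<and>
      (\<forall>x. (U' t has_real_derivative a0 + t * h1 + (c0 - t * h3) * U t x - f (U t x)) (at x)) \<and>
      U' t 0 = 0 \<and> E0 + t * h2 - potential F (a0 + t * h1) (c0 - t * h3) (U t 0) = 0 \<and>
      (\<forall>x. U t (x + T t) = U t x)"
    and T: "(T has_real_derivative T') (at 0)" and T0: "0 < T 0"
    and lim: "\<And>K. compact K \<Longrightarrow> uniform_limit K (\<lambda>t x. (U t x - U 0 x) / t) \<phi> (at 0)"
begin

lemma family_at_0:
  "(U 0 has_real_derivative U' 0 x) (at x)" "(U' 0 has_real_derivative a0 + c0 * U 0 x - f (U 0 x)) (at x)"
  "U' 0 0 = 0" "E0 - potential F a0 c0 (U 0 0) = 0" "U 0 (x + T 0) = U 0 x"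
  using eventually_nhds_x_imp_x[OF family] by auto

lemma family_at:
  "\<forall>\<^sub>F t in at 0. t \<noteq> 0 \<and> (\<forall>x. (U t has_real_derivative U' t x) (at x)) \<and>
      (\<forall>x. (U' t has_real_derivative a0 + t * h1 + (c0 - t * h3) * U t x - f (U t x)) (at x)) \<and>
      U' t 0 = 0 \<and> E0 + t * h2 - potential F (a0 + t * h1) (c0 - t * h3) (U t 0) = 0 \<and>
      (\<forall>x. U t (x + T t) = U t x)"
  unfolding eventually_at_filter using family by (rule eventually_mono) auto

lemma U_continuous: "\<forall>\<^sub>F t in nhds 0. continuous_on UNIV (U t)"
  using family by (rule eventually_mono) (meson DERIV_isCont continuous_at_imp_continuous_on)

lemma U0_continuous: "continuous_on S (U 0)"
  using eventually_nhds_x_imp_x[OF U_continuous] by (rule continuous_on_subset) simp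

lemma phi_continuous: "continuous_on UNIV \<phi>"
proof -
  have "continuous_on {-R..R} \<phi>" for R
  proof (rule uniform_limit_theorem[OF _ lim])
    have "\<forall>\<^sub>F t in at 0. continuous_on UNIV (U t)"
      using U_continuous by (auto simp: eventually_at_filter elim: eventually_mono)
    then show "\<forall>\<^sub>F t in at 0. continuous_on {-R..R} (\<lambda>x. (U t x - U 0 x) / t)"
      by (rule eventually_mono) (auto simp: divide_inverse intro!: continuous_intros U0_continuous intro: continuous_on_subset)
  qed auto
  note Icc = this
  have "isCont \<phi> x" for x
  proof (rule continuous_on_interior)
    show "continuous_on {-(\<bar>x\<bar> + 1)..\<bar>x\<bar> + 1} \<phi>" by (rule Icc)
    have "x \<in> {-(\<bar>x\<bar> + 1)<..<\<bar>x\<bar> + 1}" by auto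
    then show "x \<in> interior {-(\<bar>x\<bar> + 1)..\<bar>x\<bar> + 1}" by (simp only: interior_atLeastAtMost_real)
  qed
  then show ?thesis by (simp add: continuous_at_imp_continuous_on)
qed

lemma pointwise: "((\<lambda>t. (U t x - U 0 x) / t) \<longlongrightarrow> \<phi> x) (at 0)"
  using tendsto_uniform_limitI[OF lim[of "{x}"]] by simp

text \<open>Derivative in \<open>t\<close> of the energy identity at the turning point, where the
  kinetic term is absent for every small \<open>t\<close>.\<close>

lemma phi_0: "(a0 + c0 * U 0 0 - f (U 0 0)) * \<phi> 0 = - (h2 + h1 * U 0 0 - h3 / 2 * (U 0 0)\<^sup>2)"
proof -
  have y: "((\<lambda>t. U t 0) has_real_derivative \<phi> 0) (at 0)"
    using pointwise[of 0] by (simp add: DERIV_def)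
  have Fy: "((\<lambda>t. F (U t 0)) has_real_derivative f (U 0 0) * \<phi> 0) (at 0)"
    using DERIV_chain2[OF F y] .
  let ?g = "\<lambda>t. E0 + t * h2 - potential F (a0 + t * h1) (c0 - t * h3) (U t 0)"
  have "(?g has_real_derivative h2 - (f (U 0 0) * \<phi> 0 - (h1 * U 0 0 + a0 * \<phi> 0)
      - (- h3 / 2 * (U 0 0)\<^sup>2 + c0 * U 0 0 * \<phi> 0))) (at 0)"
    unfolding potential_def
    by (rule derivative_eq_intros y Fy refl | simp)+
  moreover have "(?g has_real_derivative 0) (at 0)"
  proof -
    have "\<forall>\<^sub>F t in nhds 0. ?g t = 0" using family by (rule eventually_mono) blast
    from DERIV_cong_ev[OF refl this refl, of 0] show ?thesis by simp
  qed
  ultimately have "h2 - (f (U 0 0) * \<phi> 0 - (h1 * U 0 0 + a0 * \<phi> 0)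
      - (- h3 / 2 * (U 0 0)\<^sup>2 + c0 * U 0 0 * \<phi> 0)) = 0" by (rule DERIV_unique)
  then show ?thesis by (simp add: algebra_simps)
qed

text \<open>Derivative in \<open>t\<close> of the periodicity relation. Since the period moves with
  \<open>t\<close>, the variation fails to be periodic by a multiple of the translation
  mode.\<close>

lemma phi_jump: "\<phi> (x + T 0) + T' * U' 0 x = \<phi> x"
proof -
  have Tc: "(T \<longlongrightarrow> T 0) (at 0)" using DERIV_isCont[OF T] by (simp add: isCont_def)
  \<comment> \<open>The point of evaluation moves with \<open>t\<close>, so the limit uses uniform
    convergence in a neighbourhood of \<open>x + T 0\<close>.\<close>
  have 1: "((\<lambda>t. (U t (x + T t) - U 0 (x + T t)) / t) \<longlongrightarrow> \<phi> (x + T 0)) (at 0)"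
  proof -
    have "((\<lambda>t. \<phi> (x + T t)) \<longlongrightarrow> \<phi> (x + T 0)) (at 0)"
      by (rule continuous_on_tendsto_compose[OF phi_continuous]) (auto intro!: tendsto_intros Tc)
    moreover have "((\<lambda>t. (U t (x + T t) - U 0 (x + T t)) / t - \<phi> (x + T t)) \<longlongrightarrow> 0) (at 0)"
    proof (rule tendstoI)
      fix e :: real assume "e > 0"
      from uniform_limitD[OF lim[OF compact_cball[of "x + T 0" 1]] this]
      have "\<forall>\<^sub>F t in at 0. \<forall>y\<in>cball (x + T 0) 1. dist ((U t y - U 0 y) / t) (\<phi> y) < e" .
      moreover have "\<forall>\<^sub>F t in at 0. dist (T t) (T 0) < 1" using tendstoD[OF Tc] by simp
      ultimately show "\<forall>\<^sub>F t in at 0. dist ((U t (x + T t) - U 0 (x + T t)) / t - \<phi> (x + T t)) 0 < e"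
        by eventually_elim (auto simp: dist_real_def abs_minus_commute)
    qed
    ultimately show ?thesis using tendsto_add by fastforce
  qed
  have d: "(U 0 has_real_derivative U' 0 x) (at (x + T 0))"
  proof -
    have "((\<lambda>y. U 0 (y + - T 0)) has_real_derivative U' 0 x) (at (x + T 0))"
      using family_at_0(1)[of x] DERIV_shift[of "U 0" "U' 0 x" "x + T 0" "- T 0"] by simp
    moreover have "U 0 (y + - T 0) = U 0 y" for y using family_at_0(5)[of "y - T 0"] by simp
    ultimately show ?thesis by simp
  qed
  have "((\<lambda>t. U 0 (x + T t)) has_real_derivative U' 0 x * T') (at 0)"
    by (rule DERIV_chain2[of "U 0" _ "\<lambda>t. x + T t"]) (use d in \<open>auto intro!: derivative_eq_intros T\<close>)
  then have 2: "((\<lambda>t. (U 0 (x + T t) - U 0 (x + T 0)) / t) \<longlongrightarrow> U' 0 x * T') (at 0)"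
    by (simp add: DERIV_def)
  have "((\<lambda>t. (U t x - U 0 x) / t) \<longlongrightarrow> \<phi> (x + T 0) + U' 0 x * T') (at 0)"
  proof (rule Lim_transform_eventually[OF tendsto_add[OF 1 2]])
    show "\<forall>\<^sub>F t in at 0. (U t (x + T t) - U 0 (x + T t)) / t + (U 0 (x + T t) - U 0 (x + T 0)) / t = (U t x - U 0 x) / t"
      using family_at by eventually_elim (simp add: family_at_0 add_divide_distrib[symmetric])
  qed
  from tendsto_unique[OF _ this pointwise] show ?thesis by (simp add: mult.commute)
qed

lemma mass_derivative:
  "((\<lambda>t. integral {0..T t} (U t)) has_real_derivative integral {0..T 0} \<phi> + U 0 0 * T') (at 0)"
  using moving_endpoint_integral_derivative[OF U_continuous lim phi_continuous T T0] family_at_0(5)[of 0] by simp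

lemma momentum_derivative:
  "((\<lambda>t. integral {0..T t} (\<lambda>x. (U t x)\<^sup>2)) has_real_derivative
     integral {0..T 0} (\<lambda>x. 2 * U 0 x * \<phi> x) + (U 0 0)\<^sup>2 * T') (at 0)"
proof -
  have l: "uniform_limit K (\<lambda>t x. ((U t x)\<^sup>2 - (U 0 x)\<^sup>2) / t) (\<lambda>x. 2 * U 0 x * \<phi> x) (at 0)" if K: "compact K" for K
  proof -
    have b: "bounded (g ` K)" if "continuous_on UNIV g" for g :: "real \<Rightarrow> real"
      using that K by (intro compact_imp_bounded compact_continuous_image) (auto intro: continuous_on_subset)
    have t0: "uniform_limit K (\<lambda>t x. t) (\<lambda>x. 0::real) (at 0)"
      by (auto simp: uniform_limit_iff eventually_at)
    have "uniform_limit K (\<lambda>t x. (2 * U 0 x + t * ((U t x - U 0 x) / t)) * ((U t x - U 0 x) / t))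
       (\<lambda>x. (2 * U 0 x + 0 * \<phi> x) * \<phi> x) (at 0)"
      by (intro uniform_lim_mult uniform_limit_add uniform_limit_const lim[OF K] t0 b)
        (auto intro!: b continuous_intros U0_continuous phi_continuous)
    moreover have "\<forall>\<^sub>F t in at 0. t \<noteq> (0::real)" by (simp add: eventually_at_filter)
    then have "\<forall>\<^sub>F t in at 0. \<forall>x\<in>K. (2 * U 0 x + t * ((U t x - U 0 x) / t)) * ((U t x - U 0 x) / t) = ((U t x)\<^sup>2 - (U 0 x)\<^sup>2) / t"
      by eventually_elim (simp add: power2_eq_square field_simps)
    ultimately show ?thesis by (subst (asm) uniform_limit_cong) (auto elim: eventually_mono)
  qed
  have c: "\<forall>\<^sub>F t in nhds 0. continuous_on UNIV (\<lambda>x. (U t x)\<^sup>2)"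
    using U_continuous by (rule eventually_mono) (intro continuous_intros)
  have "continuous_on UNIV (\<lambda>x. 2 * U 0 x * \<phi> x)"
    by (intro continuous_intros U0_continuous phi_continuous)
  from moving_endpoint_integral_derivative[OF c l this T T0] show ?thesis
    using family_at_0(5)[of 0] by simp
qed

text \<open>The profile equation expresses the difference quotient \<open>\<delta>''\<close> of the
  second derivatives through \<delta>, which converges. As the slopes vanish at 0 for every small
  \<open>t\<close>, two integrations along a null sequence give the limits of the slopes and of the
  functions, and the latter must be \<phi>.\<close>

lemma phi_ode:
  obtains \<phi>' where "\<And>x. (\<phi> has_real_derivative \<phi>' x) (at x)"
    "\<And>x. (\<phi>' has_real_derivative h1 + c0 * \<phi> x - h3 * U 0 x - deriv f (U 0 x) * \<phi> x) (at x)" "\<phi>' 0 = 0"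
proof -
  define \<delta> where "\<delta> t x = (U t x - U 0 x) / t" for t x
  define \<delta>' where "\<delta>' t x = (U' t x - U' 0 x) / t" for t x
  define \<delta>'' where "\<delta>'' t x = h1 + c0 * \<delta> t x - h3 * (U 0 x + t * \<delta> t x) - (f (U t x) - f (U 0 x)) / t" for t x
  define r where "r x = h1 + c0 * \<phi> x - h3 * U 0 x - deriv f (U 0 x) * \<phi> x" for x
  have limr: "uniform_limit K \<delta>'' r (at 0)" if K: "compact K" for K
  proof -
    have b: "bounded (g ` K)" if "continuous_on UNIV g" for g :: "real \<Rightarrow> real"
      using that K by (intro compact_imp_bounded compact_continuous_image) (auto intro: continuous_on_subset)
    note bs = b[OF U0_continuous] b[OF phi_continuous]
    have t0: "uniform_limit K (\<lambda>t x. t) (\<lambda>x. 0::real) (at 0)"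
      by (auto simp: uniform_limit_iff eventually_at)
    have l\<delta>: "uniform_limit K \<delta> \<phi> (at 0)" unfolding \<delta>_def[abs_def] by (rule lim[OF K])
    have lt\<delta>: "uniform_limit K (\<lambda>t x. t * \<delta> t x) (\<lambda>x. 0 * \<phi> x) (at 0)"
      by (intro uniform_lim_mult t0 l\<delta> bs) (auto simp: image_constant_conv)
    have bd: "bounded ((\<lambda>x. deriv f (U 0 x)) ` K)"
      by (rule b, rule continuous_on_compose2[OF C2_fun_D(4)[OF f, of UNIV] U0_continuous]) simp
    have lf: "uniform_limit K (\<lambda>t x. deriv f (U 0 x) * \<delta> t x) (\<lambda>x. deriv f (U 0 x) * \<phi> x) (at 0)"
      by (intro uniform_lim_mult uniform_limit_const l\<delta> bs bd)
    obtain B where B: "\<And>x. x \<in> K \<Longrightarrow> \<bar>U 0 x\<bar> \<le> B" using bs(1) by (auto simp: bounded_iff)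
    obtain L where L: "0 \<le> L" "\<And>x y. \<bar>x\<bar> \<le> B + 1 \<Longrightarrow> \<bar>y\<bar> \<le> B + 1 \<Longrightarrow> \<bar>f y - f x - deriv f x * (y - x)\<bar> \<le> L * (y - x)\<^sup>2"
      using C2_fun_remainder[OF f] by metis
    \<comment> \<open>Majorant of the Taylor remainder after division by \<open>t\<close>; one
      factor of \<open>t\<close> survives and makes it vanish in the limit.\<close>
    have lz: "uniform_limit K (\<lambda>t x. L * (\<bar>t\<bar> * (\<delta> t x * \<delta> t x))) (\<lambda>x. L * (0 * (\<phi> x * \<phi> x))) (at 0)"
    proof -
      have "uniform_limit K (\<lambda>t x. \<bar>t\<bar>) (\<lambda>x. 0::real) (at 0)"
        by (auto simp: uniform_limit_iff eventually_at)
      moreover have "bounded ((\<lambda>x. \<phi> x * \<phi> x) ` K)" by (intro b continuous_intros phi_continuous)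
      ultimately show ?thesis
        by (intro uniform_lim_mult uniform_limit_const l\<delta> bs) (auto simp: image_constant_conv)
    qed
    have "\<forall>\<^sub>F t in at 0. t \<noteq> (0::real)" by (simp add: eventually_at_filter)
    moreover have "\<forall>\<^sub>F t in at 0. \<forall>x\<in>K. dist (t * \<delta> t x) (0 * \<phi> x) < 1"
      using uniform_limitD[OF lt\<delta>, of 1] by simp
    ultimately have "\<forall>\<^sub>F t in at 0. \<forall>x\<in>K. norm ((f (U t x) - f (U 0 x)) / t - deriv f (U 0 x) * \<delta> t x) \<le> L * (\<bar>t\<bar> * (\<delta> t x * \<delta> t x))"
    proof (eventually_elim, intro ballI)
      fix t x assume t: "t \<noteq> 0" "\<forall>x\<in>K. dist (t * \<delta> t x) (0 * \<phi> x) < 1" and x: "x \<in> K"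
      have d: "U t x - U 0 x = t * \<delta> t x" using t by (simp add: \<delta>_def)
      have "\<bar>U t x - U 0 x\<bar> < 1" using t(2) x unfolding d by auto
      then have "\<bar>f (U t x) - f (U 0 x) - deriv f (U 0 x) * (U t x - U 0 x)\<bar> \<le> L * (U t x - U 0 x)\<^sup>2"
        using B[OF x] by (intro L) auto
      then have "\<bar>f (U t x) - f (U 0 x) - deriv f (U 0 x) * (t * \<delta> t x)\<bar> / \<bar>t\<bar> \<le> L * (t * \<delta> t x)\<^sup>2 / \<bar>t\<bar>"
        unfolding d by (intro divide_right_mono) auto
      moreover have "L * (t * \<delta> t x)\<^sup>2 / \<bar>t\<bar> = L * (\<bar>t\<bar> * (\<delta> t x * \<delta> t x))"
        using t(1) by (simp add: power2_eq_square field_simps)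
      moreover have "(f (U t x) - f (U 0 x)) / t - deriv f (U 0 x) * \<delta> t x = (f (U t x) - f (U 0 x) - deriv f (U 0 x) * (t * \<delta> t x)) / t"
        using t(1) by (simp add: diff_divide_distrib)
      ultimately show "norm ((f (U t x) - f (U 0 x)) / t - deriv f (U 0 x) * \<delta> t x) \<le> L * (\<bar>t\<bar> * (\<delta> t x * \<delta> t x))"
        by (simp add: abs_divide)
    qed
    from uniform_limit_null_comparison[OF this] lz
    have "uniform_limit K (\<lambda>t x. (f (U t x) - f (U 0 x)) / t - deriv f (U 0 x) * \<delta> t x) (\<lambda>x. 0) (at 0)" by simp
    from uniform_limit_add[OF this lf]
    have "uniform_limit K (\<lambda>t x. (f (U t x) - f (U 0 x)) / t) (\<lambda>x. deriv f (U 0 x) * \<phi> x) (at 0)" by simp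
    then have "uniform_limit K \<delta>'' (\<lambda>x. h1 + c0 * \<phi> x - h3 * (U 0 x + 0 * \<phi> x) - deriv f (U 0 x) * \<phi> x) (at 0)"
      unfolding \<delta>''_def[abs_def]
      by (intro uniform_limit_add uniform_limit_minus uniform_lim_mult uniform_limit_const l\<delta> lt\<delta> bs)
         (auto intro!: b continuous_intros U0_continuous)
    then show ?thesis by (simp add: r_def[abs_def])
  qed
  obtain d where d: "d > 0" "\<And>t. t \<noteq> 0 \<Longrightarrow> dist t 0 < d \<Longrightarrow> (\<forall>x. (U t has_real_derivative U' t x) (at x)) \<and>
      (\<forall>x. (U' t has_real_derivative a0 + t * h1 + (c0 - t * h3) * U t x - f (U t x)) (at x)) \<and> U' t 0 = 0"
    using family_at unfolding eventually_at by auto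
  \<comment> \<open>A null sequence inside the punctured neighbourhood; \<open>n + 2\<close> keeps
    \<open>t n\<close> strictly below \<open>d\<close> already at \<open>n = 0\<close>.\<close>
  define t where "t n = d / real (n + 2)" for n
  have t: "t n \<noteq> 0" "dist (t n) 0 < d" for n using d(1) by (auto simp: t_def field_simps intro!: add_pos_nonneg)
  have "(\<lambda>n. d * inverse (real (n + 2))) \<longlonglongrightarrow> d * 0"
    by (rule tendsto_mult[OF tendsto_const LIMSEQ_ignore_initial_segment[OF lim_inverse_n]])
  moreover have "(\<lambda>n. d * inverse (real (n + 2))) = t" by (simp only: t_def[abs_def] divide_inverse)
  ultimately have "t \<longlonglongrightarrow> 0" by simp
  then have tl: "filterlim t (at 0) sequentially"
    by (simp add: filterlim_at t(1))
  have d1: "(\<delta> (t n) has_real_derivative \<delta>' (t n) x) (at x)" for n x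
    unfolding \<delta>_def \<delta>'_def using d(2)[OF t[of n]] family_at_0(1)[of x]
    by (intro DERIV_cdivide DERIV_diff) auto
  have d2: "(\<delta>' (t n) has_real_derivative \<delta>'' (t n) x) (at x)" for n x
  proof -
    have "(\<delta>' (t n) has_real_derivative ((a0 + t n * h1 + (c0 - t n * h3) * U (t n) x - f (U (t n) x)) - (a0 + c0 * U 0 x - f (U 0 x))) / t n) (at x)"
      unfolding \<delta>'_def using d(2)[OF t[of n]] family_at_0(2)[of x]
      by (intro DERIV_cdivide DERIV_diff) auto
    moreover have "((a0 + t n * h1 + (c0 - t n * h3) * U (t n) x - f (U (t n) x)) - (a0 + c0 * U 0 x - f (U 0 x))) / t n = \<delta>'' (t n) x"
      using t(1)[of n] by (simp add: \<delta>''_def \<delta>_def field_simps)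
    ultimately show ?thesis by simp
  qed
  have z: "\<delta>' (t n) 0 = 0" for n using d(2)[OF t[of n]] family_at_0(3) by (simp add: \<delta>'_def)
  obtain \<psi> where \<psi>: "\<And>x. (\<psi> has_real_derivative r x) (at x)"
    "\<And>K. compact K \<Longrightarrow> uniform_limit K (\<lambda>n. \<delta>' (t n)) \<psi> sequentially"
  proof (rule derivative_of_uniform_limit[OF d2])
    show "uniform_limit K (\<lambda>n. \<delta>'' (t n)) r sequentially" if "compact K" for K
      using filterlim_compose[OF limr[OF that] tl] .
    show "(\<lambda>n. \<delta>' (t n) 0) \<longlonglongrightarrow> 0" by (simp add: z)
  qed blast
  have p: "(\<lambda>n. \<delta> (t n) x) \<longlonglongrightarrow> \<phi> x" for x
    using filterlim_compose[OF pointwise[of x] tl] by (simp add: \<delta>_def)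
  obtain \<phi>0 where \<phi>0: "\<And>x. (\<phi>0 has_real_derivative \<psi> x) (at x)"
    "\<And>K. compact K \<Longrightarrow> uniform_limit K (\<lambda>n. \<delta> (t n)) \<phi>0 sequentially"
    using derivative_of_uniform_limit[OF d1 \<psi>(2) p] by blast
  have "\<phi>0 = \<phi>"
  proof
    fix x
    have "(\<lambda>n. \<delta> (t n) x) \<longlonglongrightarrow> \<phi>0 x" using tendsto_uniform_limitI[OF \<phi>0(2)[of "{x}"]] by simp
    then show "\<phi>0 x = \<phi> x" using p LIMSEQ_unique by blast
  qed
  moreover have "\<psi> 0 = 0"
  proof -
    have "(\<lambda>n. \<delta>' (t n) 0) \<longlonglongrightarrow> \<psi> 0" using tendsto_uniform_limitI[OF \<psi>(2)[of "{0}"]] by simp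
    then show ?thesis unfolding z using LIMSEQ_unique tendsto_const by blast
  qed
  ultimately show ?thesis using \<phi>0(1) \<psi>(1) by (intro that[of \<psi>]) (auto simp: r_def)
qed

end

section \<open>Expansion of the monodromy matrix\<close>

lemma has_vector_derivative_of_real_complex:
  "(g has_real_derivative d) (at x) \<Longrightarrow> ((\<lambda>x. complex_of_real (g x)) has_vector_derivative of_real d) (at x)"
  using bounded_linear.has_vector_derivative[OF bounded_linear_of_real]
  by (simp add: has_real_derivative_iff_has_vector_derivative)

text \<open>The parameters \<open>\<phi> j\<close> are the derivatives of the wave with respect to \<open>a\<close>, \<open>E\<close>, \<open>s\<close>, for which
  \<open>\<L> \<phi>\<close> equals \<open>- 1\<close>, \<open>0\<close>, \<open>u\<close>; together with \<open>u'\<close> they give, to leading order in \<open>\<mu>\<close>, a basis of the solutions.\<close>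

locale modulation = hill +
  fixes u u1 u2 :: "real \<Rightarrow> real" and \<phi> \<phi>1 :: "3 \<Rightarrow> real \<Rightarrow> real" and um \<kappa> :: real and Tp Mp Pp :: "real^3"
  assumes u: "(u has_real_derivative u1 x) (at x)" "(u1 has_real_derivative u2 x) (at x)"
      "(u2 has_real_derivative q x * u1 x) (at x)"
    and u_init: "u 0 = um" "u1 0 = 0" "u2 0 = \<kappa>" "u T = um" "u1 T = 0" "u2 T = \<kappa>" and \<kappa>: "\<kappa> \<noteq> 0"
    and \<phi>: "(\<phi> j has_real_derivative \<phi>1 j x) (at x)"
      "(\<phi>1 j has_real_derivative q x * \<phi> j x - (if j = 1 then - 1 else if j = 3 then u x else 0)) (at x)"
    and \<phi>_init: "\<phi>1 j 0 = 0" "\<kappa> * \<phi> j 0 = - (if j = 1 then um else if j = 2 then 1 else - um\<^sup>2 / 2)"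
    and \<phi>_jump: "\<phi> j T = \<phi> j 0" "\<phi>1 j T = - Tp $ j * \<kappa>"
    and mass: "Mp $ j = integral {0..T} (\<phi> j) + um * Tp $ j"
    and momentum: "Pp $ j = integral {0..T} (\<lambda>x. 2 * u x * \<phi> j x) + um\<^sup>2 * Tp $ j"
begin

text \<open>The variation violates the third equation of the system by \<mu> times this vector, up
  to sign. The remainder \<open>R\<close> below compensates it.\<close>

definition force :: "3 \<Rightarrow> real \<Rightarrow> complex^3" where
  "force j x = vector [0, 0, of_real (\<phi> j x)]"

lemma phi_continuous: "continuous_on S (\<phi> j)"
  using \<phi>(1) by (meson DERIV_isCont continuous_at_imp_continuous_on)

lemma force_continuous: "continuous_on UNIV (force j)"
  unfolding force_def by (intro continuous_on_vector_3 continuous_intros phi_continuous)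

definition R :: "complex \<Rightarrow> 3 \<Rightarrow> real \<Rightarrow> complex^3" where
  "R \<mu> j = (SOME Y. Y 0 = 0 \<and> solves \<mu> (force j) Y)"

lemma R: "R \<mu> j 0 = 0" "solves \<mu> (force j) (R \<mu> j)"
proof -
  have "\<exists>Y. Y 0 = 0 \<and> solves \<mu> (force j) Y"
    using solves_exists[OF force_continuous] by metis
  from someI_ex[OF this] show "R \<mu> j 0 = 0" "solves \<mu> (force j) (R \<mu> j)" unfolding R_def by auto
qed

lemma R_deriv: "((\<lambda>x. R \<mu> j x $ i) has_vector_derivative (coef \<mu> x (R \<mu> j x) + force j x) $ i) (at x)"
  using R(2) unfolding solves_def has_vector_derivative_componentwise by simp

text \<open>Inverse of the matrix of initial values of the solutions \<open>wave_solution \<mu> j\<close> below.\<close>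

definition coord :: "complex \<Rightarrow> complex^3 \<Rightarrow> complex^3" where
  "coord \<mu> y = (let x3 = \<mu> * y $ 2 / \<kappa>; x1 = - (y $ 3) + um * x3
     in vector [x1, - \<kappa> * y $ 1 - um * x1 + um\<^sup>2 / 2 * x3, x3])"

text \<open>Up to the factor \<open>\<mu> / \<kappa>\<close>, the coordinates of the second unit
  vector, which is the direction of the jump of the variations over one period.\<close>

definition shift :: "complex^3" where
  "shift = vector [of_real um, - (of_real um)\<^sup>2 / 2, 1]"

text \<open>Column \<open>j\<close> holds the coordinates of the increment of
  \<open>wave_solution \<mu> j\<close> over one period, divided by \<mu>. Expressed through
  \<open>coord\<close> and \<open>R\<close>, which have no pole, it makes sense at
  \<open>\<mu> = 0\<close> as well.\<close>

definition W :: "complex \<Rightarrow> complex^3^3" where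
  "W \<mu> = (\<chi> i j. coord \<mu> (R \<mu> j T) $ i - Tp $ j * shift $ i)"

definition lphi :: "3 \<Rightarrow> real \<Rightarrow> real" where
  "lphi j x = (if j = 1 then - 1 else if j = 3 then u x else 0)"

text \<open>For \<open>j = 3\<close> the third component \<open>u\<close> has the derivative
  \<open>u1\<close>, which the system must produce as \<mu> times the first component. The multiple
  \<open>1 / \<mu>\<close> of the translation mode supplies it and brings that mode into the
  basis.\<close>

definition wave_solution :: "complex \<Rightarrow> 3 \<Rightarrow> real \<Rightarrow> complex^3" where
  "wave_solution \<mu> j x = vector [of_real (\<phi> j x), of_real (\<phi>1 j x), of_real (lphi j x)]
     + (if j = 3 then 1 / \<mu> else 0) *s vector [of_real (u1 x), of_real (u2 x), 0] + \<mu> *s R \<mu> j x"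

lemma wave_solution_solves:
  assumes "\<mu> \<noteq> 0"
  shows "solves \<mu> (\<lambda>x. 0) (wave_solution \<mu> j)"
proof -
  define b where "b = (if j = 3 then 1 / \<mu> else 0)"
  note d = has_vector_derivative_of_real_complex
  have m: "((\<lambda>x. c * g x) has_vector_derivative c * g') (at x)" if "(g has_vector_derivative g') (at x)" for c g' x and g :: "real \<Rightarrow> complex"
    using bounded_linear.has_vector_derivative[OF bounded_linear_mult_right that] .
  have l: "(lphi j has_real_derivative (if j = 3 then u1 x else 0)) (at x)" for x
    unfolding lphi_def[abs_def] using u(1) by (cases "j = 3"; cases "j = 1"; simp add: DERIV_const)
  have dR: "((\<lambda>x. R \<mu> j x $ i) has_vector_derivative (coef \<mu> x (R \<mu> j x) + force j x) $ i) (at x)" for i x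
    by (rule R_deriv)
  have c1: "((\<lambda>x. of_real (\<phi> j x) + b * of_real (u1 x) + \<mu> * R \<mu> j x $ 1) has_vector_derivative
     of_real (\<phi>1 j x) + b * of_real (u2 x) + \<mu> * (coef \<mu> x (R \<mu> j x) + force j x) $ 1) (at x)" for x
    by (intro has_vector_derivative_add m dR d \<phi> u)
  have c2: "((\<lambda>x. of_real (\<phi>1 j x) + b * of_real (u2 x) + \<mu> * R \<mu> j x $ 2) has_vector_derivative
     of_real (q x * \<phi> j x - lphi j x) + b * of_real (q x * u1 x) + \<mu> * (coef \<mu> x (R \<mu> j x) + force j x) $ 2) (at x)" for x
    unfolding lphi_def by (intro has_vector_derivative_add m dR d \<phi> u)
  have c3: "((\<lambda>x. of_real (lphi j x) + b * 0 + \<mu> * R \<mu> j x $ 3) has_vector_derivative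
     of_real (if j = 3 then u1 x else 0) + b * 0 + \<mu> * (coef \<mu> x (R \<mu> j x) + force j x) $ 3) (at x)" for x
    by (intro has_vector_derivative_add m dR d l has_vector_derivative_const)
  show ?thesis
    unfolding solves_def has_vector_derivative_componentwise forall_3
  proof (intro allI conjI)
    fix x
    show "((\<lambda>x. wave_solution \<mu> j x $ 1) has_vector_derivative (coef \<mu> x (wave_solution \<mu> j x) + 0) $ 1) (at x)"
      using c1[of x] by (simp add: wave_solution_def b_def[symmetric] coef_def force_def)
    show "((\<lambda>x. wave_solution \<mu> j x $ 2) has_vector_derivative (coef \<mu> x (wave_solution \<mu> j x) + 0) $ 2) (at x)"
      using c2[of x] by (simp add: wave_solution_def b_def[symmetric] coef_def force_def algebra_simps)
    have "b * \<mu> = (if j = 3 then 1 else 0)" using assms by (simp add: b_def)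
    then have "of_real (if j = 3 then u1 x else 0) = \<mu> * (b * of_real (u1 x))"
      by (cases "j = 3") (auto simp: mult.commute mult.left_commute)
    then show "((\<lambda>x. wave_solution \<mu> j x $ 3) has_vector_derivative (coef \<mu> x (wave_solution \<mu> j x) + 0) $ 3) (at x)"
      using c3[of x] by (simp add: wave_solution_def b_def[symmetric] coef_def force_def algebra_simps)
  qed
qed

lemma wave_solution_init:
  fixes \<mu> :: complex
  shows "wave_solution \<mu> j 0 = vector [of_real (\<phi> j 0), if j = 3 then \<kappa> / \<mu> else 0, of_real (lphi j 0)]"
  by (simp add: vec_eq_iff forall_3 wave_solution_def R u_init \<phi>_init)

lemma wave_solution_period:
  "wave_solution \<mu> j T = wave_solution \<mu> j 0 + of_real (- Tp $ j * \<kappa>) *s axis 2 1 + \<mu> *s R \<mu> j T"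
  by (simp add: vec_eq_iff forall_3 wave_solution_def R u_init \<phi>_init \<phi>_jump lphi_def axis_def)

lemma coord_add: "coord \<mu> (y + z) = coord \<mu> y + coord \<mu> z"
  and coord_smult: "coord \<mu> (c *s y) = c *s coord \<mu> y"
  by (simp_all add: coord_def Let_def vec_eq_iff forall_3 field_simps add_divide_distrib)

lemma phi_0: "complex_of_real (\<phi> j 0) = - of_real (if j = 1 then um else if j = 2 then 1 else - um\<^sup>2 / 2) / \<kappa>"
proof -
  have "\<phi> j 0 = - (if j = 1 then um else if j = 2 then 1 else - um\<^sup>2 / 2) / \<kappa>"
    using \<phi>_init(2)[of j] \<kappa> by (simp add: field_simps split: if_splits)
  then show ?thesis by (simp split: if_splits)
qed

lemma wave_solution_combination:
  assumes "\<mu> \<noteq> 0"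
  shows "(\<Sum>j\<in>UNIV. coord \<mu> y $ j *s wave_solution \<mu> j 0) = y"
proof -
  have i: "wave_solution \<mu> j 0 $ 1 = - of_real (if j = 1 then um else if j = 2 then 1 else - um\<^sup>2 / 2) / \<kappa>"
    "wave_solution \<mu> j 0 $ 2 = (if j = 3 then of_real \<kappa> / \<mu> else 0)"
    "wave_solution \<mu> j 0 $ 3 = of_real (if j = 1 then - 1 else if j = 3 then um else 0)" for j
    unfolding wave_solution_init by (simp_all add: phi_0 lphi_def u_init)
  show ?thesis
    using assms \<kappa>
    by (simp add: vec_eq_iff forall_3 sum_3 i coord_def Let_def field_simps power2_eq_square)
qed

text \<open>In the coordinates \<open>coord \<mu>\<close> the increment over one period acts as
  \<open>\<mu> * W \<mu>\<close>, so the multiplier \<open>l\<close> corresponds to the eigenvalue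
  \<open>(l - 1) / \<mu>\<close>.\<close>

theorem multiplier_imp_eigenvalue:
  assumes \<mu>: "\<mu> \<noteq> 0" and y: "y \<noteq> 0" "monodromy \<mu> *v y = l *s y"
  shows "det (W \<mu> - mat ((l - 1) / \<mu>)) = 0"
proof -
  define x where "x = coord \<mu> y"
  define S where "S t = (\<Sum>j\<in>UNIV. x $ j *s wave_solution \<mu> j t)" for t
  have S: "solves \<mu> (\<lambda>t. 0) S"
    using solves_add[OF solves_add[OF solves_smult[OF wave_solution_solves[OF \<mu>], of "x $ 1" 1]
        solves_smult[OF wave_solution_solves[OF \<mu>], of "x $ 2" 2]] solves_smult[OF wave_solution_solves[OF \<mu>], of "x $ 3" 3]]
    by (simp add: S_def[abs_def] sum_3)
  have S0: "S 0 = y" unfolding S_def x_def by (rule wave_solution_combination[OF \<mu>])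
  have ST: "S T = l *s y" using flow_eqI[OF S] y(2) by (simp add: S0 monodromy_flow)
  have "S T = S 0 + (\<Sum>j\<in>UNIV. x $ j *s (of_real (- Tp $ j * \<kappa>) *s axis 2 1 + \<mu> *s R \<mu> j T))"
    by (simp add: S_def wave_solution_period sum_3 vec_eq_iff algebra_simps)
  then have "(l - 1) *s y = (\<Sum>j\<in>UNIV. x $ j *s (of_real (- Tp $ j * \<kappa>) *s axis 2 1 + \<mu> *s R \<mu> j T))"
    by (simp add: ST S0 vec_eq_iff algebra_simps)
  then have "coord \<mu> ((l - 1) *s y) = coord \<mu> (\<Sum>j\<in>UNIV. x $ j *s (of_real (- Tp $ j * \<kappa>) *s axis 2 1 + \<mu> *s R \<mu> j T))"
    by simp
  then have "(l - 1) *s x = (\<Sum>j\<in>UNIV. x $ j *s (of_real (- Tp $ j * \<kappa>) *s coord \<mu> (axis 2 1) + \<mu> *s coord \<mu> (R \<mu> j T)))"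
    by (simp only: sum_3 coord_add coord_smult x_def)
  also have "coord \<mu> (axis 2 1) = (\<mu> / \<kappa>) *s shift"
    by (simp add: coord_def shift_def Let_def vec_eq_iff forall_3 axis_def field_simps power2_eq_square)
  also have "(\<Sum>j\<in>UNIV. x $ j *s (of_real (- Tp $ j * \<kappa>) *s ((\<mu> / \<kappa>) *s shift) + \<mu> *s coord \<mu> (R \<mu> j T))) = \<mu> *s (W \<mu> *v x)"
    using \<kappa> by (simp add: vec_eq_iff W_def matrix_vector_mult_def sum_3 algebra_simps)
  finally have "(W \<mu> - mat ((l - 1) / \<mu>)) *v x = 0"
    using \<mu> by (simp add: diff_mat_mult_vec vec_eq_iff field_simps)
  moreover have "x \<noteq> 0"
  proof
    assume "x = 0"
    then have "S 0 = 0" by (simp add: S_def)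
    then show False using S0 y by simp
  qed
  ultimately show ?thesis
    by (metis invertible_def invertible_det_nz matrix_left_invertible_ker matrix_left_right_inverse)
qed

section \<open>Leading order and Lipschitz dependence of the scaled matrix\<close>

text \<open>At \<open>\<mu> = 0\<close> the third component of the remainder is a plain integral of
  the variation, which yields the mass. The momentum comes from pairing the remainder with the
  profile.\<close>

lemma R_at_0:
  shows "R 0 j T $ 3 = of_real (Mp $ j - um * Tp $ j)"
    and "um * R 0 j T $ 3 - \<kappa> * R 0 j T $ 1 = of_real ((Pp $ j - um\<^sup>2 * Tp $ j) / 2)"
proof -
  note d = has_vector_derivative_of_real_complex
  have ftc: "g T - g 0 = of_real (integral {0..T} h)"
    if "\<And>x. (g has_vector_derivative complex_of_real (h x)) (at x)" "continuous_on UNIV h" for g h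
  proof -
    have "((\<lambda>x. complex_of_real (h x)) has_integral (g T - g 0)) {0..T}"
      using T_pos that(1) by (intro fundamental_theorem_of_calculus) (auto intro: has_vector_derivative_at_within)
    moreover have "(h has_integral integral {0..T} h) {0..T}"
      by (intro integrable_integral integrable_continuous_real continuous_on_subset[OF that(2)]) simp
    from has_integral_linear[OF this bounded_linear_of_real]
    have "((\<lambda>x. complex_of_real (h x)) has_integral of_real (integral {0..T} h)) {0..T}" by (simp add: o_def)
    ultimately show ?thesis by (rule has_integral_unique)
  qed
  have "((\<lambda>x. R 0 j x $ 3) has_vector_derivative complex_of_real (\<phi> j x)) (at x)" for x
    using R_deriv[of 0 j 3 x] by (simp add: coef_def force_def)
  from ftc[OF this phi_continuous] show "R 0 j T $ 3 = of_real (Mp $ j - um * Tp $ j)"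
    by (simp add: R mass)
  have uc: "continuous_on UNIV u" using u(1) by (meson DERIV_isCont continuous_at_imp_continuous_on)
  \<comment> \<open>Because \<open>u1\<close> solves the linearized equation with zero right-hand
    side, everything in the derivative of this pairing cancels except
    \<open>u x * \<phi> j x\<close>.\<close>
  have "((\<lambda>x. of_real (u x) * R 0 j x $ 3 + of_real (u1 x) * R 0 j x $ 2 - of_real (u2 x) * R 0 j x $ 1)
    has_vector_derivative complex_of_real (u x * \<phi> j x)) (at x)" for x
    by (rule derivative_eq_intros R_deriv d u refl)+ (simp add: coef_def force_def algebra_simps)
  from ftc[OF this] have "um * R 0 j T $ 3 - \<kappa> * R 0 j T $ 1 = of_real (integral {0..T} (\<lambda>x. u x * \<phi> j x))"
    using uc phi_continuous by (simp add: R u_init continuous_on_mult)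
  also have "integral {0..T} (\<lambda>x. u x * \<phi> j x) = (Pp $ j - um\<^sup>2 * Tp $ j) / 2"
    using integral_mult_right[of "{0..T}" 2 "\<lambda>x. u x * \<phi> j x"] by (simp add: momentum mult.assoc)
  finally show "um * R 0 j T $ 3 - \<kappa> * R 0 j T $ 1 = of_real ((Pp $ j - um\<^sup>2 * Tp $ j) / 2)" .
qed

text \<open>The boundary terms caused by the moving period cancel: those with
  \<open>um * Tp $ j\<close> and \<open>um\<^sup>2 * Tp $ j\<close> in mass and momentum are matched
  by the first two entries of \<open>shift\<close>.\<close>

theorem W_0:
  "W 0 = complex_matrix (\<chi> i j. if i = 1 then - Mp $ j else if i = 2 then Pp $ j / 2 else - Tp $ j)"
proof -
  have "W 0 $ 1 $ j = - of_real (Mp $ j)" for j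
    by (simp add: W_def shift_def coord_def Let_def R_at_0)
  moreover have "W 0 $ 2 $ j = of_real (Pp $ j / 2)" for j
  proof -
    have "W 0 $ 2 $ j = (um * R 0 j T $ 3 - \<kappa> * R 0 j T $ 1) + of_real (Tp $ j * um\<^sup>2 / 2)"
      by (simp add: W_def shift_def coord_def Let_def)
    then show ?thesis by (simp add: R_at_0(2) field_simps)
  qed
  moreover have "W 0 $ 3 $ j = - of_real (Tp $ j)" for j
    by (simp add: W_def shift_def coord_def Let_def)
  ultimately show ?thesis
    by (simp add: vec_eq_iff forall_3 complex_matrix_def)
qed

text \<open>Two remainders differ by a solution with zero initial value and forcing
  \<open>(\<mu> - \<nu>) * R \<nu> j t $ 1\<close> in the third component. Gronwall is used twice:
  to bound \<open>R\<close> uniformly for \<open>cmod \<nu> \<le> 1\<close>, and then for the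
  difference.\<close>

lemma R_lipschitz:
  obtains L where "\<And>\<mu> \<nu> i. cmod \<mu> \<le> 1 \<Longrightarrow> cmod \<nu> \<le> 1 \<Longrightarrow> cmod (R \<mu> j T $ i - R \<nu> j T $ i) \<le> L * cmod (\<mu> - \<nu>)"
proof -
  define K where "K = q_bound + 3"
  have K: "0 \<le> K" using q_bound(1) by (simp add: K_def)
  have Kc: "norm (coef \<mu> x y) \<le> K * norm y" if "cmod \<mu> \<le> 1" for \<mu> x y
  proof (rule order_trans[OF coef_norm])
    show "coef_bound \<mu> * norm y \<le> K * norm y"
      using that by (intro mult_right_mono) (auto simp: coef_bound_def K_def)
  qed
  define X where "X = exp ((2 * K + 1) * T)"
  have "compact (\<phi> j ` {0..T})" by (intro compact_continuous_image phi_continuous compact_Icc)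
  then obtain \<Phi> where \<Phi>: "\<And>x. x \<in> {0..T} \<Longrightarrow> \<bar>\<phi> j x\<bar> \<le> \<Phi>"
    by (metis bounded_iff compact_imp_bounded imageI real_norm_def)
  have nf: "norm (force j x) = \<bar>\<phi> j x\<bar>" for x
    by (simp add: force_def norm_vec_def L2_set_def sum_3)
  define B where "B = sqrt (X * (\<Phi>\<^sup>2 * T))"
  have X: "0 \<le> X" by (simp add: X_def)
  have Xx: "exp ((2 * K + 1) * (x - 0)) * (0 + C\<^sup>2 * (x - 0)) \<le> X * (C\<^sup>2 * T)" if "x \<in> {0..T}" for x C
    using that K unfolding X_def by (intro mult_mono) (auto intro: mult_left_mono)
  have RB: "norm (R \<nu> j x) \<le> B" if \<nu>: "cmod \<nu> \<le> 1" and x: "x \<in> {0..T}" for \<nu> x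
  proof -
    have "(norm (R \<nu> j x))\<^sup>2 \<le> exp ((2 * K + 1) * (x - 0)) * ((norm (R \<nu> j 0))\<^sup>2 + \<Phi>\<^sup>2 * (x - 0))"
    proof (rule gronwall[OF _ K])
      show "(R \<nu> j has_vector_derivative coef \<nu> t (R \<nu> j t) + force j t) (at t)" for t
        using R(2) by (simp add: solves_def)
      show "norm (coef \<nu> t (R \<nu> j t) + force j t) \<le> K * norm (R \<nu> j t) + \<Phi>" if "0 \<le> t" "t \<le> x" for t
        using norm_triangle_ineq[of "coef \<nu> t (R \<nu> j t)" "force j t"] Kc[OF \<nu>, of t "R \<nu> j t"] \<Phi>[of t] that x
        by (simp add: nf)
    qed (use x in auto)
    also have "\<dots> \<le> X * (\<Phi>\<^sup>2 * T)" using Xx[OF x, of \<Phi>] by (simp add: R)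
    finally show ?thesis unfolding B_def by (rule real_le_rsqrt)
  qed
  show ?thesis
  proof (rule that[of "sqrt (X * (B\<^sup>2 * T))"])
    fix \<mu> \<nu> :: complex and i assume \<mu>\<nu>: "cmod \<mu> \<le> 1" "cmod \<nu> \<le> 1"
    let ?D = "\<lambda>x. R \<mu> j x - R \<nu> j x"
    have dR: "(R \<mu> j has_vector_derivative coef \<mu> t (R \<mu> j t) + force j t) (at t)" for \<mu> t
      using R(2) by (simp add: solves_def)
    have "(norm (?D T))\<^sup>2 \<le> exp ((2 * K + 1) * (T - 0)) * ((norm (?D 0))\<^sup>2 + (cmod (\<mu> - \<nu>) * B)\<^sup>2 * (T - 0))"
    proof (rule gronwall[OF _ K has_vector_derivative_diff[OF dR dR]])
      fix t assume t: "0 \<le> t" "t \<le> T"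
      let ?v = "((\<mu> - \<nu>) * R \<nu> j t $ 1) *s (axis 3 1 :: complex^3)"
      have eq: "coef \<mu> t (R \<mu> j t) + force j t - (coef \<nu> t (R \<nu> j t) + force j t) = coef \<mu> t (?D t) + ?v"
        by (simp add: coef_def vec_eq_iff forall_3 axis_def algebra_simps)
      have "cmod (R \<nu> j t $ 1) \<le> B"
        by (rule order_trans[OF Finite_Cartesian_Product.norm_nth_le RB[OF \<mu>\<nu>(2)]]) (use t in simp)
      then have "norm ?v \<le> cmod (\<mu> - \<nu>) * B"
        by (simp only: norm_smult_axis norm_mult mult_left_mono norm_ge_zero)
      then show "norm (coef \<mu> t (R \<mu> j t) + force j t - (coef \<nu> t (R \<nu> j t) + force j t)) \<le> K * norm (?D t) + cmod (\<mu> - \<nu>) * B"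
        unfolding eq by (intro order_trans[OF norm_triangle_ineq] add_mono Kc[OF \<mu>\<nu>(1)])
    qed (use T_pos in auto)
    also have "\<dots> \<le> X * ((cmod (\<mu> - \<nu>) * B)\<^sup>2 * T)" using Xx[of T "cmod (\<mu> - \<nu>) * B"] T_pos by (simp add: R)
    finally have "norm (?D T) \<le> sqrt (X * ((cmod (\<mu> - \<nu>) * B)\<^sup>2 * T))" by (rule real_le_rsqrt)
    also have "X * ((cmod (\<mu> - \<nu>) * B)\<^sup>2 * T) = X * (B\<^sup>2 * T) * (cmod (\<mu> - \<nu>))\<^sup>2"
      by (simp add: power_mult_distrib)
    finally have "norm (?D T) \<le> sqrt (X * (B\<^sup>2 * T)) * cmod (\<mu> - \<nu>)"
      by (simp add: real_sqrt_mult)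
    then show "cmod (R \<mu> j T $ i - R \<nu> j T $ i) \<le> sqrt (X * (B\<^sup>2 * T)) * cmod (\<mu> - \<nu>)"
      using order_trans[OF Finite_Cartesian_Product.norm_nth_le[of "?D T" i]] by simp
  qed
qed

end

section \<open>Reflected roots of a family of cubics\<close>

text \<open>Lipschitz continuity on the closed unit disc. Boundedness there makes the class closed
  under products, hence under the coefficients of a characteristic polynomial.\<close>

definition lip :: "(complex \<Rightarrow> complex) \<Rightarrow> bool" where
  "lip g \<longleftrightarrow> (\<exists>L. \<forall>\<mu> \<nu>. cmod \<mu> \<le> 1 \<longrightarrow> cmod \<nu> \<le> 1 \<longrightarrow> cmod (g \<mu> - g \<nu>) \<le> L * cmod (\<mu> - \<nu>))"

lemma lip_bounded:
  assumes "lip g"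
  obtains B where "0 \<le> B" "\<And>\<mu>. cmod \<mu> \<le> 1 \<Longrightarrow> cmod (g \<mu>) \<le> B"
proof -
  obtain L where L: "\<And>\<mu> \<nu>. cmod \<mu> \<le> 1 \<Longrightarrow> cmod \<nu> \<le> 1 \<Longrightarrow> cmod (g \<mu> - g \<nu>) \<le> L * cmod (\<mu> - \<nu>)"
    using assms unfolding lip_def by blast
  show ?thesis
  proof (rule that[of "cmod (g 0) + \<bar>L\<bar>"])
    fix \<mu> assume "cmod \<mu> \<le> 1"
    then have "cmod (g \<mu> - g 0) \<le> L * cmod \<mu>" using L[of \<mu> 0] by simp
    also have "\<dots> \<le> \<bar>L\<bar> * 1" using \<open>cmod \<mu> \<le> 1\<close> by (intro mult_mono) auto
    finally show "cmod (g \<mu>) \<le> cmod (g 0) + \<bar>L\<bar>"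
      using norm_triangle_ineq2[of "g \<mu>" "g 0"] by simp
  qed simp
qed

lemma lip_const: "lip (\<lambda>_. c)" unfolding lip_def by (rule exI[of _ 0]) simp

lemma lip_ident: "lip (\<lambda>\<mu>. \<mu>)" unfolding lip_def by (rule exI[of _ 1]) simp

lemma lip_add: "lip g \<Longrightarrow> lip h \<Longrightarrow> lip (\<lambda>\<mu>. g \<mu> + h \<mu>)"
proof -
  assume "lip g" "lip h"
  then obtain L K where *: "\<And>\<mu> \<nu>. cmod \<mu> \<le> 1 \<Longrightarrow> cmod \<nu> \<le> 1 \<Longrightarrow> cmod (g \<mu> - g \<nu>) \<le> L * cmod (\<mu> - \<nu>)"
    "\<And>\<mu> \<nu>. cmod \<mu> \<le> 1 \<Longrightarrow> cmod \<nu> \<le> 1 \<Longrightarrow> cmod (h \<mu> - h \<nu>) \<le> K * cmod (\<mu> - \<nu>)"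
    unfolding lip_def by blast
  have "cmod (g \<mu> + h \<mu> - (g \<nu> + h \<nu>)) \<le> (L + K) * cmod (\<mu> - \<nu>)" if "cmod \<mu> \<le> 1" "cmod \<nu> \<le> 1" for \<mu> \<nu>
  proof -
    have "g \<mu> + h \<mu> - (g \<nu> + h \<nu>) = (g \<mu> - g \<nu>) + (h \<mu> - h \<nu>)" by simp
    then show ?thesis using *[OF that] norm_triangle_ineq[of "g \<mu> - g \<nu>" "h \<mu> - h \<nu>"]
      by (simp only: distrib_right)
  qed
  then show ?thesis unfolding lip_def by blast
qed

lemma lip_mult: "lip g \<Longrightarrow> lip h \<Longrightarrow> lip (\<lambda>\<mu>. g \<mu> * h \<mu>)"
proof -
  assume gh: "lip g" "lip h"
  then obtain L K where *: "\<And>\<mu> \<nu>. cmod \<mu> \<le> 1 \<Longrightarrow> cmod \<nu> \<le> 1 \<Longrightarrow> cmod (g \<mu> - g \<nu>) \<le> L * cmod (\<mu> - \<nu>)"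
    "\<And>\<mu> \<nu>. cmod \<mu> \<le> 1 \<Longrightarrow> cmod \<nu> \<le> 1 \<Longrightarrow> cmod (h \<mu> - h \<nu>) \<le> K * cmod (\<mu> - \<nu>)"
    unfolding lip_def by blast
  obtain A where A: "0 \<le> A" "\<And>\<mu>. cmod \<mu> \<le> 1 \<Longrightarrow> cmod (g \<mu>) \<le> A" using lip_bounded[OF gh(1)] by blast
  obtain B where B: "0 \<le> B" "\<And>\<mu>. cmod \<mu> \<le> 1 \<Longrightarrow> cmod (h \<mu>) \<le> B" using lip_bounded[OF gh(2)] by blast
  have "cmod (g \<mu> * h \<mu> - g \<nu> * h \<nu>) \<le> (A * K + L * B) * cmod (\<mu> - \<nu>)" if "cmod \<mu> \<le> 1" "cmod \<nu> \<le> 1" for \<mu> \<nu>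
  proof -
    have "g \<mu> * h \<mu> - g \<nu> * h \<nu> = g \<mu> * (h \<mu> - h \<nu>) + (g \<mu> - g \<nu>) * h \<nu>" by (simp add: algebra_simps)
    also have "cmod \<dots> \<le> cmod (g \<mu>) * cmod (h \<mu> - h \<nu>) + cmod (g \<mu> - g \<nu>) * cmod (h \<nu>)"
      by (metis norm_mult norm_triangle_ineq)
    also have "\<dots> \<le> A * (K * cmod (\<mu> - \<nu>)) + (L * cmod (\<mu> - \<nu>)) * B"
      using *[OF that] A(2)[OF that(1)] B(2)[OF that(2)] A(1) B(1)
      by (intro add_mono mult_mono) (auto intro: order_trans[OF norm_ge_zero])
    finally show ?thesis by (simp add: algebra_simps)
  qed
  then show ?thesis unfolding lip_def by blast
qed

lemma lip_minus: "lip g \<Longrightarrow> lip (\<lambda>\<mu>. - g \<mu>)"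
  using lip_mult[OF lip_const[of "-1"], of g] by simp

lemma lip_diff: "lip g \<Longrightarrow> lip h \<Longrightarrow> lip (\<lambda>\<mu>. g \<mu> - h \<mu>)"
  using lip_add[OF _ lip_minus, of g h] by simp

lemma lip_tendsto:
  assumes "lip g" "m \<longlonglongrightarrow> 0" "\<And>n. cmod (m n) \<le> 1"
  shows "(\<lambda>n. g (m n)) \<longlonglongrightarrow> g 0"
proof -
  obtain L where L: "\<And>\<mu> \<nu>. cmod \<mu> \<le> 1 \<Longrightarrow> cmod \<nu> \<le> 1 \<Longrightarrow> cmod (g \<mu> - g \<nu>) \<le> L * cmod (\<mu> - \<nu>)"
    using assms(1) unfolding lip_def by blast
  have "(\<lambda>n. L * cmod (m n)) \<longlonglongrightarrow> L * cmod 0" by (intro tendsto_intros assms(2))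
  then have "(\<lambda>n. L * cmod (m n)) \<longlonglongrightarrow> 0" by simp
  then have "(\<lambda>n. g (m n) - g 0) \<longlonglongrightarrow> 0"
    by (rule Lim_null_comparison[rotated]) (use L[OF assms(3), of 0] in \<open>auto intro: always_eventually\<close>)
  then show ?thesis by (rule LIM_zero_cancel)
qed

text \<open>For \<open>cmod w > 1\<close> all lower terms are bounded by multiples of
  \<open>(cmod w)\<^sup>2\<close>. The bound keeps the scaled multipliers in a compact set.\<close>

lemma cubic_root_bound:
  fixes w t e d :: complex
  assumes "w^3 - t * w\<^sup>2 + e * w - d = 0"
  shows "cmod w \<le> 1 + cmod t + cmod e + cmod d"
proof (cases "cmod w \<le> 1")
  case True
  then show ?thesis by (smt (verit) norm_ge_zero)
next
  case False
  let ?r = "cmod w"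
  have "w^3 = t * w\<^sup>2 - e * w + d" using assms by (simp add: algebra_simps)
  then have "?r^3 = cmod (t * w\<^sup>2 - e * w + d)" by (metis norm_power)
  also have "\<dots> \<le> cmod t * ?r\<^sup>2 + cmod e * ?r + cmod d"
    using norm_triangle_ineq[of "t * w\<^sup>2 - e * w" d] norm_triangle_ineq4[of "t * w\<^sup>2" "e * w"]
    by (simp add: norm_mult norm_power)
  also have "\<dots> \<le> cmod t * ?r\<^sup>2 + cmod e * ?r\<^sup>2 + cmod d * ?r\<^sup>2"
    using False by (intro add_mono mult_left_mono) (auto simp: power2_eq_square mult_le_cancel_left1 intro: order_trans[OF _ mult_mono[of 1 ?r 1 ?r]])
  finally have "?r * ?r\<^sup>2 \<le> (cmod t + cmod e + cmod d) * ?r\<^sup>2"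
    by (simp add: power3_eq_cube power2_eq_square algebra_simps)
  then have "?r \<le> cmod t + cmod e + cmod d"
    using False by (subst (asm) mult_le_cancel_right) auto
  then show ?thesis by simp
qed

text \<open>If a multiplier \<open>l\<close> on the unit circle belongs to \<open>\<mu>\<close>, it also belongs to the reflection \<open>- cnj \<mu>\<close>. As both
  scaled multipliers tend to the same simple eigenvalue, the Lipschitz dependence on \<open>\<mu>\<close> forces \<open>\<mu> = - cnj \<mu>\<close>.\<close>

lemma cubic_reflected_roots:
  fixes t e d :: "complex \<Rightarrow> complex"
  assumes lips: "lip t" "lip e" "lip d"
    and roots: "\<And>z. z^3 - t 0 * z\<^sup>2 + e 0 * z - d 0 = 0 \<Longrightarrow> z \<in> \<real> \<and> z \<noteq> 0 \<and> 3 * z\<^sup>2 - 2 * t 0 * z + e 0 \<noteq> 0"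
  obtains r where "0 < r" "\<And>\<mu> l. cmod \<mu> < r \<Longrightarrow> Re \<mu> \<noteq> 0 \<Longrightarrow> cmod l = 1
    \<Longrightarrow> ((l - 1) / \<mu>)^3 - t \<mu> * ((l - 1) / \<mu>)\<^sup>2 + e \<mu> * ((l - 1) / \<mu>) - d \<mu> = 0
    \<Longrightarrow> ((l - 1) / (- cnj \<mu>))^3 - t (- cnj \<mu>) * ((l - 1) / (- cnj \<mu>))\<^sup>2 + e (- cnj \<mu>) * ((l - 1) / (- cnj \<mu>)) - d (- cnj \<mu>) = 0
    \<Longrightarrow> False"
proof -
  let ?p = "\<lambda>\<mu> w. w^3 - t \<mu> * w\<^sup>2 + e \<mu> * w - d \<mu>"
  have "\<exists>r>0. \<forall>\<mu> l. cmod \<mu> < r \<and> Re \<mu> \<noteq> 0 \<and> cmod l = 1 \<and> ?p \<mu> ((l - 1) / \<mu>) = 0 \<and> ?p (- cnj \<mu>) ((l - 1) / (- cnj \<mu>)) = 0 \<longrightarrow> False"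
  proof (rule ccontr)
    assume "\<not> ?thesis"
    then have "\<forall>n. \<exists>\<mu> l. cmod \<mu> < 1 / real (Suc n) \<and> Re \<mu> \<noteq> 0 \<and> cmod l = 1 \<and> ?p \<mu> ((l - 1) / \<mu>) = 0 \<and> ?p (- cnj \<mu>) ((l - 1) / (- cnj \<mu>)) = 0"
      by (metis of_nat_0_less_iff zero_less_Suc zero_less_divide_1_iff)
    then obtain m l where ml: "\<And>n. cmod (m n) < 1 / real (Suc n)" "\<And>n. Re (m n) \<noteq> 0" "\<And>n. cmod (l n) = 1"
        "\<And>n. ?p (m n) ((l n - 1) / m n) = 0" "\<And>n. ?p (- cnj (m n)) ((l n - 1) / (- cnj (m n))) = 0"
      by metis
    define w where "w n = (l n - 1) / m n" for n
    define w' where "w' n = (l n - 1) / (- cnj (m n))" for n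
    have m1: "cmod (m n) \<le> 1" for n
      using ml(1)[of n] by (smt (verit, best) divide_le_eq_1_pos of_nat_0_less_iff of_nat_1 of_nat_le_iff Suc_leI zero_less_Suc One_nat_def)
    have m0: "m n \<noteq> 0" for n using ml(2)[of n] by auto
    have mlim: "m \<longlonglongrightarrow> 0"
      by (rule Lim_null_comparison[OF _ LIMSEQ_inverse_real_of_nat])
        (use ml(1) in \<open>auto intro!: always_eventually simp: inverse_eq_divide less_imp_le\<close>)
    obtain Bt where Bt: "\<And>\<mu>. cmod \<mu> \<le> 1 \<Longrightarrow> cmod (t \<mu>) \<le> Bt" using lip_bounded[OF lips(1)] by blast
    obtain Be where Be: "\<And>\<mu>. cmod \<mu> \<le> 1 \<Longrightarrow> cmod (e \<mu>) \<le> Be" using lip_bounded[OF lips(2)] by blast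
    obtain Bd where Bd: "\<And>\<mu>. cmod \<mu> \<le> 1 \<Longrightarrow> cmod (d \<mu>) \<le> Bd" using lip_bounded[OF lips(3)] by blast
    have wb: "cmod (w n) \<le> 1 + Bt + Be + Bd" for n
      using cubic_root_bound[OF ml(4)[of n]] Bt[OF m1[of n]] Be[OF m1[of n]] Bd[OF m1[of n]] unfolding w_def by linarith
    then have "bounded (range w)" by (auto simp: bounded_iff)
    then obtain ws s where s: "strict_mono (s :: nat \<Rightarrow> nat)" and ws: "(w \<circ> s) \<longlonglongrightarrow> ws"
      using bounded_imp_convergent_subsequence by blast
    have ml_s: "(\<lambda>n. m (s n)) \<longlonglongrightarrow> 0" using LIMSEQ_subseq_LIMSEQ[OF mlim s] by (simp add: o_def)
    have mc_s: "(\<lambda>n. - cnj (m (s n))) \<longlonglongrightarrow> 0" using tendsto_minus[OF tendsto_cnj[OF ml_s]] by simp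
    have wl: "(\<lambda>n. w (s n)) \<longlonglongrightarrow> ws" using ws by (simp add: o_def)
    have l_eq: "l n = 1 + m n * w n" for n using m0[of n] by (simp add: w_def)
    have "(\<lambda>n. 1 + m (s n) * w (s n)) \<longlonglongrightarrow> 1 + 0 * ws" by (intro tendsto_intros ml_s wl)
    then have ll: "(\<lambda>n. l (s n)) \<longlonglongrightarrow> 1" by (simp add: l_eq[symmetric])
    \<comment> \<open>On the unit circle \<open>cnj l\<close> is the inverse of \<open>l\<close>,
      which relates the two scaled multipliers by conjugation. Hence \<open>w'\<close> tends to
      \<open>cnj ws\<close>, and this is \<open>ws\<close> because the limiting root is
      real.\<close>
    have w'_eq: "w' n = l n * cnj (w n)" for n
    proof -
      have "l n * cnj (l n) = 1" using ml(3)[of n] complex_norm_square[of "l n"] by simp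
      then have "l n * (cnj (l n) - 1) = 1 - l n" by (simp add: algebra_simps)
      then show ?thesis using m0[of n] by (simp add: w_def w'_def field_simps)
    qed
    have "(\<lambda>n. l (s n) * cnj (w (s n))) \<longlonglongrightarrow> 1 * cnj ws" by (intro tendsto_intros ll wl)
    then have w'l: "(\<lambda>n. w' (s n)) \<longlonglongrightarrow> cnj ws" by (simp add: w'_eq)
    note tl = lip_tendsto[OF lips(1) ml_s m1] and el = lip_tendsto[OF lips(2) ml_s m1] and dl = lip_tendsto[OF lips(3) ml_s m1]
    have "(\<lambda>n. ?p (m (s n)) (w (s n))) \<longlonglongrightarrow> ?p 0 ws" by (intro tendsto_intros tl el dl wl)
    moreover have "?p (m (s n)) (w (s n)) = 0" for n using ml(4) by (simp add: w_def)
    ultimately have "?p 0 ws = 0" by (simp add: LIMSEQ_const_iff)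
    from roots[OF this] have ws0: "cnj ws = ws" "ws \<noteq> 0" "3 * ws\<^sup>2 - 2 * t 0 * ws + e 0 \<noteq> 0"
      by (auto simp: Reals_cnj_iff)
    \<comment> \<open>Divided difference of the cubic for \<open>m n\<close> between
      \<open>w n\<close> and \<open>w' n\<close>. Its limit is the derivative at \<open>ws\<close>,
      nonzero at a simple root.\<close>
    define Q where "Q n = (w n)\<^sup>2 + w n * w' n + (w' n)\<^sup>2 - t (m n) * (w n + w' n) + e (m n)" for n
    have Ql: "(\<lambda>n. Q (s n)) \<longlonglongrightarrow> ws\<^sup>2 + ws * ws + ws\<^sup>2 - t 0 * (ws + ws) + e 0"
      unfolding Q_def by (intro tendsto_intros tl el wl w'l[unfolded ws0(1)])
    obtain Lt where Lt: "\<And>\<mu> \<nu>. cmod \<mu> \<le> 1 \<Longrightarrow> cmod \<nu> \<le> 1 \<Longrightarrow> cmod (t \<mu> - t \<nu>) \<le> Lt * cmod (\<mu> - \<nu>)"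
      using lips(1) unfolding lip_def by blast
    obtain Le where Le: "\<And>\<mu> \<nu>. cmod \<mu> \<le> 1 \<Longrightarrow> cmod \<nu> \<le> 1 \<Longrightarrow> cmod (e \<mu> - e \<nu>) \<le> Le * cmod (\<mu> - \<nu>)"
      using lips(2) unfolding lip_def by blast
    obtain Ld where Ld: "\<And>\<mu> \<nu>. cmod \<mu> \<le> 1 \<Longrightarrow> cmod \<nu> \<le> 1 \<Longrightarrow> cmod (d \<mu> - d \<nu>) \<le> Ld * cmod (\<mu> - \<nu>)"
      using lips(3) unfolding lip_def by blast
    define C where "C n = Lt * (cmod (w' n))\<^sup>2 + Le * cmod (w' n) + Ld" for n
    have key: "cmod (w n) * cmod (Q n) \<le> C n * cmod (m n)" for n
    proof -
      let ?m = "m n" and ?m' = "- cnj (m n)"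
      have ne: "?m - ?m' \<noteq> 0" using ml(2)[of n] by (simp add: complex_eq_iff)
      have m': "cmod ?m' = cmod ?m" by simp
      have p: "?p ?m (w n) = 0" "?p ?m' (w' n) = 0" using ml(4,5)[of n] by (simp_all add: w_def w'_def)
      have "(w n - w' n) * Q n = ?p ?m (w n) - ?p ?m (w' n)"
        by (simp add: Q_def power3_eq_cube power2_eq_square algebra_simps)
      also have "\<dots> = ?p ?m' (w' n) - ?p ?m (w' n)" using p by simp
      also have "\<dots> = (t ?m - t ?m') * (w' n)\<^sup>2 - (e ?m - e ?m') * w' n + (d ?m - d ?m')"
        by (simp add: algebra_simps)
      finally have "cmod (w n - w' n) * cmod (Q n) = cmod ((t ?m - t ?m') * (w' n)\<^sup>2 - (e ?m - e ?m') * w' n + (d ?m - d ?m'))"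
        by (metis norm_mult)
      also have "\<dots> \<le> cmod (t ?m - t ?m') * (cmod (w' n))\<^sup>2 + cmod (e ?m - e ?m') * cmod (w' n) + cmod (d ?m - d ?m')"
        using norm_triangle_ineq[of "(t ?m - t ?m') * (w' n)\<^sup>2 - (e ?m - e ?m') * w' n" "d ?m - d ?m'"]
          norm_triangle_ineq4[of "(t ?m - t ?m') * (w' n)\<^sup>2" "(e ?m - e ?m') * w' n"]
        by (simp add: norm_mult norm_power)
      also have "\<dots> \<le> (Lt * cmod (?m - ?m')) * (cmod (w' n))\<^sup>2 + (Le * cmod (?m - ?m')) * cmod (w' n) + Ld * cmod (?m - ?m')"
        using m1[of n] by (intro add_mono mult_right_mono Lt Le Ld) auto
      also have "\<dots> = C n * cmod (?m - ?m')" by (simp add: C_def algebra_simps)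
      finally have 1: "cmod (w n - w' n) * cmod (Q n) \<le> C n * cmod (?m - ?m')" .
      \<comment> \<open>Both scaled multipliers come from the same \<open>l n - 1\<close>, so
        \<open>w n * ?m = w' n * ?m'\<close>. This makes \<open>w n - w' n\<close> larger than the
        Lipschitz bound allows by a factor of order \<open>1 / cmod ?m\<close>. The common factor
        \<open>cmod (?m - ?m')\<close> is nonzero off the imaginary axis and cancels.\<close>
      have "(w n - w' n) * ?m' = - (w n * (?m - ?m'))"
        using m0[of n] by (simp add: w_def w'_def field_simps)
      then have 2: "cmod (w n - w' n) * cmod ?m = cmod (w n) * cmod (?m - ?m')"
        by (metis m' norm_minus_cancel norm_mult)
      have "cmod (?m - ?m') * (cmod (w n) * cmod (Q n)) = (cmod (w n - w' n) * cmod (Q n)) * cmod ?m"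
        using 2 by (simp add: algebra_simps)
      also have "\<dots> \<le> (C n * cmod (?m - ?m')) * cmod ?m" using 1 by (intro mult_right_mono) auto
      finally have "cmod (?m - ?m') * (cmod (w n) * cmod (Q n)) \<le> cmod (?m - ?m') * (C n * cmod ?m)"
        by (simp add: algebra_simps)
      then show ?thesis by (rule mult_left_le_imp_le) (simp only: zero_less_norm_iff ne not_False_eq_True)
    qed
    have "(\<lambda>n. cmod (w (s n)) * cmod (Q (s n))) \<longlonglongrightarrow> cmod ws * cmod (ws\<^sup>2 + ws * ws + ws\<^sup>2 - t 0 * (ws + ws) + e 0)"
      by (intro tendsto_intros wl Ql)
    moreover have "(\<lambda>n. C (s n) * cmod (m (s n))) \<longlonglongrightarrow> (Lt * (cmod (cnj ws))\<^sup>2 + Le * cmod (cnj ws) + Ld) * cmod 0"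
      unfolding C_def by (intro tendsto_intros w'l ml_s)
    ultimately have "cmod ws * cmod (ws\<^sup>2 + ws * ws + ws\<^sup>2 - t 0 * (ws + ws) + e 0) \<le> (Lt * (cmod (cnj ws))\<^sup>2 + Le * cmod (cnj ws) + Ld) * cmod 0"
      by (rule LIMSEQ_le) (use key in blast)
    then have "cmod (ws\<^sup>2 + ws * ws + ws\<^sup>2 - t 0 * (ws + ws) + e 0) \<le> 0"
      using ws0(2) by (simp add: mult_le_0_iff)
    then have "ws\<^sup>2 + ws * ws + ws\<^sup>2 - t 0 * (ws + ws) + e 0 = 0" by simp
    moreover have "ws\<^sup>2 + ws * ws + ws\<^sup>2 - t 0 * (ws + ws) + e 0 = 3 * ws\<^sup>2 - 2 * t 0 * ws + e 0"
      by (simp add: power2_eq_square algebra_simps)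
    ultimately show False using ws0(3) by simp
  qed
  then show ?thesis using that by blast
qed

section \<open>The Whitham matrix\<close>

text \<open>Restriction of the differential to a line; passing from the norm of the increment to the
  signed \<open>t\<close> costs the factor \<open>norm h\<close>.\<close>

lemma lu_differential_directional:
  assumes lu: "has_lu_differential U D q0" and h: "h \<noteq> 0" and K: "compact K"
  shows "uniform_limit K (\<lambda>t x. (U (q0 + t *\<^sub>R h) x - U q0 x) / t) (D h) (at 0)"
proof (rule uniform_limitI)
  fix e :: real assume "e > 0"
  have lin: "bounded_linear (\<lambda>h. D h x)" for x using lu by (simp add: has_lu_differential_def)
  have "((\<lambda>t. q0 + t *\<^sub>R h) \<longlongrightarrow> q0 + 0 *\<^sub>R h) (at 0)" by (intro tendsto_intros)
  then have fl: "filterlim (\<lambda>t. q0 + t *\<^sub>R h) (at q0) (at 0)"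
    using h by (auto simp: filterlim_at eventually_at_filter)
  have "uniform_limit K (\<lambda>q x. (U q x - U q0 x - D (q - q0) x) / norm (q - q0)) (\<lambda>_. 0) (at q0)"
    using lu K by (simp add: has_lu_differential_def)
  from uniform_limitD[OF filterlim_compose[OF this fl], of "e / norm h"]
  have "\<forall>\<^sub>F t in at 0. \<forall>x\<in>K. dist ((U (q0 + t *\<^sub>R h) x - U q0 x - D (t *\<^sub>R h) x) / norm (t *\<^sub>R h)) 0 < e / norm h"
    using \<open>e > 0\<close> h by simp
  moreover have "\<forall>\<^sub>F t in at 0. t \<noteq> (0::real)" by (simp add: eventually_at_filter)
  ultimately show "\<forall>\<^sub>F t in at 0. \<forall>x\<in>K. dist ((U (q0 + t *\<^sub>R h) x - U q0 x) / t) (D h x) < e"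
  proof (eventually_elim, intro ballI)
    fix t x assume *: "\<forall>x\<in>K. dist ((U (q0 + t *\<^sub>R h) x - U q0 x - D (t *\<^sub>R h) x) / norm (t *\<^sub>R h)) 0 < e / norm h"
      and t: "t \<noteq> 0" and x: "x \<in> K"
    have D: "D (t *\<^sub>R h) x = t * D h x" using linear_scale[OF bounded_linear.linear[OF lin]] by simp
    have "\<bar>U (q0 + t *\<^sub>R h) x - U q0 x - t * D h x\<bar> / (\<bar>t\<bar> * norm h) < e / norm h"
      using bspec[OF * x] by (simp add: D dist_real_def abs_mult)
    then have "\<bar>U (q0 + t *\<^sub>R h) x - U q0 x - t * D h x\<bar> / \<bar>t\<bar> < e"
      using h t by (simp add: field_simps)
    moreover have "(U (q0 + t *\<^sub>R h) x - U q0 x) / t - D h x = (U (q0 + t *\<^sub>R h) x - U q0 x - t * D h x) / t"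
      using t by (simp add: diff_divide_distrib)
    ultimately show "dist ((U (q0 + t *\<^sub>R h) x - U q0 x) / t) (D h x) < e"
      by (simp add: dist_real_def abs_divide)
  qed
qed

lemma has_derivative_vec3:
  fixes g :: "'a::real_normed_vector \<Rightarrow> real^3"
  assumes "\<And>i. ((\<lambda>x. g x $ i) has_derivative (\<lambda>h. g' h $ i)) (at x)"
  shows "(g has_derivative g') (at x)"
  using assms by (subst has_derivative_componentwise_within) (auto simp: Basis_vec_def inner_axis)

lemma jacobian_nth:
  fixes g :: "real^'n \<Rightarrow> real^'m"
  assumes "(g has_derivative g') (at x)"
  shows "jacobian g (at x) $ i $ j = g' (axis j 1) $ i"
  using frechet_derivative_at[OF assms] by (simp add: jacobian_def matrix_def)

lemma aEc_nth: "aEc c0 q $ 1 = q $ 1" "aEc c0 q $ 2 = q $ 2" "aEc c0 q $ 3 = c0 - q $ 3"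
  by (simp_all add: aEc_def)

lemma aEc_has_derivative: "(aEc c0 has_derivative (\<lambda>h. vector [h $ 1, h $ 2, - h $ 3])) (at q)"
proof (rule has_derivative_vec3)
  fix i :: 3
  have n: "((\<lambda>q. q $ k) has_derivative (\<lambda>h. h $ k)) (at q)" for k :: 3 and q :: "real^3"
    by (rule bounded_linear_imp_has_derivative[OF bounded_linear_vec_nth])
  then show "((\<lambda>q. aEc c0 q $ i) has_derivative (\<lambda>h. vector [h $ 1, h $ 2, - h $ 3] $ i)) (at q)"
    using exhaust_3[of i] has_derivative_diff[OF has_derivative_const[of c0] n[of 3 q]] n
    by (auto simp: aEc_nth)
qed

section \<open>Characteristic polynomials of 3 by 3 matrices\<close>

definition tr3 :: "'a::comm_ring_1^3^3 \<Rightarrow> 'a" where "tr3 M = M$1$1 + M$2$2 + M$3$3"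

text \<open>Sum of the principal 2 by 2 minors, the linear coefficient of the characteristic
  polynomial.\<close>

definition minors3 :: "'a::comm_ring_1^3^3 \<Rightarrow> 'a" where
  "minors3 M = M$1$1 * M$2$2 - M$1$2 * M$2$1 + M$1$1 * M$3$3 - M$1$3 * M$3$1 + M$2$2 * M$3$3 - M$2$3 * M$3$2"

lemma det_diff_mat_3: "det (M - mat l) = - (l^3 - tr3 M * l\<^sup>2 + minors3 M * l - det (M :: complex^3^3))"
  unfolding tr3_def minors3_def det_3 by (simp add: mat_def power3_eq_cube power2_eq_square algebra_simps)

lemma characteristic_poly_3:
  "characteristic_poly (M :: complex^3^3) = [:- det M, minors3 M, - tr3 M, 1:]"
  unfolding characteristic_poly_def tr3_def minors3_def det_3
  by (simp add: algebra_simps)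

text \<open>The expression is the derivative of the characteristic polynomial at \<open>y\<close>,
  and differentiation lowers the order of a root by one.\<close>

lemma simple_eigenvalue_cubic:
  fixes A :: "complex^3^3"
  assumes "order y (characteristic_poly A) = 1"
  shows "3 * y\<^sup>2 - 2 * tr3 A * y + minors3 A \<noteq> 0"
proof -
  let ?p = "characteristic_poly A"
  have d: "pderiv ?p = [:minors3 A, - 2 * tr3 A, 3:]"
    by (simp add: characteristic_poly_3 pderiv_pCons)
  then have p: "?p \<noteq> 0" "pderiv ?p \<noteq> 0" by auto
  moreover have "poly ?p y = 0" using assms p(1) by (simp add: order_root)
  ultimately have "order y (pderiv ?p) = 0" using order_pderiv[of ?p y] assms by simp
  with p(2) have "poly (pderiv ?p) y \<noteq> 0" by (simp add: order_root)
  then show ?thesis by (simp add: d power2_eq_square algebra_simps)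
qed

text \<open>A nonzero real factor scales the eigenvalues and keeps them real and simple. That 0 is
  not among them comes from the determinant.\<close>

lemma scaled_simple_eigenvalues:
  fixes A :: "real^3^3" and W :: "complex^3^3"
  assumes A: "only_simple_real_eigenvalues A" and c: "c \<noteq> 0"
    and W: "\<And>i j. W $ i $ j = of_real c * of_real (A $ i $ j)" and det: "det W \<noteq> 0"
    and z: "z^3 - tr3 W * z\<^sup>2 + minors3 W * z - det W = 0"
  shows "z \<in> \<real>" "z \<noteq> 0" "3 * z\<^sup>2 - 2 * tr3 W * z + minors3 W \<noteq> 0"
proof -
  let ?A = "complex_matrix A"
  show "z \<noteq> 0" using z det by auto
  have "det (W - mat z) = 0" using z by (simp add: det_diff_mat_3)
  then obtain v where v: "v \<noteq> 0" "(W - mat z) *v v = 0" by (rule det_zero_imp_kernel)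
  define y where "y = z / of_real c"
  have zy: "z = of_real c * y" using c by (simp add: y_def)
  have "W *v v = of_real c *s (?A *v v)"
    by (simp add: vec_eq_iff matrix_vector_mult_def complex_matrix_def W sum_3 algebra_simps)
  then have "of_real c *s (?A *v v) = of_real c *s (y *s v)"
    using v(2) by (simp add: diff_mat_mult_vec zy vec_eq_iff)
  then have "?A *v v = y *s v" using c by (simp add: vec_eq_iff)
  then have "matrix_eigenvalue ?A y" using v(1) unfolding matrix_eigenvalue_def by blast
  then have y: "y \<in> \<real>" "order y (characteristic_poly ?A) = 1"
    using A unfolding only_simple_real_eigenvalues_def by auto
  show "z \<in> \<real>" using y(1) by (simp add: zy)
  have tr: "tr3 W = of_real c * tr3 ?A" "minors3 W = (of_real c)\<^sup>2 * minors3 ?A"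
    by (simp_all add: tr3_def minors3_def W complex_matrix_def power2_eq_square algebra_simps)
  have "3 * z\<^sup>2 - 2 * tr3 W * z + minors3 W = (of_real c)\<^sup>2 * (3 * y\<^sup>2 - 2 * tr3 ?A * y + minors3 ?A)"
    by (simp add: zy tr power2_eq_square algebra_simps)
  then show "3 * z\<^sup>2 - 2 * tr3 W * z + minors3 W \<noteq> 0"
    using simple_eigenvalue_cubic[OF y(2)] c by simp
qed

lemma matrix_inv_left: "invertible A \<Longrightarrow> matrix_inv A ** A = mat 1"
  unfolding invertible_def matrix_inv_def by (rule someI2_ex) auto

lemma directional_derivative:
  fixes g :: "'a::real_normed_vector \<Rightarrow> real"
  assumes "(g has_derivative g') (at x)"
  shows "((\<lambda>t. g (x + t *\<^sub>R h)) has_real_derivative g' h) (at 0)"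
proof -
  have "((\<lambda>t. x + t *\<^sub>R h) has_derivative (\<lambda>t. t *\<^sub>R h)) (at 0)"
    by (auto intro!: derivative_eq_intros)
  from diff_chain_at[OF this, of g g'] assms
  have "((\<lambda>t. g (x + t *\<^sub>R h)) has_derivative (\<lambda>t. g' (t *\<^sub>R h))) (at 0)"
    by (simp add: o_def)
  moreover have "(\<lambda>t. g' (t *\<^sub>R h)) = (\<lambda>t. g' h * t)"
    using has_derivative_linear[OF assms] by (simp add: linear_scale mult.commute fun_eq_iff)
  ultimately show ?thesis by (simp add: has_field_derivative_def)
qed

text \<open>At \<open>s = 0\<close> the density Jacobian factors through the flux Jacobian.\<close>

lemma whitham_matrix_eq:
  fixes F um up u c0 q0
  defines "Tq \<equiv> \<lambda>q. wave_period F um up (aEc c0 q)" and "Mq \<equiv> \<lambda>q. wave_mass F um up u (aEc c0 q)"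
    and "Pq \<equiv> \<lambda>q. wave_momentum F um up u (aEc c0 q)"
  assumes T: "(Tq has_derivative Td) (at q0)" and M: "(Mq has_derivative Md) (at q0)"
    and P: "(Pq has_derivative Pd) (at q0)" and s: "q0 $ 3 = 0" and pos: "0 < Tq q0"
  shows "whitham_matrix F um up u c0 q0 = (\<chi> i j. (if i = 1 then Md (axis j 1) else if i = 2 then - Pd (axis j 1) / 2 else Td (axis j 1)) / Tq q0)"
proof -
  let ?T = "Tq q0" and ?M = "Mq q0" and ?P = "Pq q0"
  have n: "((\<lambda>q. q $ k) has_derivative (\<lambda>h. h $ k)) (at q)" for k :: 3 and q :: "real^3"
    by (rule bounded_linear_imp_has_derivative[OF bounded_linear_vec_nth])
  have w: "((\<lambda>q. 1 / Tq q) has_derivative (\<lambda>h. - Td h / ?T\<^sup>2)) (at q0)"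
    using pos by (auto intro!: derivative_eq_intros T simp: power2_eq_square field_simps)
  have mw: "((\<lambda>q. Mq q * (1 / Tq q)) has_derivative (\<lambda>h. ?M * (- Td h / ?T\<^sup>2) + Md h * (1 / ?T))) (at q0)"
    by (rule has_derivative_mult[OF M w])
  have pw: "((\<lambda>q. Pq q * (1 / Tq q)) has_derivative (\<lambda>h. ?P * (- Td h / ?T\<^sup>2) + Pd h * (1 / ?T))) (at q0)"
    by (rule has_derivative_mult[OF P w])
  define d' :: "real^3 \<Rightarrow> real^3" where "d' h = vector [?M * (- Td h / ?T\<^sup>2) + Md h * (1 / ?T), ?P * (- Td h / ?T\<^sup>2) + Pd h * (1 / ?T), - Td h / ?T\<^sup>2]" for h
  \<comment> \<open>At \<open>s = 0\<close> the product rule leaves only the terms in which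
    \<open>s\<close> itself is differentiated, so the flux Jacobian contains no derivative of mass,
    momentum or frequency.\<close>
  define f' :: "real^3 \<Rightarrow> real^3" where "f' h = vector [h $ 1 - h $ 3 * (?M * (1 / ?T)), - (h $ 3 * (?P * (1 / ?T))) - 2 * h $ 2, - (h $ 3 * (1 / ?T))]" for h
  have dens: "(whitham_density F um up u c0 has_derivative d') (at q0)"
  proof (rule has_derivative_vec3)
    fix i :: 3
    show "((\<lambda>q. whitham_density F um up u c0 q $ i) has_derivative (\<lambda>h. d' h $ i)) (at q0)"
      using exhaust_3[of i] mw pw w
      by (auto simp: whitham_density_def Let_def wave_frequency_def Tq_def Mq_def Pq_def d'_def)
  qed
  have flux: "(whitham_flux F um up u c0 has_derivative f') (at q0)"
  proof (rule has_derivative_vec3)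
    fix i :: 3
    have 1: "((\<lambda>q. q $ 1 - q $ 3 * (Mq q * (1 / Tq q))) has_derivative (\<lambda>h. f' h $ 1)) (at q0)"
      by (rule has_derivative_eq_rhs, rule has_derivative_diff[OF n has_derivative_mult[OF n mw]])
        (simp add: f'_def s fun_eq_iff)
    have 2: "((\<lambda>q. - (q $ 3 * (Pq q * (1 / Tq q))) - 2 * q $ 2) has_derivative (\<lambda>h. f' h $ 2)) (at q0)"
      by (rule has_derivative_eq_rhs, rule has_derivative_diff[OF has_derivative_minus[OF has_derivative_mult[OF n pw]] has_derivative_mult_right[OF n]])
        (simp add: f'_def s fun_eq_iff)
    have 3: "((\<lambda>q. - (q $ 3 * (1 / Tq q))) has_derivative (\<lambda>h. f' h $ 3)) (at q0)"
      by (rule has_derivative_eq_rhs, rule has_derivative_minus[OF has_derivative_mult[OF n w]])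
        (simp add: f'_def s fun_eq_iff)
    show "((\<lambda>q. whitham_flux F um up u c0 q $ i) has_derivative (\<lambda>h. f' h $ i)) (at q0)"
      using exhaust_3[of i] 1 2 3
      by (auto simp: whitham_flux_def Let_def wave_frequency_def Tq_def Mq_def Pq_def mult.assoc)
  qed
  \<comment> \<open>Found by solving the factorization row by row: the last row of the flux Jacobian
    gives the row of \<open>Td\<close>, and substituting it in the other two leaves
    \<open>Md\<close> and \<open>Pd\<close> alone.\<close>
  define A :: "real^3^3" where "A = (\<chi> i j. (if i = 1 then Md (axis j 1) else if i = 2 then - Pd (axis j 1) / 2 else Td (axis j 1)) / ?T)"
  let ?J = "jacobian (whitham_flux F um up u c0) (at q0)"
  have "det ?J \<noteq> 0"
    unfolding det_3 jacobian_nth[OF flux] using pos by (simp add: f'_def axis_def)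
  then have "invertible ?J" by (simp add: invertible_det_nz)
  moreover have "jacobian (whitham_density F um up u c0) (at q0) = ?J ** A"
    using pos by (simp add: vec_eq_iff forall_3 matrix_matrix_mult_def sum_3 jacobian_nth[OF flux] jacobian_nth[OF dens]
        f'_def d'_def A_def axis_def field_simps power2_eq_square)
  ultimately have "whitham_matrix F um up u c0 q0 = A"
    unfolding whitham_matrix_def by (simp add: matrix_mul_assoc matrix_inv_left)
  then show ?thesis by (simp add: A_def)
qed

section \<open>Absence of unimodular multipliers off the imaginary axis\<close>

context modulation
begin

text \<open>The coordinates are polynomial in \<mu> and in the remainders, so the pole of the basis
  at \<open>\<mu> = 0\<close> does not show.\<close>

lemma lip_W: "lip (\<lambda>\<mu>. W \<mu> $ i $ j)"
proof -
  have R: "lip (\<lambda>\<mu>. R \<mu> j T $ k)" for k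
    unfolding lip_def using R_lipschitz[of j] by metis
  define g3 where "g3 \<mu> = \<mu> * R \<mu> j T $ 2 / of_real \<kappa>" for \<mu>
  define g1 where "g1 \<mu> = - (R \<mu> j T $ 3) + of_real um * g3 \<mu>" for \<mu>
  define g2 where "g2 \<mu> = - (of_real \<kappa> * R \<mu> j T $ 1) - of_real um * g1 \<mu> + (of_real um)\<^sup>2 / 2 * g3 \<mu>" for \<mu>
  have g3: "lip g3" unfolding g3_def[abs_def] divide_inverse by (rule lip_mult[OF lip_mult[OF lip_ident R] lip_const])
  have g1: "lip g1" unfolding g1_def[abs_def] by (rule lip_add[OF lip_minus[OF R] lip_mult[OF lip_const g3]])
  have g2: "lip g2" unfolding g2_def[abs_def]
    by (rule lip_add[OF lip_diff[OF lip_minus[OF lip_mult[OF lip_const R]] lip_mult[OF lip_const g1]] lip_mult[OF lip_const g3]])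
  have "(\<lambda>\<mu>. coord \<mu> (R \<mu> j T) $ 1) = g1" "(\<lambda>\<mu>. coord \<mu> (R \<mu> j T) $ 2) = g2" "(\<lambda>\<mu>. coord \<mu> (R \<mu> j T) $ 3) = g3"
    by (simp_all add: fun_eq_iff coord_def Let_def g1_def g2_def g3_def)
  then have "lip (\<lambda>\<mu>. coord \<mu> (R \<mu> j T) $ 1)" "lip (\<lambda>\<mu>. coord \<mu> (R \<mu> j T) $ 2)" "lip (\<lambda>\<mu>. coord \<mu> (R \<mu> j T) $ 3)"
    using g1 g2 g3 by (simp_all only:)
  then have "lip (\<lambda>\<mu>. coord \<mu> (R \<mu> j T) $ i)"
    using exhaust_3[of i] by auto
  from lip_diff[OF this lip_const[of "of_real (Tp $ j) * shift $ i"]] show ?thesis by (simp add: W_def)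
qed

text \<open>A unimodular multiplier at \<mu> recurs at \<open>- cnj \<mu>\<close>, and each
  occurrence gives a root of the characteristic cubic of \<open>W\<close>. Near 0 and off the
  imaginary axis such a pair is excluded.\<close>

theorem no_unimodular_multiplier:
  fixes A :: "real^3^3"
  defines "J \<equiv> (\<chi> i j. if i = 1 then Tp $ j else if i = 2 then Mp $ j else Pp $ j) :: real^3^3"
  assumes A: "only_simple_real_eigenvalues A" and det: "det J \<noteq> 0"
    and A_eq: "A = (\<chi> i j. (if i = 1 then Mp $ j else if i = 2 then - Pp $ j / 2 else Tp $ j) / T)"
  obtains r where "0 < r" "\<And>\<mu> l y. cmod \<mu> < r \<Longrightarrow> Re \<mu> \<noteq> 0 \<Longrightarrow> cmod l = 1 \<Longrightarrow> monodromy \<mu> *v y = l *s y \<Longrightarrow> y = 0"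
proof -
  have lips: "lip (\<lambda>\<mu>. tr3 (W \<mu>))" "lip (\<lambda>\<mu>. minors3 (W \<mu>))" "lip (\<lambda>\<mu>. det (W \<mu>))"
    unfolding tr3_def minors3_def det_3 by (intro lip_add lip_mult lip_diff lip_W)+
  have W0: "W 0 $ i $ j = of_real (- T) * of_real (A $ i $ j)" for i j
    using T_pos exhaust_3[of i] by (auto simp: W_0 A_eq complex_matrix_def)
  \<comment> \<open>Two sign changes, the factor 1/2 in the momentum row and a cyclic permutation of
    the rows relate this determinant to that of \<open>J\<close>.\<close>
  have dW: "det (W 0) = of_real (det J / 2)"
    unfolding W_0 det_3 J_def by (simp add: complex_matrix_def field_simps)
  have det0: "det (W 0) \<noteq> 0" unfolding dW of_real_eq_0_iff using det by simp
  have "- T \<noteq> 0" using T_pos by simp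
  note roots = scaled_simple_eigenvalues[OF A this W0 det0]
  show ?thesis
  proof (rule cubic_reflected_roots[OF lips])
    fix z assume "z^3 - tr3 (W 0) * z\<^sup>2 + minors3 (W 0) * z - det (W 0) = 0"
    from roots[OF this] show "z \<in> \<real> \<and> z \<noteq> 0 \<and> 3 * z\<^sup>2 - 2 * tr3 (W 0) * z + minors3 (W 0) \<noteq> 0" by blast
  next
    fix r assume r: "0 < r" "\<And>\<mu> l. cmod \<mu> < r \<Longrightarrow> Re \<mu> \<noteq> 0 \<Longrightarrow> cmod l = 1
      \<Longrightarrow> ((l - 1) / \<mu>)^3 - tr3 (W \<mu>) * ((l - 1) / \<mu>)\<^sup>2 + minors3 (W \<mu>) * ((l - 1) / \<mu>) - det (W \<mu>) = 0
      \<Longrightarrow> ((l - 1) / (- cnj \<mu>))^3 - tr3 (W (- cnj \<mu>)) * ((l - 1) / (- cnj \<mu>))\<^sup>2 + minors3 (W (- cnj \<mu>)) * ((l - 1) / (- cnj \<mu>)) - det (W (- cnj \<mu>)) = 0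
      \<Longrightarrow> False"
    show thesis
    proof (rule that[OF r(1)])
    fix \<mu> l y assume a: "cmod \<mu> < r" "Re \<mu> \<noteq> 0" "cmod l = 1" "monodromy \<mu> *v y = l *s y"
    have \<mu>: "\<mu> \<noteq> 0" using a(2) by auto
    show "y = 0"
    proof (rule ccontr)
      assume y: "y \<noteq> 0"
      obtain z where z: "z \<noteq> 0" "monodromy (- cnj \<mu>) *v z = l *s z"
        by (rule unimodular_multiplier_reflect[OF \<mu> a(3) y a(4)])
      have \<mu>': "- cnj \<mu> \<noteq> 0" using \<mu> by simp
      show False
        using r(2)[OF a(1-3)] multiplier_imp_eigenvalue[OF \<mu> y a(4)] multiplier_imp_eigenvalue[OF \<mu>' z]
        unfolding det_diff_mat_3 by simp
    qed
  qed
  qed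
qed

end

section \<open>Modulational stability\<close>

locale wave_family =
  fixes f F :: "real \<Rightarrow> real" and \<Omega> :: "(real^3) set" and um up :: "real^3 \<Rightarrow> real"
    and u :: "real^3 \<Rightarrow> real \<Rightarrow> real" and c0 :: real and q0 :: "real^3" and D :: "real^3 \<Rightarrow> real \<Rightarrow> real"
  assumes f: "C2_fun f" and F: "\<And>v. (F has_real_derivative f v) (at v)"
    and \<Omega>: "open \<Omega>" "aEc c0 q0 \<in> \<Omega>" and q0: "q0 $ 3 = 0"
    and roots: "\<And>p. p \<in> \<Omega> \<Longrightarrow> potential_well F (p$1) (p$2) (p$3) (um p) (up p)"
    and profile: "\<And>p. p \<in> \<Omega> \<Longrightarrow> periodic_profile f F (p$1) (p$2) (p$3) (u p) \<and> u p 0 = um p"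
    and TMP: "TMP F um up u differentiable (at (aEc c0 q0))"
    and lu: "has_lu_differential (\<lambda>q. u (aEc c0 q)) D q0"
begin

definition p0 :: "real^3" where "p0 = aEc c0 q0"

text \<open>The differential in the variables \<open>(a, E, s)\<close>; the sign of the last
  component stems from \<open>c = c0 - s\<close>.\<close>

definition dTMP :: "real^3 \<Rightarrow> real^3" where
  "dTMP h = frechet_derivative (TMP F um up u) (at p0) (vector [h $ 1, h $ 2, - h $ 3])"

lemma TMP_has_derivative: "((\<lambda>q. TMP F um up u (aEc c0 q)) has_derivative dTMP) (at q0)"
  using diff_chain_at[OF aEc_has_derivative TMP[unfolded frechet_derivative_works]]
  by (simp add: o_def dTMP_def[abs_def] p0_def)

lemma component_derivatives:
  "((\<lambda>q. wave_period F um up (aEc c0 q)) has_derivative (\<lambda>h. dTMP h $ 1)) (at q0)"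
  "((\<lambda>q. wave_mass F um up u (aEc c0 q)) has_derivative (\<lambda>h. dTMP h $ 2)) (at q0)"
  "((\<lambda>q. wave_momentum F um up u (aEc c0 q)) has_derivative (\<lambda>h. dTMP h $ 3)) (at q0)"
  using bounded_linear.has_derivative[OF bounded_linear_vec_nth[of 1] TMP_has_derivative]
    bounded_linear.has_derivative[OF bounded_linear_vec_nth[of 2] TMP_has_derivative]
    bounded_linear.has_derivative[OF bounded_linear_vec_nth[of 3] TMP_has_derivative]
  by (simp_all add: TMP_def)

lemma wave_facts:
  assumes "p \<in> \<Omega>"
  shows "(u p has_real_derivative deriv (u p) x) (at x)"
    "(deriv (u p) has_real_derivative p$1 + p$3 * u p x - f (u p x)) (at x)"
    "deriv (u p) 0 = 0" "p$2 - potential F (p$1) (p$3) (u p 0) = 0"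
    "(deriv (u p) x)\<^sup>2 / 2 = p$2 - potential F (p$1) (p$3) (u p x)"
    "0 < wave_period F um up p" "u p (x + wave_period F um up p) = u p x" "p$1 + p$3 * um p - f (um p) > 0"
proof -
  note w = roots[OF assms] profile[OF assms, THEN conjunct1] profile[OF assms, THEN conjunct2]
  show "(u p has_real_derivative deriv (u p) x) (at x)"
    "(deriv (u p) has_real_derivative p$1 + p$3 * u p x - f (u p x)) (at x)"
    "(deriv (u p) x)\<^sup>2 / 2 = p$2 - potential F (p$1) (p$3) (u p x)"
    by (rule profile_second_order[OF f F w(2)])+
  show "deriv (u p) 0 = 0" "p$1 + p$3 * um p - f (um p) > 0" by (rule profile_rise[OF f F w])+
  show "0 < wave_period F um up p" "u p (x + wave_period F um up p) = u p x"
    unfolding wave_period_def by (rule profile_period[OF f F w])+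
  show "p$2 - potential F (p$1) (p$3) (u p 0) = 0"
    using w(1) by (simp add: potential_well_def simple_root_def w(3))
qed

definition line :: "real^3 \<Rightarrow> real \<Rightarrow> real^3" where "line h t = aEc c0 (q0 + t *\<^sub>R h)"

lemma line_nth: "line h t $ 1 = p0 $ 1 + t * h $ 1" "line h t $ 2 = p0 $ 2 + t * h $ 2" "line h t $ 3 = p0 $ 3 - t * h $ 3"
  and line_0: "line h 0 = p0"
  by (simp_all add: line_def p0_def aEc_nth)

lemma p0_3: "p0 $ 3 = c0" by (simp add: p0_def aEc_nth q0)

lemma p0_in: "p0 \<in> \<Omega>" unfolding p0_def by (rule \<Omega>)

lemma line_in: "\<forall>\<^sub>F t in nhds 0. line h t \<in> \<Omega>"
proof -
  have "((\<lambda>t. q0 + t *\<^sub>R h) \<longlongrightarrow> q0 + 0 *\<^sub>R h) (nhds 0)" by (intro tendsto_intros filterlim_ident)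
  then have "((\<lambda>t. q0 + t *\<^sub>R h) \<longlongrightarrow> q0) (nhds 0)" by simp
  moreover have "isCont (aEc c0) q0" by (rule has_derivative_continuous[OF aEc_has_derivative])
  ultimately have "(line h \<longlongrightarrow> aEc c0 q0) (nhds 0)"
    unfolding line_def[abs_def] by (rule isCont_tendsto_compose[rotated])
  then show ?thesis using \<Omega> by (rule topological_tendstoD)
qed

lemma variation:
  assumes "h \<noteq> 0"
  shows "wave_variation f F (\<lambda>t. u (line h t)) (\<lambda>t. deriv (u (line h t))) (D h)
    (p0 $ 1) (p0 $ 2) c0 (h $ 1) (h $ 2) (h $ 3) (dTMP h $ 1) (\<lambda>t. wave_period F um up (line h t))"
proof
  show "C2_fun f" by (rule f)
  show "(F has_real_derivative f v) (at v)" for v by (rule F)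
  show "((\<lambda>t. wave_period F um up (line h t)) has_real_derivative dTMP h $ 1) (at 0)"
    unfolding line_def by (rule directional_derivative[OF component_derivatives(1)])
  show "0 < wave_period F um up (line h 0)" unfolding line_0 by (rule wave_facts[OF p0_in])
  show "uniform_limit K (\<lambda>t x. (u (line h t) x - u (line h 0) x) / t) (D h) (at 0)" if "compact K" for K
    using lu_differential_directional[OF lu assms that] by (simp add: line_def)
  show "\<forall>\<^sub>F t in nhds 0. (\<forall>x. (u (line h t) has_real_derivative deriv (u (line h t)) x) (at x)) \<and>
      (\<forall>x. (deriv (u (line h t)) has_real_derivative p0 $ 1 + t * h $ 1 + (c0 - t * h $ 3) * u (line h t) x - f (u (line h t) x)) (at x)) \<and>
      deriv (u (line h t)) 0 = 0 \<and> p0 $ 2 + t * h $ 2 - potential F (p0 $ 1 + t * h $ 1) (c0 - t * h $ 3) (u (line h t) 0) = 0 \<and>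
      (\<forall>x. u (line h t) (x + wave_period F um up (line h t)) = u (line h t) x)"
    using line_in
  proof (rule eventually_mono)
    fix t assume "line h t \<in> \<Omega>"
    from wave_facts[OF this, unfolded line_nth p0_3]
    show "(\<forall>x. (u (line h t) has_real_derivative deriv (u (line h t)) x) (at x)) \<and>
      (\<forall>x. (deriv (u (line h t)) has_real_derivative p0 $ 1 + t * h $ 1 + (c0 - t * h $ 3) * u (line h t) x - f (u (line h t) x)) (at x)) \<and>
      deriv (u (line h t)) 0 = 0 \<and> p0 $ 2 + t * h $ 2 - potential F (p0 $ 1 + t * h $ 1) (c0 - t * h $ 3) (u (line h t) 0) = 0 \<and>
      (\<forall>x. u (line h t) (x + wave_period F um up (line h t)) = u (line h t) x)"
      by blast
  qed
qed

definition T0 :: real where "T0 = wave_period F um up p0"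

definition q :: "real \<Rightarrow> real" where "q x = c0 - deriv f (u p0 x)"

text \<open>The second derivative of the profile at the turning point \<open>um p0\<close>, nonzero
  because the root is simple.\<close>

definition \<kappa> :: real where "\<kappa> = p0 $ 1 + c0 * um p0 - f (um p0)"

lemma u_p0_continuous: "continuous_on S (u p0)"
  using wave_facts(1)[OF p0_in] by (meson DERIV_isCont continuous_at_imp_continuous_on)

lemma hill_q: "hill q T0"
proof
  show "continuous_on UNIV q"
    unfolding q_def by (intro continuous_intros continuous_on_compose2[OF C2_fun_D(4)[OF f, of UNIV] u_p0_continuous]) simp
  show "0 < T0" unfolding T0_def by (rule wave_facts[OF p0_in])
  show "q (x + T0) = q x" for x unfolding q_def T0_def by (simp only: wave_facts(7)[OF p0_in])
qed

lemma wave_mass_fold: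
  "integral {0..wave_period F um up (line h t)} (u (line h t)) = wave_mass F um up u (aEc c0 (q0 + t *\<^sub>R h))"
  "integral {0..wave_period F um up (line h t)} (\<lambda>x. (u (line h t) x)\<^sup>2) = wave_momentum F um up u (aEc c0 (q0 + t *\<^sub>R h))"
  by (simp_all add: wave_mass_def wave_momentum_def line_def)

text \<open>The variations are the values of the differential \<open>D\<close> on the unit vectors.
  The gradients of mass and momentum are obtained twice along each axis, from \<open>dTMP\<close>
  and from the integrals, and uniqueness of derivatives equates them.\<close>

lemma modulation_exists:
  obtains \<phi> \<phi>1 where "modulation q T0 (u p0) (deriv (u p0)) (\<lambda>x. p0 $ 1 + c0 * u p0 x - f (u p0 x)) \<phi> \<phi>1 (um p0) \<kappa>
    (\<chi> j. dTMP (axis j 1) $ 1) (\<chi> j. dTMP (axis j 1) $ 2) (\<chi> j. dTMP (axis j 1) $ 3)"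
proof -
  note w = wave_facts[OF p0_in, unfolded p0_3, folded T0_def]
  let ?h = "\<lambda>j. axis j 1 :: real^3"
  have ne: "?h j \<noteq> 0" for j by simp
  interpret v: wave_variation f F "\<lambda>t. u (line (?h j) t)" "\<lambda>t. deriv (u (line (?h j) t))" "D (?h j)"
    "p0 $ 1" "p0 $ 2" c0 "?h j $ 1" "?h j $ 2" "?h j $ 3" "dTMP (?h j) $ 1" "\<lambda>t. wave_period F um up (line (?h j) t)" for j
    by (rule variation[OF ne])
  have "\<exists>\<phi>'. (\<forall>x. (D (?h j) has_real_derivative \<phi>' x) (at x)) \<and>
    (\<forall>x. (\<phi>' has_real_derivative ?h j $ 1 + c0 * D (?h j) x - ?h j $ 3 * u p0 x - deriv f (u p0 x) * D (?h j) x) (at x)) \<and> \<phi>' 0 = 0" for j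
    using v.phi_ode[of j] unfolding line_0 by metis
  then obtain \<phi>1 where \<phi>1: "\<And>j x. (D (?h j) has_real_derivative \<phi>1 j x) (at x)"
    "\<And>j x. (\<phi>1 j has_real_derivative ?h j $ 1 + c0 * D (?h j) x - ?h j $ 3 * u p0 x - deriv f (u p0 x) * D (?h j) x) (at x)"
    "\<And>j. \<phi>1 j 0 = 0"
    by metis
  note jump = v.phi_jump[unfolded line_0, folded T0_def]
  have uT: "u p0 T0 = u p0 0" using w(7)[of 0] by simp
  have u0: "u p0 0 = um p0" using profile[OF p0_in] by simp
  \<comment> \<open>Derivative in \<open>x\<close> of the jump relation, which gives the jump of the
    slopes of the variations.\<close>
  have jump1: "\<phi>1 j (x + T0) + dTMP (?h j) $ 1 * (p0 $ 1 + c0 * u p0 x - f (u p0 x)) = \<phi>1 j x" for j x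
  proof -
    have "((\<lambda>x. D (?h j) (x + T0) + dTMP (?h j) $ 1 * deriv (u p0) x) has_real_derivative
        \<phi>1 j (x + T0) + dTMP (?h j) $ 1 * (p0 $ 1 + c0 * u p0 x - f (u p0 x))) (at x)"
      using \<phi>1(1)[of j "x + T0"] w(2) by (intro DERIV_add DERIV_cmult) (simp_all add: DERIV_shift)
    then show ?thesis unfolding jump using \<phi>1(1) by (rule DERIV_unique)
  qed
  show ?thesis
  proof (rule that[of "\<lambda>j. D (?h j)" \<phi>1], rule modulation.intro[OF hill_q], unfold_locales)
    fix x :: real and j :: 3
    show "(u p0 has_real_derivative deriv (u p0) x) (at x)" by (rule w)
    show "(deriv (u p0) has_real_derivative p0 $ 1 + c0 * u p0 x - f (u p0 x)) (at x)" by (rule w)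
    show "((\<lambda>x. p0 $ 1 + c0 * u p0 x - f (u p0 x)) has_real_derivative q x * deriv (u p0) x) (at x)"
      by (rule derivative_eq_intros DERIV_chain2[OF C2_fun_D(1)[OF f] w(1)] w(1) refl)+ (simp add: q_def algebra_simps)
    show "u p0 0 = um p0" "deriv (u p0) 0 = 0" "p0 $ 1 + c0 * u p0 0 - f (u p0 0) = \<kappa>" "u p0 T0 = um p0"
      "p0 $ 1 + c0 * u p0 T0 - f (u p0 T0) = \<kappa>"
      using w(3) by (simp_all add: u0 uT \<kappa>_def)
    \<comment> \<open>After one period the wave is back at the turning point, where the energy
      leaves no kinetic part.\<close>
    show "deriv (u p0) T0 = 0" using w(4) w(5)[of T0] by (simp add: uT)
    show "\<kappa> \<noteq> 0" using w(8) by (simp add: \<kappa>_def)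
    show "(D (?h j) has_real_derivative \<phi>1 j x) (at x)" by (rule \<phi>1)
    show "(\<phi>1 j has_real_derivative q x * D (?h j) x - (if j = 1 then - 1 else if j = 3 then u p0 x else 0)) (at x)"
    proof -
      have "?h j $ 1 + c0 * D (?h j) x - ?h j $ 3 * u p0 x - deriv f (u p0 x) * D (?h j) x
          = q x * D (?h j) x - (if j = 1 then - 1 else if j = 3 then u p0 x else 0)"
        using exhaust_3[of j] by (auto simp: q_def axis_def algebra_simps)
      then show ?thesis using \<phi>1(2)[of j x] by simp
    qed
    show "\<phi>1 j 0 = 0" by (rule \<phi>1)
    show "\<kappa> * D (?h j) 0 = - (if j = 1 then um p0 else if j = 2 then 1 else - (um p0)\<^sup>2 / 2)"
      using v.phi_0[of j] exhaust_3[of j] unfolding line_0 u0 \<kappa>_def by (auto simp: axis_def)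
    show "D (?h j) T0 = D (?h j) 0" using jump[of j 0] w(3) by simp
    show "\<phi>1 j T0 = - (\<chi> j. dTMP (?h j) $ 1) $ j * \<kappa>"
      using jump1[of j 0] \<phi>1(3)[of j] by (simp add: u0 \<kappa>_def)
    show "(\<chi> j. dTMP (?h j) $ 2) $ j = integral {0..T0} (D (?h j)) + um p0 * (\<chi> j. dTMP (?h j) $ 1) $ j"
      using DERIV_unique[OF directional_derivative[OF component_derivatives(2), of "?h j"]
          v.mass_derivative[of j, unfolded wave_mass_fold]]
      by (simp add: line_0 u0 T0_def)
    show "(\<chi> j. dTMP (?h j) $ 3) $ j = integral {0..T0} (\<lambda>x. 2 * u p0 x * D (?h j) x) + (um p0)\<^sup>2 * (\<chi> j. dTMP (?h j) $ 1) $ j"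
      using DERIV_unique[OF directional_derivative[OF component_derivatives(3), of "?h j"]
          v.momentum_derivative[of j, unfolded wave_mass_fold]]
      by (simp add: line_0 u0 T0_def)
  qed
qed

text \<open>The radius without unimodular multipliers off the imaginary axis serves as the
  neighbourhood: every such point in the ball lies in the resolvent set.\<close>

theorem spectrum_near_origin:
  assumes det: "det (jacobian (TMP F um up u) (at p0)) \<noteq> 0"
    and hyperbolic: "only_simple_real_eigenvalues (whitham_matrix F um up u c0 q0)"
  shows "modulationally_stable f (u p0) c0"
proof -
  obtain \<phi> \<phi>1 where m: "modulation q T0 (u p0) (deriv (u p0)) (\<lambda>x. p0 $ 1 + c0 * u p0 x - f (u p0 x)) \<phi> \<phi>1 (um p0) \<kappa>
    (\<chi> j. dTMP (axis j 1) $ 1) (\<chi> j. dTMP (axis j 1) $ 2) (\<chi> j. dTMP (axis j 1) $ 3)"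
    by (rule modulation_exists)
  interpret m: modulation q T0 "u p0" "deriv (u p0)" "\<lambda>x. p0 $ 1 + c0 * u p0 x - f (u p0 x)" \<phi> \<phi>1 "um p0" \<kappa>
    "\<chi> j. dTMP (axis j 1) $ 1" "\<chi> j. dTMP (axis j 1) $ 2" "\<chi> j. dTMP (axis j 1) $ 3" by (rule m)
  have A_eq: "whitham_matrix F um up u c0 q0 = (\<chi> i j. (if i = 1 then dTMP (axis j 1) $ 2 else if i = 2 then - dTMP (axis j 1) $ 3 / 2 else dTMP (axis j 1) $ 1) / T0)"
    using whitham_matrix_eq[OF component_derivatives q0] wave_facts(6)[OF p0_in] by (simp add: T0_def p0_def)
  define J where "J = (\<chi> i j. if i = 1 then (\<chi> j. dTMP (axis j 1) $ 1) $ j else if i = 2 then (\<chi> j. dTMP (axis j 1) $ 2) $ j else (\<chi> j. dTMP (axis j 1) $ 3) $ j :: real^3^3)"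
  let ?K = "jacobian (TMP F um up u) (at p0)"
  have d: "(TMP F um up u has_derivative frechet_derivative (TMP F um up u) (at p0)) (at p0)"
    using TMP by (simp add: p0_def frechet_derivative_works)
  have vec: "vector [axis j 1 $ 1, axis j 1 $ 2, - axis j 1 $ 3] = (if j = 3 then - 1 else 1) *\<^sub>R (axis j 1 :: real^3)" for j :: 3
    using exhaust_3[of j] by (auto simp: vec_eq_iff forall_3 axis_def)
  have "dTMP (axis j 1) $ i = (if j = 3 then - 1 else 1) * ?K $ i $ j" for i j
    unfolding dTMP_def vec jacobian_nth[OF d] by (simp add: linear_scale[OF has_derivative_linear[OF d]])
  \<comment> \<open>Passing from \<open>c\<close> to \<open>s\<close> reverses the sign of one
    column.\<close>
  then have "det J = - det ?K" unfolding J_def det_3 by (simp add: algebra_simps)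
  then have "det J \<noteq> 0" using det by simp
  note detJ = this[unfolded J_def]
  have A_eq': "whitham_matrix F um up u c0 q0 = (\<chi> i j. (if i = 1 then (\<chi> j. dTMP (axis j 1) $ 2) $ j
      else if i = 2 then - (\<chi> j. dTMP (axis j 1) $ 3) $ j / 2 else (\<chi> j. dTMP (axis j 1) $ 1) $ j) / T0)"
    by (simp only: A_eq vec_lambda_beta)
  obtain r where r: "0 < r" "\<And>\<mu> l y. cmod \<mu> < r \<Longrightarrow> Re \<mu> \<noteq> 0 \<Longrightarrow> cmod l = 1 \<Longrightarrow> m.monodromy \<mu> *v y = l *s y \<Longrightarrow> y = 0"
    by (rule m.no_unimodular_multiplier[OF hyperbolic detJ A_eq']) blast
  show ?thesis
    unfolding modulationally_stable_def
  proof (intro exI[of _ "ball 0 r"] conjI subsetI)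
    fix \<mu> assume \<mu>: "\<mu> \<in> L2_spectrum (linearized_op f (u p0) c0) \<inter> ball 0 r"
    show "\<mu> \<in> {z. Re z = 0}"
    proof (rule ccontr)
      assume "\<mu> \<notin> {z. Re z = 0}"
      then have "\<mu> \<in> L2_resolvent_set (linearized_op f (u p0) c0)"
        using \<mu> r(2) by (intro m.resolvent_of_linearized_op) (auto simp: q_def)
      then show False using \<mu> by (simp add: L2_spectrum_def)
    qed
  qed (use r in auto)
qed

end

theorem mainTheorem3:
  fixes f F :: "real \<Rightarrow> real"
    and \<Omega> :: "(real^3) set"
    and um up :: "real^3 \<Rightarrow> real"
    and u :: "real^3 \<Rightarrow> real \<Rightarrow> real"
    and a0 E0 c0 :: real
  assumes f_smooth: "C2_fun f"
    and F_antideriv: "\<And>v. (F has_real_derivative f v) (at v)" "F 0 = 0"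
    and params: "open \<Omega>" "vector [a0, E0, c0] \<in> \<Omega>"
    and roots: "\<And>p. p \<in> \<Omega> \<Longrightarrow> potential_well F (p$1) (p$2) (p$3) (um p) (up p)"
    and profile: "\<And>p. p \<in> \<Omega> \<Longrightarrow> periodic_profile f F (p$1) (p$2) (p$3) (u p) \<and> u p 0 = um p"
    and TMP_C1: "C1_map_on \<Omega> (TMP F um up u)"
    and jacobian_TMP: "det (jacobian (TMP F um up u) (at (vector [a0, E0, c0]))) \<noteq> 0"
    and nonsingular: "nonsingular_mod_translation (traveling_waves \<Omega> u)
          (\<lambda>q. u (aEc c0 q)) (vector [a0, E0, 0])"
    and hyperbolic: "only_simple_real_eigenvalues
          (whitham_matrix F um up u c0 (vector [a0, E0, 0]))"
  shows "modulationally_stable f (u (vector [a0, E0, c0])) c0"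
proof -
  \<comment> \<open>The differential of the wave in \<open>(a, E, s)\<close> provides the variations
    on which the expansion of the monodromy matrix rests.\<close>
  obtain D where D: "has_lu_differential (\<lambda>q. u (aEc c0 q)) D (vector [a0, E0, 0])"
    using nonsingular unfolding nonsingular_mod_translation_def by blast
  have p: "aEc c0 (vector [a0, E0, 0]) = vector [a0, E0, c0]"
    by (simp add: vec_eq_iff forall_3 aEc_def)
  interpret wave_family f F \<Omega> um up u c0 "vector [a0, E0, 0]" D
    using f_smooth F_antideriv(1) params roots profile TMP_C1 D
    by unfold_locales (auto simp: p C1_map_on_def)
  show ?thesis
    using spectrum_near_origin jacobian_TMP hyperbolic by (simp add: p0_def p)
qed

end
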